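(* Let $n\ge 1$ and $m\geq 2$ be integers and let $p\ge 1$ be a real number. Let $f:\mathbb{R}\to\mathbb{R}$ be a function such that the composition operator $N_f: g\mapsto f\circ g$ sends $\dot{A}^m_p(\mathbb{R}^n)$ to itself. Let $\alpha\in\mathbb{N}^n$ be such that $0<|\alpha|\le m$. Then, for all $g\in\dot{A}^m_p(\mathbb{R}^n)$, the formula $$(f\circ g)^{(\alpha)}=\sum_{s=1}^{|\alpha|}\ \sum_{\substack{\gamma=(\gamma_1,\dots,\gamma_s)\\ \gamma_r\in\mathbb{N}^n\setminus\{0\},\ \gamma_1+\cdots+\gamma_s=\alpha}} c_{\alpha,s,\gamma}\,(f^{(s)}\circ g)\,g^{(\gamma_1)}\cdots g^{(\gamma_s)}$$ holds in the sense of distributions on $\mathbb{R}^n$ and almost everywhere.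
   Context: $\mathbb{N}$ includes $0$; all functions are real valued; for $\alpha\in\mathbb{N}^n$, $|\alpha|=\alpha_1+\dots+\alpha_n$ and $g^{(\alpha)}$ is the partial derivative of order $\alpha$ (in the sense of distributions when $g$ is not smooth). Measurable functions on $\mathbb{R}^n$ equal a.e. are identified into classes. $\dot W^k_q(\mathbb{R}^n)$ is the space of distributions $g$ with $g^{(\alpha)}\in L_q(\mathbb{R}^n)$ for all $|\alpha|=k$. The homogeneous Adams-Frazier space is $\dot A^m_p(\mathbb{R}^n)=\dot W^m_p(\mathbb{R}^n)\cap\dot W^1_{mp}(\mathbb{R}^n)$; its elements are (classes of) locally integrable functions. "$N_f$ sends $X$ to itself" means that for each $g\in X$ the class of $f\circ g$ belongs to $X$. Meaning of the right-hand side. It is known that any $f$ satisfying the hypothesis is of class $C^{m-1}$ with $f^{(m-1)}$ locally absolutely continuous. For $s<m$, $f^{(s)}$ is this continuous derivative, and $(f^{(s)}\circ g)\,g^{(\gamma_1)}\cdots g^{(\gamma_s)}$ is the class of the pointwise product formed from any representatives of $g, g^{(\gamma_1)},\dots,g^{(\gamma_s)}$. For $s=m$, $f^{(m)}$ is only a class of locally integrable functions on $\mathbb{R}$; the product $(f^{(m)}\circ g)\,g^{(\gamma_1)}\cdots g^{(\gamma_m)}$ is the class of $x\mapsto u(v(x))\,w_1(x)\cdots w_m(x)$, where $u,v,w_r$ are arbitrary representatives of $f^{(m)},g,g^{(\gamma_r)}$, and the formula is understood to include that this class does not depend on the representatives (in particular not on $u$). The numbers $c_{\alpha,s,\gamma}$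 are the combinatorial constants of the classical Faà di Bruno formula, i.e. those for which the displayed formula holds for all smooth $f:\mathbb{R}\to\mathbb{R}$, $g:\mathbb{R}^n\to\mathbb{R}$; with the sum over ordered tuples one may take $c_{\alpha,s,\gamma}=\frac{\alpha!}{s!\,\gamma_1!\cdots\gamma_s!}$. *)

theory Defs
  imports "HOL-Analysis.Analysis"
begin

section \<open>Test functions and distributions\<close>

definition directional_deriv :: "'a::euclidean_space \<Rightarrow> ('a \<Rightarrow> real) \<Rightarrow> 'a \<Rightarrow> real" where
  "directional_deriv b \<phi> = (\<lambda>x. frechet_derivative \<phi> (at x) b)"

definition iter_deriv :: "'a::euclidean_space list \<Rightarrow> ('a \<Rightarrow> real) \<Rightarrow> 'a \<Rightarrow> real" where
  "iter_deriv bs \<phi> = foldr directional_deriv bs \<phi>"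

definition smooth :: "('a::euclidean_space \<Rightarrow> real) \<Rightarrow> bool" where
  "smooth \<phi> \<longleftrightarrow> (\<forall>bs. set bs \<subseteq> Basis \<longrightarrow> (\<forall>x. iter_deriv bs \<phi> differentiable (at x)))"

definition test_functions :: "('a::euclidean_space \<Rightarrow> real) set" where
  "test_functions = {\<phi>. smooth \<phi> \<and> compact (closure {x. \<phi> x \<noteq> 0})}"

text \<open>Functionals are kept extensional, i.e. \<open>undefined\<close> off the test functions, so that
  equality of distributions is plain equality.\<close>

type_synonym 'a distribution = "('a \<Rightarrow> real) \<Rightarrow> real"

definition distributions :: "'a::euclidean_space distribution set" where
  "distributions = {T \<in> extensional test_functions.
     (\<forall>\<phi>\<in>test_functions. \<forall>\<psi>\<in>test_functions. \<forall>a b.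
        T (\<lambda>x. a * \<phi> x + b * \<psi> x) = a * T \<phi> + b * T \<psi>) \<and>
     (\<forall>K. compact K \<longrightarrow> (\<exists>C N. \<forall>\<phi>\<in>test_functions. \<forall>M.
        {x. \<phi> x \<noteq> 0} \<subseteq> K \<and>
        (\<forall>bs x. set bs \<subseteq> Basis \<and> length bs \<le> N \<longrightarrow> \<bar>iter_deriv bs \<phi> x\<bar> \<le> M)
        \<longrightarrow> \<bar>T \<phi>\<bar> \<le> C * M))}"

definition dist_deriv :: "'a::euclidean_space list \<Rightarrow> 'a distribution \<Rightarrow> 'a distribution" where
  "dist_deriv bs T = (\<lambda>\<phi>\<in>test_functions. (-1) ^ length bs * T (iter_deriv bs \<phi>))"

definition locally_integrable :: "('a::euclidean_space \<Rightarrow> real) \<Rightarrow> bool" where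
  "locally_integrable u \<longleftrightarrow> (\<forall>K. compact K \<longrightarrow> u absolutely_integrable_on K)"

definition dist_of :: "('a::euclidean_space \<Rightarrow> real) \<Rightarrow> 'a distribution" where
  "dist_of u = (\<lambda>\<phi>\<in>test_functions. \<integral>x. u x * \<phi> x \<partial>lebesgue)"

text \<open>Two locally integrable functions represent the same distribution iff they agree almost
  everywhere, so the functions representing \<open>T\<close> are the members of one class modulo a.e.\
  equality.\<close>

definition represents :: "('a::euclidean_space \<Rightarrow> real) \<Rightarrow> 'a distribution \<Rightarrow> bool" where
  "represents u T \<longleftrightarrow> locally_integrable u \<and> T = dist_of u"

section \<open>Multi-indices\<close>

type_synonym 'n multi_index = "'n \<Rightarrow> nat"

definition mi_order :: "'n::finite multi_index \<Rightarrow> nat" where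
  "mi_order \<alpha> = (\<Sum>i\<in>UNIV. \<alpha> i)"

definition mi_fact :: "'n::finite multi_index \<Rightarrow> real" where
  "mi_fact \<alpha> = (\<Prod>i\<in>UNIV. fact (\<alpha> i))"

text \<open>The order in which the coordinate directions are listed is immaterial, since partial
  derivatives of test functions commute.\<close>

definition mi_list :: "'n::finite multi_index \<Rightarrow> 'n list" where
  "mi_list \<alpha> = (SOME is. \<forall>i. count_list is i = \<alpha> i)"

definition mderiv ::
    "'n::finite multi_index \<Rightarrow> (real^'n) distribution \<Rightarrow> (real^'n) distribution" where
  "mderiv \<alpha> T = dist_deriv (map (\<lambda>i. axis i 1) (mi_list \<alpha>)) T"

section \<open>Function spaces and composition operators\<close>

definition Lebesgue_space :: "real \<Rightarrow> ('a::euclidean_space \<Rightarrow> real) set" where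
  "Lebesgue_space q =
     {u \<in> borel_measurable lebesgue. integrable lebesgue (\<lambda>x. \<bar>u x\<bar> powr q)}"

definition homogeneous_Sobolev :: "nat \<Rightarrow> real \<Rightarrow> (real^'n::finite) distribution set" where
  "homogeneous_Sobolev k q =
     {T \<in> distributions. \<forall>\<alpha>. mi_order \<alpha> = k \<longrightarrow> (\<exists>u\<in>Lebesgue_space q. mderiv \<alpha> T = dist_of u)}"

definition adams_frazier :: "nat \<Rightarrow> real \<Rightarrow> (real^'n::finite) distribution set" where
  "adams_frazier m p = homogeneous_Sobolev m p \<inter> homogeneous_Sobolev 1 (real m * p)"

definition composition_preserves ::
    "(real \<Rightarrow> real) \<Rightarrow> 'a::euclidean_space distribution set \<Rightarrow> bool" where
  "composition_preserves f X \<longleftrightarrow>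
     (\<forall>G\<in>X. \<forall>g. represents g G \<longrightarrow> (\<exists>H\<in>X. represents (f \<circ> g) H))"

section \<open>The right-hand side of the chain rule\<close>

text \<open>\<open>F s\<close> is the \<open>s\<close>-th derivative of \<open>f\<close>: for \<open>s < m\<close> the classical one, all of these being
  continuous, and for \<open>s = m\<close> an arbitrary locally integrable representative of the
  distributional derivative of \<open>F (m - 1)\<close>.  As \<open>F (m - 1)\<close> is continuous, the last condition
  also says that it is locally absolutely continuous.  The values \<open>F s\<close> for \<open>s > m\<close> are
  irrelevant.\<close>

definition derivative_reps :: "nat \<Rightarrow> (real \<Rightarrow> real) \<Rightarrow> (nat \<Rightarrow> real \<Rightarrow> real) \<Rightarrow> bool" where
  "derivative_reps m f F \<longleftrightarrow>
     F 0 = f \<and>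
     (\<forall>s<m - 1. \<forall>t. (F s has_real_derivative F (Suc s) t) (at t)) \<and>
     continuous_on UNIV (F (m - 1)) \<and>
     represents (F m) (dist_deriv [1] (dist_of (F (m - 1))))"

definition partial_reps ::
    "'n::finite multi_index \<Rightarrow> (real^'n) distribution \<Rightarrow> ('n multi_index \<Rightarrow> real^'n \<Rightarrow> real) \<Rightarrow> bool"
  where
  "partial_reps \<alpha> G D \<longleftrightarrow> (\<forall>\<beta>\<le>\<alpha>. represents (D \<beta>) (mderiv \<beta> G))"

definition mi_tuples :: "nat \<Rightarrow> 'n::finite multi_index \<Rightarrow> 'n multi_index list set" where
  "mi_tuples s \<alpha> =
     {\<gamma>. length \<gamma> = s \<and> (\<lambda>_. 0) \<notin> set \<gamma> \<and> (\<forall>i. (\<Sum>r<s. (\<gamma> ! r) i) = \<alpha> i)}"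

definition faa_coeff :: "'n::finite multi_index \<Rightarrow> nat \<Rightarrow> 'n multi_index list \<Rightarrow> real" where
  "faa_coeff \<alpha> s \<gamma> = mi_fact \<alpha> / (fact s * (\<Prod>r<s. mi_fact (\<gamma> ! r)))"

definition faa_di_bruno ::
    "'n::finite multi_index \<Rightarrow> (nat \<Rightarrow> real \<Rightarrow> real) \<Rightarrow> (real^'n \<Rightarrow> real) \<Rightarrow>
     ('n multi_index \<Rightarrow> real^'n \<Rightarrow> real) \<Rightarrow> real^'n \<Rightarrow> real" where
  "faa_di_bruno \<alpha> F g D x =
     (\<Sum>s = 1..mi_order \<alpha>. \<Sum>\<gamma>\<in>mi_tuples s \<alpha>.
        faa_coeff \<alpha> s \<gamma> * F s (g x) * (\<Prod>r<s. D (\<gamma> ! r) x))"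

end

theory Submission
  imports Defs
begin

text \<open>Weak derivatives are handled as limits of difference quotients: if \<open>h\<close> is the weak derivative of \<open>u\<close> in
  the direction \<open>b\<close>, then for almost every \<open>x\<close> the function \<open>t \<mapsto> u (x + t b)\<close> is differentiable at \<open>0\<close> along
  \<open>t = 1, 1/2, 1/3, \<dots>\<close> with derivative \<open>h x\<close>.  All derivatives of \<open>g\<close> and of \<open>f \<circ> g\<close> up to order \<open>m\<close> are locally
  integrable, so the formula follows by induction on the order from the ordinary product and chain rules at such
  points, without any integrability estimate for the right-hand side.  Only at the top order may the outer
  derivative \<open>f\<^bsup>(m-1)\<^esup>\<close> fail to be differentiable, and then only for \<open>g x\<close> in a null set; there all first derivatives
  of \<open>g\<close> vanish almost everywhere, and so does the cofactor.  The regularity of \<open>f\<close> comes from testing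
  the hypothesis on functions of one coordinate, among them one that is constant on a half space and flat at its boundary,
  which excludes the modification of \<open>f\<close> at single points.\<close>

section \<open>Smooth functions\<close>

text \<open>The obstacle is that the summands on the right are not known to be locally integrable
  one by one, and that mollifying \<open>g\<close> gives no control over the products. A sequence of
  difference quotients has at most one limit, so a pointwise computation identifies the weak
  derivative of \<open>f \<circ> g\<close> without any convergence of integrals. This needs
  intermediate weak derivatives that are functions, whereas the space only prescribes orders 1 and
  \<open>m\<close>; they are obtained by descending from order \<open>m\<close>, each derivative
  being recovered from its gradient. At an exceptional point of \<open>f^(m-1)\<close>, continuity
  is enough because a continuous factor times a factor that is differentiable and vanishes at the
  point is differentiable there. The single-point argument for \<open>f\<close> rests on a
  measure-theoretic fact: an inner function equal to \<open>t\<close> on a half line makes the one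
  value \<open>f t\<close> visible on a set of positive measure, and the continuity of the composite
  across the boundary ties it to the neighbouring values.\<close>

inductive_set lin_closure :: "('a \<Rightarrow> real) set \<Rightarrow> ('a \<Rightarrow> real) set" for S where
  scale: "f \<in> S \<Longrightarrow> (\<lambda>x. c * f x) \<in> lin_closure S"
| add: "f \<in> lin_closure S \<Longrightarrow> g \<in> lin_closure S \<Longrightarrow> (\<lambda>x. f x + g x) \<in> lin_closure S"

lemma directional_deriv_eqI:
  assumes "(f has_derivative D) (at x)"
  shows "directional_deriv b f x = D b"
  unfolding directional_deriv_def using frechet_derivative_at[OF assms] by simp

lemma directional_deriv_real_eqI:
  assumes "(f has_real_derivative d) (at x)"
  shows "directional_deriv 1 f x = d"
  using directional_deriv_eqI[OF assms[unfolded has_field_derivative_def], of 1] by simp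

lemma differentiable_has_directional_deriv:
  assumes "f differentiable (at x)"
  shows "(f has_derivative (\<lambda>h. directional_deriv h f x)) (at x)"
  unfolding directional_deriv_def using assms frechet_derivative_works[of f "at x"] by simp

lemma directional_deriv_scaleR:
  assumes "f differentiable (at x)"
  shows "directional_deriv (c *\<^sub>R b) f x = c * directional_deriv b f x"
  using linear_scale[OF has_derivative_linear[OF differentiable_has_directional_deriv[OF assms]]] by simp

lemma directional_deriv_add:
  assumes "\<And>x. f differentiable (at x)" "\<And>x. g differentiable (at x)"
  shows "directional_deriv b (\<lambda>x. f x + g x) = (\<lambda>x. directional_deriv b f x + directional_deriv b g x)"
proof
  fix x show "directional_deriv b (\<lambda>x. f x + g x) x = directional_deriv b f x + directional_deriv b g x"
    by (rule directional_deriv_eqI)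
      (intro has_derivative_add differentiable_has_directional_deriv assms)
qed

lemma directional_deriv_scale:
  assumes "\<And>x. f differentiable (at x)"
  shows "directional_deriv b (\<lambda>x. c * f x) = (\<lambda>x. c * directional_deriv b f x)"
proof
  fix x show "directional_deriv b (\<lambda>x. c * f x) x = c * directional_deriv b f x"
    by (rule directional_deriv_eqI)
      (intro has_derivative_mult_right differentiable_has_directional_deriv assms)
qed

lemma directional_deriv_mult:
  assumes "\<And>x. f differentiable (at x)" "\<And>x. g differentiable (at x)"
  shows "directional_deriv b (\<lambda>x. f x * g x)
    = (\<lambda>x. f x * directional_deriv b g x + directional_deriv b f x * g x)"
proof
  fix x show "directional_deriv b (\<lambda>x. f x * g x) x = f x * directional_deriv b g x + directional_deriv b f x * g x"
    by (rule directional_deriv_eqI)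
      (intro has_derivative_mult differentiable_has_directional_deriv assms)
qed

lemma iter_deriv_Nil [simp]: "iter_deriv [] f = f"
  and iter_deriv_Cons: "iter_deriv (b # bs) f = directional_deriv b (iter_deriv bs f)"
  and iter_deriv_append: "iter_deriv (bs @ cs) f = iter_deriv bs (iter_deriv cs f)"
  by (auto simp: iter_deriv_def)

lemma lin_closure_differentiable:
  assumes "f \<in> lin_closure S" "\<And>f x. f \<in> S \<Longrightarrow> f differentiable (at x)"
  shows "f differentiable (at x)"
  using assms(1) by induction (auto intro!: derivative_intros assms(2))

lemma lin_closure_scale: "f \<in> lin_closure S \<Longrightarrow> (\<lambda>x. c * f x) \<in> lin_closure S"
proof (induction rule: lin_closure.induct)
  case (scale f d)
  then show ?case using lin_closure.scale[of f S "c * d"] by (simp add: mult.assoc)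
next
  case (add f g)
  then show ?case using lin_closure.add[OF add(3,4)] by (simp add: distrib_left)
qed

lemma lin_closure_base: "f \<in> S \<Longrightarrow> f \<in> lin_closure S"
  using lin_closure.scale[of f S 1] by simp

text \<open>Coinduction principle: smoothness only requires exhibiting a family of differentiable functions
  whose partial derivatives are linear combinations of members of the family.\<close>

lemma smooth_coinduct:
  assumes f: "f \<in> lin_closure S"
    and diff: "\<And>f x. f \<in> S \<Longrightarrow> f differentiable (at x)"
    and deriv: "\<And>f b. f \<in> S \<Longrightarrow> b \<in> Basis \<Longrightarrow> directional_deriv b f \<in> lin_closure S"
  shows "smooth f"
proof -
  have *: "directional_deriv b g \<in> lin_closure S" if "g \<in> lin_closure S" "b \<in> Basis" for g b
    using that(1)
  proof induction
    case (scale f c)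
    then show ?case
      by (subst directional_deriv_scale) (auto intro: diff lin_closure_scale deriv that(2))
  next
    case (add f g)
    then show ?case
      by (subst directional_deriv_add) (auto intro: lin_closure_differentiable diff lin_closure.add)
  qed
  have "iter_deriv bs f \<in> lin_closure S" if "set bs \<subseteq> Basis" for bs
    using that by (induction bs) (auto simp: iter_deriv_Cons f *)
  then show ?thesis
    unfolding smooth_def using lin_closure_differentiable[OF _ diff] by blast
qed

lemma smooth_iter_deriv: "smooth f \<Longrightarrow> set bs \<subseteq> Basis \<Longrightarrow> smooth (iter_deriv bs f)"
  unfolding smooth_def by (metis iter_deriv_append set_append Un_subset_iff)

lemma smooth_directional_deriv: "smooth f \<Longrightarrow> b \<in> Basis \<Longrightarrow> smooth (directional_deriv b f)"
  using smooth_iter_deriv[of f "[b]"] by (simp add: iter_deriv_Cons)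

lemma smooth_differentiable: "smooth f \<Longrightarrow> f differentiable (at x)"
  unfolding smooth_def by (metis iter_deriv_Nil empty_subsetI list.set(1))

lemma smooth_continuous_on: "smooth f \<Longrightarrow> continuous_on A f"
  by (meson continuous_at_imp_continuous_on differentiable_imp_continuous_within smooth_differentiable)

lemma smooth_isCont: "smooth f \<Longrightarrow> isCont f x"
  by (meson differentiable_imp_continuous_within smooth_differentiable)

lemma smooth_lin_closure: "f \<in> lin_closure {f. smooth f} \<Longrightarrow> smooth f"
  by (erule smooth_coinduct) (auto intro: smooth_differentiable smooth_directional_deriv lin_closure_base)

lemma smooth_add: "smooth f \<Longrightarrow> smooth g \<Longrightarrow> smooth (\<lambda>x. f x + g x)"
  by (rule smooth_lin_closure, rule lin_closure.add; rule lin_closure_base; simp)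

text \<open>The products of two smooth functions form a family whose derivatives are sums of two
  members, so coinduction replaces a Leibniz formula for iterated derivatives.\<close>

lemma smooth_mult:
  assumes "smooth f" "smooth g"
  shows "smooth (\<lambda>x. f x * g x)"
proof (rule smooth_coinduct)
  let ?S = "{(\<lambda>x. f x * g x) |f g. smooth f \<and> smooth g}"
  show "(\<lambda>x. f x * g x) \<in> lin_closure ?S"
    by (rule lin_closure_base) (use assms in blast)
  show "h differentiable (at x)" if "h \<in> ?S" for h x
    using that by (auto intro!: differentiable_mult intro: smooth_differentiable)
  show "directional_deriv b h \<in> lin_closure ?S" if "h \<in> ?S" "b \<in> Basis" for h b
  proof -
    from that(1) obtain f g where h: "h = (\<lambda>x. f x * g x)" "smooth f" "smooth g"
      unfolding mem_Collect_eq by (elim exE conjE)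
    have "(\<lambda>x. f x * directional_deriv b g x + directional_deriv b f x * g x) \<in> lin_closure ?S"
      by (rule lin_closure.add; rule lin_closure_base)
        (use h(2,3) smooth_directional_deriv[OF _ \<open>b \<in> Basis\<close>] in blast)+
    then show ?thesis
      unfolding h(1) using h(2,3) by (subst directional_deriv_mult) (auto intro: smooth_differentiable)
  qed
qed

lemma smooth_const: "smooth (\<lambda>x. c)"
proof (rule smooth_coinduct)
  show "(\<lambda>x. c) \<in> lin_closure {\<lambda>x. c |c. True}" by (auto intro: lin_closure_base)
  show "directional_deriv b h \<in> lin_closure {\<lambda>x. c |c. True}" if "h \<in> {\<lambda>x. c |c. True}" "b \<in> Basis"
    for h :: "'a \<Rightarrow> real" and b
  proof -
    from that(1) obtain c where h: "h = (\<lambda>x. c)" unfolding mem_Collect_eq by (elim exE conjE)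
    have "directional_deriv b h = (\<lambda>x. 0)"
      unfolding h by (rule ext, rule directional_deriv_eqI[where D="\<lambda>_. 0"]) auto
    then show ?thesis by (auto intro: lin_closure_base)
  qed
qed auto

lemma smooth_prod: "(\<And>i. i \<in> I \<Longrightarrow> smooth (f i)) \<Longrightarrow> smooth (\<lambda>x. \<Prod>i\<in>I. f i x)"
  by (induction I rule: infinite_finite_induct) (auto intro: smooth_const smooth_mult)

text \<open>Such ridge functions enter twice: as the factors of \<open>box_bump\<close>, and as the
  functions of one coordinate on which the hypothesis about \<open>f\<close> is tested.\<close>

lemma smooth_affine:
  fixes k :: "real \<Rightarrow> real"
  assumes "smooth k"
  shows "smooth (\<lambda>x. k (c * (x \<bullet> b) + d))"
proof (rule smooth_coinduct)
  let ?S = "{(\<lambda>x. k (c * (x \<bullet> b) + d)) |k. smooth k}"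
  show "(\<lambda>x. k (c * (x \<bullet> b) + d)) \<in> lin_closure ?S"
    using assms by (auto intro: lin_closure_base)
  have D: "((\<lambda>x. k (c * (x \<bullet> b) + d)) has_derivative
        (\<lambda>h. (c * (h \<bullet> b)) * directional_deriv 1 k (c * (x \<bullet> b) + d))) (at x)" if "smooth k" for k x
  proof -
    have lin: "directional_deriv s k y = s * directional_deriv 1 k y" for s y
      using directional_deriv_scaleR[OF smooth_differentiable[OF that], of s 1] by simp
    have "((\<lambda>x. k (c * (x \<bullet> b) + d)) has_derivative
        (\<lambda>h. directional_deriv (c * (h \<bullet> b)) k (c * (x \<bullet> b) + d))) (at x)"
      by (rule has_derivative_compose[where g=k])
        (auto intro!: derivative_eq_intros differentiable_has_directional_deriv smooth_differentiable that)
    then show ?thesis by (subst (asm) lin)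
  qed
  show "h differentiable (at x)" if "h \<in> ?S" for h x
    using that D by (auto simp: differentiable_def)
  show "directional_deriv e h \<in> lin_closure ?S" if "h \<in> ?S" "e \<in> Basis" for h e
  proof -
    from that(1) obtain k where h: "h = (\<lambda>x. k (c * (x \<bullet> b) + d))" "smooth k"
      unfolding mem_Collect_eq by (elim exE conjE)
    have "directional_deriv e h = (\<lambda>x. (c * (e \<bullet> b)) * directional_deriv 1 k (c * (x \<bullet> b) + d))"
      unfolding h(1) by (rule ext, rule directional_deriv_eqI[OF D[OF h(2)]])
    then show ?thesis
      using smooth_directional_deriv[OF h(2), of 1] by (auto intro!: lin_closure.scale)
  qed
qed

lemma smooth_real_primitive:
  fixes k :: "real \<Rightarrow> real"
  assumes "\<And>x. (k has_real_derivative k' x) (at x)" "smooth k'"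
  shows "smooth k"
proof (rule smooth_coinduct)
  let ?S = "insert k {f. smooth f}"
  show "k \<in> lin_closure ?S" by (auto intro: lin_closure_base)
  show "h differentiable (at x)" if "h \<in> ?S" for h x
    using that assms(1) by (auto intro: smooth_differentiable real_differentiable_def[THEN iffD2])
  have "directional_deriv 1 k = k'"
    by (rule ext, rule directional_deriv_real_eqI[OF assms(1)])
  then show "directional_deriv b h \<in> lin_closure ?S" if "h \<in> ?S" "b \<in> Basis" for h b
    using that assms(2) by (intro lin_closure_base) (auto intro: smooth_directional_deriv)
qed

section \<open>A smooth function that is flat at the origin\<close>

text \<open>For \<open>k = 0\<close> this is the standard function exp (-1/t), extended by 0. The
  powers of 1/t are included so that every derivative of a member is a linear combination of
  members.\<close>

definition flat_mono :: "nat \<Rightarrow> real \<Rightarrow> real" where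
  "flat_mono k t = (if t > 0 then (1/t)^k * exp (- (1/t)) else 0)"

lemma flat_mono_deriv:
  "(flat_mono k has_real_derivative (- real k * flat_mono (Suc k) t + flat_mono (k+2) t)) (at t)"
proof -
  consider "t > 0" | "t < 0" | "t = 0" by linarith
  then show ?thesis
  proof cases
    case 1
    have "((\<lambda>t. (1/t)^k * exp (- (1/t))) has_real_derivative
       (- real k * flat_mono (Suc k) t + flat_mono (k+2) t)) (at t)"
    proof -
      have *: "((\<lambda>t. (1/t)^k) has_real_derivative real k * (-((1/t)^2) * (1/t) ^ (k - Suc 0))) (at t)"
      proof -
        have "((\<lambda>t. 1/t) has_real_derivative -((1/t)^2)) (at t)"
          using 1 by (auto intro!: derivative_eq_intros simp: power2_eq_square)
        from DERIV_power[OF this, of k] show ?thesis by simp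
      qed
      have "((\<lambda>t. (1/t)^k * exp (- (1/t))) has_real_derivative
         (real k * (-((1/t)^2) * (1/t) ^ (k - Suc 0))) * exp (-(1/t)) + (1/t)^2 * exp (-(1/t)) * (1/t)^k) (at t)"
        using 1 by (auto intro!: derivative_eq_intros * simp: power2_eq_square)
      \<comment> \<open>The exponent \<open>k - Suc 0\<close> is truncated at \<open>k = 0\<close>;
        there the factor \<open>real k\<close> removes the term, hence the case split on
        \<open>k\<close>.\<close>
      moreover have "(real k * (-(s^2) * s ^ (k - Suc 0))) * E + s^2 * E * s^k
        = - real k * (s ^ Suc k * E) + s ^ (k+2) * E" for s E :: real
        by (cases k) (simp_all add: algebra_simps power2_eq_square)
      ultimately show ?thesis using 1 by (simp add: flat_mono_def)
    qed
    then show ?thesis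
      by (rule has_field_derivative_transform_within_open[where S="{0<..}"]) (use 1 in \<open>auto simp: flat_mono_def\<close>)
  next
    case 2
    have "((\<lambda>t. 0) has_real_derivative 0) (at t)" by simp
    then have "(flat_mono k has_real_derivative 0) (at t)"
      by (rule has_field_derivative_transform_within_open[where S="{..<0}"]) (use 2 in \<open>auto simp: flat_mono_def\<close>)
    then show ?thesis using 2 by (simp add: flat_mono_def)
  next
    case 3
    \<comment> \<open>With x = 1/h the difference quotient at 0 from the right becomes x^(k+1) / exp
      x as x tends to infinity.\<close>
    have lim: "((\<lambda>h. (1/h)^Suc k * exp (- (1/h))) \<longlongrightarrow> (0::real)) (at_right 0)"
    proof -
      have "((\<lambda>x::real. x ^ Suc k / exp x) \<longlongrightarrow> 0) at_top" by (rule tendsto_power_div_exp_0)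
      then have "((\<lambda>h::real. (inverse h) ^ Suc k / exp (inverse h)) \<longlongrightarrow> 0) (at_right 0)"
        by (rule filterlim_compose[OF _ filterlim_inverse_at_top_right])
      then show ?thesis by (simp add: exp_minus field_simps inverse_eq_divide)
    qed
    have "((\<lambda>h. (flat_mono k (0 + h) - flat_mono k 0) / h) \<longlongrightarrow> 0) (at 0)"
    proof (rule filterlim_split_at)
      show "((\<lambda>h. (flat_mono k (0 + h) - flat_mono k 0) / h) \<longlongrightarrow> 0) (at_left 0)"
        by (rule tendsto_eventually) (auto simp: flat_mono_def eventually_at intro!: exI[of _ 1])
      show "((\<lambda>h. (flat_mono k (0 + h) - flat_mono k 0) / h) \<longlongrightarrow> 0) (at_right 0)"
        by (rule Lim_transform_eventually[OF lim])
          (auto simp: flat_mono_def eventually_at field_simps intro!: exI[of _ 1])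
    qed
    then show ?thesis using 3 by (simp add: flat_mono_def DERIV_def)
  qed
qed

lemma smooth_flat_mono: "smooth (flat_mono k)"
proof (rule smooth_coinduct)
  show "flat_mono k \<in> lin_closure (range flat_mono)" by (auto intro: lin_closure_base)
  show "f differentiable (at x)" if "f \<in> range flat_mono" for f x
    using that flat_mono_deriv by (auto intro: real_differentiable_def[THEN iffD2])
  show "directional_deriv b f \<in> lin_closure (range flat_mono)" if "f \<in> range flat_mono" "b \<in> Basis" for f b
  proof -
    from that(1) obtain k where f: "f = flat_mono k" by (elim imageE)
    have "directional_deriv 1 f = (\<lambda>t. - real k * flat_mono (Suc k) t + flat_mono (k+2) t)"
      unfolding f by (rule ext, rule directional_deriv_real_eqI[OF flat_mono_deriv])
    moreover have "(\<lambda>t. - real k * flat_mono (Suc k) t + flat_mono (k+2) t) \<in> lin_closure (range flat_mono)"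
      by (rule lin_closure.add) (rule lin_closure.scale lin_closure_base, rule rangeI)+
    ultimately show ?thesis using that(2) by simp
  qed
qed

section \<open>Symmetry of mixed derivatives\<close>

lemma smooth_line_deriv:
  assumes "smooth f"
  shows "((\<lambda>t. f (x + t *\<^sub>R c)) has_real_derivative directional_deriv c f (x + t *\<^sub>R c)) (at t)"
proof -
  have "((\<lambda>t. f (x + t *\<^sub>R c)) has_derivative (\<lambda>h. directional_deriv (h *\<^sub>R c) f (x + t *\<^sub>R c))) (at t)"
    by (rule has_derivative_compose[where g=f])
      (auto intro!: derivative_eq_intros differentiable_has_directional_deriv smooth_differentiable assms)
  moreover have "directional_deriv (h *\<^sub>R c) f z = h * directional_deriv c f z" for h z
    by (rule directional_deriv_scaleR[OF smooth_differentiable[OF assms]])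
  ultimately show ?thesis by (simp add: has_field_derivative_def mult.commute[of _ "directional_deriv _ _ _"])
qed

text \<open>The second difference of \<open>f\<close> over a square of side \<open>h\<close> is
  symmetric in \<open>a\<close> and \<open>b\<close>. Two applications of the mean value theorem, in
  either order, express it as h^2 times one of the mixed derivatives at a nearby point; continuity
  then forces the two to agree at \<open>x\<close>.\<close>

lemma directional_deriv_commute:
  assumes "smooth f" "a \<in> Basis" "b \<in> Basis"
  shows "directional_deriv a (directional_deriv b f) = directional_deriv b (directional_deriv a f)"
proof
  fix x
  have key: "\<exists>\<xi>>0. \<exists>\<eta>>0. \<xi> < h \<and> \<eta> < h \<and> f (x + h *\<^sub>R a + h *\<^sub>R b) - f (x + h *\<^sub>R a) - f (x + h *\<^sub>R b) + f x
       = h * h * directional_deriv b (directional_deriv a f) (x + \<xi> *\<^sub>R a + \<eta> *\<^sub>R b)"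
    if "h > 0" and ab: "a \<in> Basis" "b \<in> Basis" for h a b
  proof -
    define G where "G = (\<lambda>t. f (x + h *\<^sub>R b + t *\<^sub>R a) - f (x + t *\<^sub>R a))"
    have "\<exists>\<xi>>0. \<xi> < h \<and> G h - G 0 = (h - 0) * (directional_deriv a f (x + h *\<^sub>R b + \<xi> *\<^sub>R a) - directional_deriv a f (x + \<xi> *\<^sub>R a))"
      unfolding G_def
      by (rule MVT2[OF \<open>h>0\<close>]) (intro derivative_intros smooth_line_deriv assms)
    then obtain \<xi> where \<xi>: "\<xi> > 0" "\<xi> < h" "G h - G 0 = h * (directional_deriv a f (x + h *\<^sub>R b + \<xi> *\<^sub>R a) - directional_deriv a f (x + \<xi> *\<^sub>R a))"
      by auto
    have "\<exists>\<eta>>0. \<eta> < h \<and> directional_deriv a f (x + \<xi> *\<^sub>R a + h *\<^sub>R b) - directional_deriv a f (x + \<xi> *\<^sub>R a + 0 *\<^sub>R b)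
       = (h - 0) * directional_deriv b (directional_deriv a f) (x + \<xi> *\<^sub>R a + \<eta> *\<^sub>R b)"
      by (rule MVT2[OF \<open>h>0\<close>]) (intro derivative_intros smooth_line_deriv assms smooth_directional_deriv ab)
    then obtain \<eta> where "\<eta> > 0" "\<eta> < h" "directional_deriv a f (x + \<xi> *\<^sub>R a + h *\<^sub>R b) - directional_deriv a f (x + \<xi> *\<^sub>R a)
       = h * directional_deriv b (directional_deriv a f) (x + \<xi> *\<^sub>R a + \<eta> *\<^sub>R b)" by auto
    with \<xi> show ?thesis unfolding G_def
      by (intro exI[of _ \<xi>] exI[of _ \<eta>] conjI) (auto simp: algebra_simps)
  qed
  have lim: "\<exists>d>0. \<forall>h \<xi> \<eta>. 0 < h \<longrightarrow> h < d \<longrightarrow> 0 < \<xi> \<longrightarrow> \<xi> < h \<longrightarrow> 0 < \<eta> \<longrightarrow> \<eta> < h \<longrightarrow>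
      \<bar>g (x + \<xi> *\<^sub>R a + \<eta> *\<^sub>R b) - g x\<bar> < e" if "smooth g" "e > 0" and ab: "a \<in> Basis" "b \<in> Basis" for g e a b
  proof -
    obtain d where d: "d > 0" "\<And>y. dist y x < d \<Longrightarrow> dist (g y) (g x) < e"
      using smooth_isCont[OF \<open>smooth g\<close>, of x] \<open>e>0\<close> unfolding continuous_at_eps_delta by metis
    show ?thesis
    proof (intro exI[of _ "d/2"] conjI allI impI)
      fix h \<xi> \<eta> :: real assume *: "0 < h" "h < d/2" "0 < \<xi>" "\<xi> < h" "0 < \<eta>" "\<eta> < h"
      have "norm (\<xi> *\<^sub>R a + \<eta> *\<^sub>R b) \<le> \<xi> + \<eta>"
        using norm_triangle_ineq[of "\<xi> *\<^sub>R a" "\<eta> *\<^sub>R b"] * ab by simp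
      then have "dist (x + \<xi> *\<^sub>R a + \<eta> *\<^sub>R b) x < d"
        using * by (simp add: dist_norm add.assoc)
      then show "\<bar>g (x + \<xi> *\<^sub>R a + \<eta> *\<^sub>R b) - g x\<bar> < e" using d(2) by (simp add: dist_real_def)
    qed (use d in auto)
  qed
  show "directional_deriv a (directional_deriv b f) x = directional_deriv b (directional_deriv a f) x"
  proof (rule ccontr)
    define A where "A = directional_deriv a (directional_deriv b f)"
    define B where "B = directional_deriv b (directional_deriv a f)"
    assume "\<not> ?thesis"
    then have ne: "\<bar>A x - B x\<bar> / 2 > 0" by (auto simp: A_def B_def)
    have sm: "smooth A" "smooth B" unfolding A_def B_def using assms by (auto intro!: smooth_directional_deriv)
    obtain d1 where d1: "d1 > 0" "\<And>h \<xi> \<eta>. 0 < h \<Longrightarrow> h < d1 \<Longrightarrow> 0 < \<xi> \<Longrightarrow> \<xi> < h \<Longrightarrow> 0 < \<eta> \<Longrightarrow> \<eta> < h \<Longrightarrow>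
      \<bar>A (x + \<xi> *\<^sub>R b + \<eta> *\<^sub>R a) - A x\<bar> < \<bar>A x - B x\<bar> / 2" using lim[OF sm(1) ne assms(3,2)] by metis
    obtain d2 where d2: "d2 > 0" "\<And>h \<xi> \<eta>. 0 < h \<Longrightarrow> h < d2 \<Longrightarrow> 0 < \<xi> \<Longrightarrow> \<xi> < h \<Longrightarrow> 0 < \<eta> \<Longrightarrow> \<eta> < h \<Longrightarrow>
      \<bar>B (x + \<xi> *\<^sub>R a + \<eta> *\<^sub>R b) - B x\<bar> < \<bar>A x - B x\<bar> / 2" using lim[OF sm(2) ne assms(2,3)] by metis
    define h where "h = min d1 d2 / 2"
    have h: "h > 0" "h < d1" "h < d2" using d1(1) d2(1) by (auto simp: h_def)
    obtain \<xi> \<eta> where 1: "\<xi> > 0" "\<eta> > 0" "\<xi> < h" "\<eta> < h" "f (x + h *\<^sub>R a + h *\<^sub>R b) - f (x + h *\<^sub>R a) - f (x + h *\<^sub>R b) + f x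
       = h * h * B (x + \<xi> *\<^sub>R a + \<eta> *\<^sub>R b)" using key[OF h(1) assms(2,3)] unfolding B_def by blast
    obtain \<xi>' \<eta>' where 2: "\<xi>' > 0" "\<eta>' > 0" "\<xi>' < h" "\<eta>' < h" "f (x + h *\<^sub>R b + h *\<^sub>R a) - f (x + h *\<^sub>R b) - f (x + h *\<^sub>R a) + f x
       = h * h * A (x + \<xi>' *\<^sub>R b + \<eta>' *\<^sub>R a)" using key[OF h(1) assms(3,2)] unfolding A_def by blast
    have "h * h * B (x + \<xi> *\<^sub>R a + \<eta> *\<^sub>R b) = h * h * A (x + \<xi>' *\<^sub>R b + \<eta>' *\<^sub>R a)"
      using 1(5) 2(5) by (simp add: algebra_simps)
    then have "B (x + \<xi> *\<^sub>R a + \<eta> *\<^sub>R b) = A (x + \<xi>' *\<^sub>R b + \<eta>' *\<^sub>R a)" using h(1) by simp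
    with d1(2)[OF h(1,2) 2(1,3,2,4)] d2(2)[OF h(1,3) 1(1,3,2,4)] show False by argo
  qed
qed

lemma iter_deriv_mset_eq:
  assumes "smooth f" "set bs \<subseteq> Basis" "mset bs = mset cs"
  shows "iter_deriv bs f = iter_deriv cs f"
  using assms(2,3)
proof (induction bs arbitrary: cs)
  case Nil
  then show ?case by simp
next
  case (Cons b bs)
  have move: "directional_deriv b (iter_deriv ds f) = iter_deriv ds (directional_deriv b f)" if "set ds \<subseteq> Basis" for ds
    using that
  proof (induction ds)
    case (Cons d ds)
    then show ?case
      using directional_deriv_commute[OF smooth_iter_deriv[OF assms(1), of ds], of b d] \<open>set (b # bs) \<subseteq> Basis\<close>
      by (simp add: iter_deriv_Cons)
  qed simp
  have "b \<in> set cs" using Cons.prems(2) by (metis list.set_intros(1) set_mset_mset)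
  then obtain cs1 cs2 where cs: "cs = cs1 @ b # cs2" by (meson split_list)
  have sub: "set cs1 \<subseteq> Basis" "set cs2 \<subseteq> Basis"
    using Cons.prems(1) mset_eq_setD[OF Cons.prems(2)] cs by auto
  have "iter_deriv (b # bs) f = directional_deriv b (iter_deriv (cs1 @ cs2) f)"
    using Cons.IH[of "cs1 @ cs2"] Cons.prems cs by (simp add: iter_deriv_Cons)
  also have "\<dots> = iter_deriv (cs1 @ cs2) (directional_deriv b f)" using sub by (intro move) auto
  also have "\<dots> = iter_deriv cs1 (directional_deriv b (iter_deriv cs2 f))"
    using sub move[of cs2] by (simp add: iter_deriv_append)
  also have "\<dots> = iter_deriv cs f" by (simp add: cs iter_deriv_append iter_deriv_Cons)
  finally show ?case .
qed

section \<open>Test functions and superpositions of translates\<close>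

lemma test_functionsI:
  assumes "smooth \<phi>" "compact K" "\<And>x. x \<notin> K \<Longrightarrow> \<phi> x = 0"
  shows "\<phi> \<in> test_functions"
proof -
  have "bounded {x. \<phi> x \<noteq> 0}"
    by (rule bounded_subset[OF compact_imp_bounded[OF assms(2)]]) (use assms(3) in auto)
  then show ?thesis using assms(1) by (simp add: test_functions_def compact_closure)
qed

lemma test_functionsD:
  assumes "\<phi> \<in> test_functions"
  shows "smooth \<phi>" "compact (closure {x. \<phi> x \<noteq> 0})" "x \<notin> closure {x. \<phi> x \<noteq> 0} \<Longrightarrow> \<phi> x = 0"
  using assms closure_subset[of "{x. \<phi> x \<noteq> 0}"] by (auto simp: test_functions_def)

lemma test_functions_obtain_support:
  assumes "\<phi> \<in> test_functions"
  obtains K where "compact K" "\<And>x. x \<notin> K \<Longrightarrow> \<phi> x = 0"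
  using test_functionsD[OF assms] by metis

lemma directional_deriv_outside_support:
  assumes "x \<notin> closure {x. \<phi> x \<noteq> 0}"
  shows "directional_deriv b \<phi> x = 0"
proof -
  have "(\<phi> has_derivative (\<lambda>h. 0)) (at x)"
  proof (rule has_derivative_transform_within_open)
    show "((\<lambda>x. 0::real) has_derivative (\<lambda>h. 0)) (at x)" by simp
    show "open (- closure {x. \<phi> x \<noteq> 0})" by auto
    show "x \<in> - closure {x. \<phi> x \<noteq> 0}" using assms by simp
    show "0 = \<phi> y" if "y \<in> - closure {x. \<phi> x \<noteq> 0}" for y
      using that closure_subset[of "{x. \<phi> x \<noteq> 0}"] by auto
  qed
  then show ?thesis by (rule directional_deriv_eqI)
qed

lemma test_functions_directional_deriv:
  assumes "\<phi> \<in> test_functions" "b \<in> Basis"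
  shows "directional_deriv b \<phi> \<in> test_functions"
  by (rule test_functionsI[OF smooth_directional_deriv[OF test_functionsD(1)[OF assms(1)] assms(2)]
        test_functionsD(2)[OF assms(1)] directional_deriv_outside_support])

lemma test_functions_iter_deriv:
  assumes "\<phi> \<in> test_functions" "set bs \<subseteq> Basis"
  shows "iter_deriv bs \<phi> \<in> test_functions"
  using assms(2) by (induction bs) (auto simp: iter_deriv_Cons assms(1) test_functions_directional_deriv)

lemma test_functions_mult:
  assumes "smooth f" "\<phi> \<in> test_functions"
  shows "(\<lambda>x. f x * \<phi> x) \<in> test_functions"
proof (rule test_functionsI)
  show "smooth (\<lambda>x. f x * \<phi> x)" by (intro smooth_mult assms(1) test_functionsD(1)[OF assms(2)])
  show "compact (closure {x. \<phi> x \<noteq> 0})" by (rule test_functionsD(2)[OF assms(2)])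
  show "f x * \<phi> x = 0" if "x \<notin> closure {x. \<phi> x \<noteq> 0}" for x
    using test_functionsD(3)[OF assms(2) that] by simp
qed

lemma test_functions_add:
  assumes "\<phi> \<in> test_functions" "\<psi> \<in> test_functions"
  shows "(\<lambda>x. \<phi> x + \<psi> x) \<in> test_functions"
proof (rule test_functionsI)
  show "smooth (\<lambda>x. \<phi> x + \<psi> x)" by (intro smooth_add assms[THEN test_functionsD(1)])
  show "compact (closure {x. \<phi> x \<noteq> 0} \<union> closure {x. \<psi> x \<noteq> 0})"
    by (intro compact_Un assms[THEN test_functionsD(2)])
  show "\<phi> x + \<psi> x = 0" if "x \<notin> closure {x. \<phi> x \<noteq> 0} \<union> closure {x. \<psi> x \<noteq> 0}" for x
    using that test_functionsD(3)[OF assms(1), of x] test_functionsD(3)[OF assms(2), of x] by simp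
qed

lemma test_functions_scale: "\<phi> \<in> test_functions \<Longrightarrow> (\<lambda>x. c * \<phi> x) \<in> test_functions"
  using test_functions_mult[OF smooth_const] by blast

lemma test_functions_bounded:
  assumes "\<phi> \<in> test_functions"
  obtains B where "B \<ge> 0" "\<And>x. \<bar>\<phi> x\<bar> \<le> B"
proof -
  obtain K where K: "compact K" "\<And>x. x \<notin> K \<Longrightarrow> \<phi> x = 0"
    by (rule test_functions_obtain_support[OF assms]) blast
  have "bounded (\<phi> ` K)"
    by (intro compact_imp_bounded compact_continuous_image K smooth_continuous_on test_functionsD(1)[OF assms])
  then obtain B where B: "B > 0" "\<And>x. x \<in> K \<Longrightarrow> \<bar>\<phi> x\<bar> \<le> B" unfolding bounded_pos by auto
  show thesis by (rule that[of B]) (use B K(2) in \<open>force+\<close>)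
qed

lemma test_functions_borel [measurable_dest]:
  "\<phi> \<in> test_functions \<Longrightarrow> \<phi> \<in> borel_measurable borel"
  by (intro borel_measurable_continuous_onI smooth_continuous_on test_functionsD)

section \<open>Uniform expansions of test functions\<close>

lemma smooth_mean_value:
  assumes "smooth f"
  shows "\<exists>\<xi>. f (x + h) - f x = directional_deriv h f (x + \<xi> *\<^sub>R h) \<and> 0 < \<xi> \<and> \<xi> < 1"
  using MVT2[of 0 1 "\<lambda>t. f (x + t *\<^sub>R h)" "\<lambda>t. directional_deriv h f (x + t *\<^sub>R h)"]
    smooth_line_deriv[OF assms, of x h] by auto

lemma directional_deriv_Basis_sum:
  assumes "f differentiable (at x)"
  shows "directional_deriv h f x = (\<Sum>b\<in>Basis. (h \<bullet> b) * directional_deriv b f x)"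
proof -
  have lin: "linear (\<lambda>h. directional_deriv h f x)"
    using differentiable_has_directional_deriv[OF assms] by (rule has_derivative_linear)
  have "directional_deriv h f x = directional_deriv (\<Sum>b\<in>Basis. (h \<bullet> b) *\<^sub>R b) f x"
    by (simp add: euclidean_representation)
  also have "\<dots> = (\<Sum>b\<in>Basis. (h \<bullet> b) * directional_deriv b f x)"
    by (simp add: linear_sum[OF lin] linear_scale[OF lin])
  finally show ?thesis .
qed

lemma test_functions_Lipschitz:
  assumes "\<phi> \<in> test_functions"
  obtains L where "L \<ge> 0" "\<And>x h. \<bar>\<phi> (x + h) - \<phi> x\<bar> \<le> L * norm h"
proof -
  have "\<exists>B. \<forall>b\<in>Basis. 0 \<le> B b \<and> (\<forall>x. \<bar>directional_deriv b \<phi> x\<bar> \<le> B b)"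
    by (rule bchoice) (use test_functions_bounded[OF test_functions_directional_deriv[OF assms]] in metis)
  then obtain B where "\<forall>b\<in>Basis. 0 \<le> B b \<and> (\<forall>x. \<bar>directional_deriv b \<phi> x\<bar> \<le> B b)" ..
  then have B: "\<And>b. b \<in> Basis \<Longrightarrow> 0 \<le> B b" "\<And>b x. b \<in> Basis \<Longrightarrow> \<bar>directional_deriv b \<phi> x\<bar> \<le> B b"
    by (auto simp del: abs_le_iff)
  have sm: "smooth \<phi>" by (rule test_functionsD(1)[OF assms])
  show thesis
  proof
    show "0 \<le> (\<Sum>b\<in>Basis. B b)" by (simp add: sum_nonneg B)
    fix x h
    obtain \<xi> where "\<phi> (x + h) - \<phi> x = directional_deriv h \<phi> (x + \<xi> *\<^sub>R h)"
      using smooth_mean_value[OF sm] by blast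
    also have "\<dots> = (\<Sum>b\<in>Basis. (h \<bullet> b) * directional_deriv b \<phi> (x + \<xi> *\<^sub>R h))"
      by (intro directional_deriv_Basis_sum smooth_differentiable sm)
    also have "\<bar>\<dots>\<bar> \<le> (\<Sum>b\<in>Basis. norm h * B b)"
    proof (intro order_trans[OF sum_abs] sum_mono)
      fix b :: 'a assume b: "b \<in> Basis"
      show "\<bar>(h \<bullet> b) * directional_deriv b \<phi> (x + \<xi> *\<^sub>R h)\<bar> \<le> norm h * B b"
        unfolding abs_mult by (rule mult_mono) (use b in \<open>simp_all add: Basis_le_norm B\<close>)
    qed
    finally show "\<bar>\<phi> (x + h) - \<phi> x\<bar> \<le> (\<Sum>b\<in>Basis. B b) * norm h"
      by (simp add: sum_distrib_left mult.commute)
  qed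
qed

lemma test_functions_Taylor:
  assumes "\<phi> \<in> test_functions"
  obtains L where "L \<ge> 0" "\<And>x h. \<bar>\<phi> (x + h) - \<phi> x - directional_deriv h \<phi> x\<bar> \<le> L * (norm h)\<^sup>2"
proof -
  have "\<exists>B. \<forall>b\<in>Basis. 0 \<le> B b \<and> (\<forall>x h. \<bar>directional_deriv b \<phi> (x + h) - directional_deriv b \<phi> x\<bar> \<le> B b * norm h)"
    by (rule bchoice) (use test_functions_Lipschitz[OF test_functions_directional_deriv[OF assms]] in metis)
  then obtain B where "\<forall>b\<in>Basis. 0 \<le> B b \<and> (\<forall>x h. \<bar>directional_deriv b \<phi> (x + h) - directional_deriv b \<phi> x\<bar> \<le> B b * norm h)" ..
  then have B: "\<And>b. b \<in> Basis \<Longrightarrow> 0 \<le> B b" "\<And>b x h. b \<in> Basis \<Longrightarrow> \<bar>directional_deriv b \<phi> (x + h) - directional_deriv b \<phi> x\<bar> \<le> B b * norm h"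
    by (auto simp del: abs_le_iff)
  have sm: "smooth \<phi>" by (rule test_functionsD(1)[OF assms])
  show thesis
  proof
    show "0 \<le> (\<Sum>b\<in>Basis. B b)" by (simp add: sum_nonneg B)
    fix x h
    obtain \<xi> where \<xi>: "\<phi> (x + h) - \<phi> x = directional_deriv h \<phi> (x + \<xi> *\<^sub>R h)" "0 < \<xi>" "\<xi> < 1"
      using smooth_mean_value[OF sm] by blast
    have "\<phi> (x + h) - \<phi> x - directional_deriv h \<phi> x
      = (\<Sum>b\<in>Basis. (h \<bullet> b) * (directional_deriv b \<phi> (x + \<xi> *\<^sub>R h) - directional_deriv b \<phi> x))"
      unfolding \<xi>(1)
      by (simp add: directional_deriv_Basis_sum[OF smooth_differentiable[OF sm], where h=h]
          right_diff_distrib sum_subtractf)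
    also have "\<bar>\<dots>\<bar> \<le> (\<Sum>b\<in>Basis. norm h * (B b * norm h))"
    proof (intro order_trans[OF sum_abs] sum_mono)
      fix b :: 'a assume b: "b \<in> Basis"
      have "\<bar>directional_deriv b \<phi> (x + \<xi> *\<^sub>R h) - directional_deriv b \<phi> x\<bar> \<le> B b * norm (\<xi> *\<^sub>R h)"
        by (rule B(2)[OF b])
      also have "\<dots> \<le> B b * norm h"
        using \<xi> B(1)[OF b] by (intro mult_left_mono) (auto intro: mult_left_le_one_le)
      finally show "\<bar>(h \<bullet> b) * (directional_deriv b \<phi> (x + \<xi> *\<^sub>R h) - directional_deriv b \<phi> x)\<bar> \<le> norm h * (B b * norm h)"
        unfolding abs_mult by (intro mult_mono) (use b in \<open>simp_all add: Basis_le_norm\<close>)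
    qed
    finally show "\<bar>\<phi> (x + h) - \<phi> x - directional_deriv h \<phi> x\<bar> \<le> (\<Sum>b\<in>Basis. B b) * (norm h)\<^sup>2"
      by (simp add: sum_distrib_left sum_distrib_right power2_eq_square mult_ac)
  qed
qed

section \<open>Local integrability and averages of translates\<close>

text \<open>The Borel counterpart of \<open>locally_integrable\<close>. Borel functions stay
  measurable under translations and on product spaces, which Fubini's theorem needs;
  \<open>locally_integrable_borel_version\<close> and \<open>represents_iff\<close> translate back
  to classes modulo null sets.\<close>

definition loc_int :: "('a::euclidean_space \<Rightarrow> real) \<Rightarrow> bool" where
  "loc_int h \<longleftrightarrow> h \<in> borel_measurable borel \<and>
     (\<forall>K. compact K \<longrightarrow> integrable lborel (\<lambda>x. indicator K x * h x))"

lemma loc_int_borel [measurable_dest]: "loc_int h \<Longrightarrow> h \<in> borel_measurable borel"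
  by (simp add: loc_int_def)

lemma loc_int_integrable: "loc_int h \<Longrightarrow> compact K \<Longrightarrow> integrable lborel (\<lambda>x. indicator K x * h x)"
  by (simp add: loc_int_def)

lemma loc_int_integrable_bounded:
  assumes "loc_int h" "compact K" "\<phi> \<in> borel_measurable borel"
    "\<And>x. \<bar>\<phi> x\<bar> \<le> B * indicator K x"
  shows "integrable lborel (\<lambda>x. h x * \<phi> x)"
proof (rule Bochner_Integration.integrable_bound)
  show "integrable lborel (\<lambda>x. B * (indicator K x * h x))"
    by (intro integrable_mult_right loc_int_integrable assms)
  show "(\<lambda>x. h x * \<phi> x) \<in> borel_measurable lborel"
    using loc_int_borel[OF assms(1)] assms(3) by simp
  have "norm (h x * \<phi> x) \<le> norm (B * (indicator K x * h x))" for x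
  proof -
    have "norm (h x * \<phi> x) \<le> \<bar>h x\<bar> * (B * indicator K x)"
      using assms(4)[of x] by (auto simp: abs_mult intro: mult_left_mono)
    also have "\<dots> \<le> \<bar>B * (indicator K x * h x)\<bar>"
      by (simp add: abs_mult mult_ac mult_right_mono)
    finally show ?thesis by simp
  qed
  then show "AE x in lborel. norm (h x * \<phi> x) \<le> norm (B * (indicator K x * h x))" by simp
qed

lemma test_functions_dominated:
  assumes "\<phi> \<in> test_functions"
  obtains B K where "B \<ge> 0" "compact K" "\<And>x. \<bar>\<phi> x\<bar> \<le> B * indicator K x"
proof -
  obtain B where B: "B \<ge> 0" "\<And>x. \<bar>\<phi> x\<bar> \<le> B" by (rule test_functions_bounded[OF assms]) blast
  obtain K where "compact K" "\<And>x. x \<notin> K \<Longrightarrow> \<phi> x = 0"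
    by (rule test_functions_obtain_support[OF assms]) blast
  with B show thesis by (intro that[of B K]) (auto simp: indicator_def)
qed

lemma loc_int_integrable_test:
  assumes "loc_int h" "\<phi> \<in> test_functions"
  shows "integrable lborel (\<lambda>x. h x * \<phi> x)"
  by (rule test_functions_dominated[OF assms(2)])
    (rule loc_int_integrable_bounded[OF assms(1) _ test_functions_borel[OF assms(2)]])

text \<open>One notion for three uses: convolution (\<open>M\<close> is Lebesgue measure,
  \<open>Y\<close> is plus or minus the identity), integration along a segment in direction
  \<open>b\<close> (\<open>Y s = s *\<^sub>R b\<close>), and the kernel of the divergence formula
  (\<open>M\<close> lives on pairs of a vector and a scalar).\<close>

definition superpose :: "'m measure \<Rightarrow> ('m \<Rightarrow> real) \<Rightarrow> ('m \<Rightarrow> 'a::euclidean_space) \<Rightarrow> ('a \<Rightarrow> real) \<Rightarrow> 'a \<Rightarrow> real" where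
  "superpose M w Y \<phi> x = (\<integral>\<omega>. w \<omega> * \<phi> (x + Y \<omega>) \<partial>M)"

text \<open>The bound is imposed only where the weight is nonzero: in the applications
  \<open>Y\<close> is unbounded, but the translations that contribute are bounded, and this keeps
  supports compact.\<close>

locale displacement = sigma_finite_measure M for M :: "'m measure" +
  fixes w :: "'m \<Rightarrow> real" and Y :: "'m \<Rightarrow> 'a::euclidean_space" and C :: real
  assumes w_integrable: "integrable M w" and Y_measurable [measurable]: "Y \<in> borel_measurable M"
    and Y_bound: "\<And>\<omega>. w \<omega> \<noteq> 0 \<Longrightarrow> norm (Y \<omega>) \<le> C"
begin

lemma w_measurable [measurable]: "w \<in> borel_measurable M"
  using w_integrable by simp

lemma uminus_displacement: "displacement M w (\<lambda>\<omega>. - Y \<omega>) C"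
  by unfold_locales (auto simp: w_integrable Y_bound)

lemma integrable_test:
  assumes "\<phi> \<in> test_functions"
  shows "integrable M (\<lambda>\<omega>. w \<omega> * \<phi> (x + Y \<omega>))"
proof -
  obtain B where B: "B \<ge> 0" "\<And>x. \<bar>\<phi> x\<bar> \<le> B" by (rule test_functions_bounded[OF assms]) blast
  have [measurable]: "\<phi> \<in> borel_measurable borel" using assms by (rule test_functions_borel)
  show ?thesis
    by (rule Bochner_Integration.integrable_bound[OF integrable_mult_right[OF w_integrable, of B]])
      (use B in \<open>auto simp: abs_mult mult.commute[of "\<bar>w _\<bar>"] intro!: mult_right_mono\<close>)
qed

text \<open>The remainder in \<open>test_functions_Taylor\<close> is quadratic with a constant
  independent of the base point, so integrating it against |w| leaves a quadratic remainder for the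
  average.\<close>

lemma superpose_has_derivative:
  assumes "\<phi> \<in> test_functions"
  shows "(superpose M w Y \<phi> has_derivative (\<lambda>h. superpose M w Y (directional_deriv h \<phi>) x)) (at x)"
proof -
  have sm: "smooth \<phi>" by (rule test_functionsD(1)[OF assms])
  obtain L where L: "L \<ge> 0" "\<And>x h. \<bar>\<phi> (x + h) - \<phi> x - directional_deriv h \<phi> x\<bar> \<le> L * (norm h)\<^sup>2"
    by (rule test_functions_Taylor[OF assms]) blast
  let ?W = "\<integral>\<omega>. \<bar>w \<omega>\<bar> \<partial>M"
  have int: "integrable M (\<lambda>\<omega>. w \<omega> * directional_deriv h \<phi> (x + Y \<omega>))" for h x
  proof -
    have "integrable M (\<lambda>\<omega>. \<Sum>b\<in>Basis. (h \<bullet> b) * (w \<omega> * directional_deriv b \<phi> (x + Y \<omega>)))"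
      by (intro Bochner_Integration.integrable_sum integrable_mult_right integrable_test
          test_functions_directional_deriv assms)
    then show ?thesis
      by (subst directional_deriv_Basis_sum)
        (auto simp: smooth_differentiable[OF sm] sum_distrib_left mult_ac)
  qed
  have eq: "superpose M w Y (directional_deriv h \<phi>) x
      = (\<Sum>b\<in>Basis. (h \<bullet> b) * superpose M w Y (directional_deriv b \<phi>) x)" for h
    unfolding superpose_def
    by (subst directional_deriv_Basis_sum)
      (auto simp: smooth_differentiable[OF sm] sum_distrib_left mult.left_commute[of "w _"]
        integrable_test test_functions_directional_deriv assms)
  show ?thesis
  proof (rule has_derivativeI_sandwich[of 1])
    show "bounded_linear (\<lambda>h. superpose M w Y (directional_deriv h \<phi>) x)"
      by (subst ext[OF eq]) (intro bounded_linear_sum bounded_linear_mult_const bounded_linear_inner_left)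
    fix y assume "y \<noteq> x"
    define h where "h = y - x"
    have "h \<noteq> 0" using \<open>y \<noteq> x\<close> by (simp add: h_def)
    have "superpose M w Y \<phi> y - superpose M w Y \<phi> x - superpose M w Y (directional_deriv h \<phi>) x
      = (\<integral>\<omega>. w \<omega> * (\<phi> ((x + Y \<omega>) + h) - \<phi> (x + Y \<omega>) - directional_deriv h \<phi> (x + Y \<omega>)) \<partial>M)"
      using integrable_test[OF assms, of y] integrable_test[OF assms, of x] int[of h x]
      by (simp add: superpose_def right_diff_distrib h_def algebra_simps)
    also have "\<bar>\<dots>\<bar> \<le> (\<integral>\<omega>. \<bar>w \<omega>\<bar> * (L * (norm h)\<^sup>2) \<partial>M)"
      by (rule integral_abs_bound[THEN order_trans], rule integral_mono')
        (auto intro!: integrable_mult_left w_integrable integrable_abs mult_left_mono mult_nonneg_nonneg L simp: abs_mult)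
    also have "\<dots> = L * ?W * (norm h)\<^sup>2" by simp
    finally show "norm (superpose M w Y \<phi> y - superpose M w Y \<phi> x - superpose M w Y (directional_deriv (y - x) \<phi>) x)
        / norm (y - x) \<le> L * ?W * norm (y - x)"
      using \<open>h \<noteq> 0\<close> by (simp add: h_def[symmetric] divide_simps power2_eq_square mult_ac)
  next
    show "((\<lambda>y. L * ?W * norm (y - x)) \<longlongrightarrow> 0) (at x)"
      by (auto intro!: tendsto_eq_intros)
  qed auto
qed

lemma directional_deriv_superpose:
  assumes "\<phi> \<in> test_functions"
  shows "directional_deriv b (superpose M w Y \<phi>) = superpose M w Y (directional_deriv b \<phi>)"
  by (rule ext, rule directional_deriv_eqI[OF superpose_has_derivative[OF assms]])

lemma superpose_smooth:
  assumes "\<phi> \<in> test_functions"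
  shows "smooth (superpose M w Y \<phi>)"
proof (rule smooth_coinduct)
  show "superpose M w Y \<phi> \<in> lin_closure (superpose M w Y ` test_functions)"
    using assms by (intro lin_closure_base imageI)
qed (auto simp: directional_deriv_superpose intro!: lin_closure_base imageI test_functions_directional_deriv
      intro: superpose_has_derivative simp: differentiable_def)

lemma superpose_test:
  assumes "\<phi> \<in> test_functions"
  shows "superpose M w Y \<phi> \<in> test_functions"
proof -
  obtain K where K: "compact K" "\<And>x. x \<notin> K \<Longrightarrow> \<phi> x = 0"
    by (rule test_functions_obtain_support[OF assms]) blast
  show ?thesis
  proof (rule test_functionsI[OF superpose_smooth[OF assms]])
    show "compact {x + y |x y. x \<in> K \<and> y \<in> cball 0 C}"
      by (rule compact_sums[OF K(1) compact_cball])
    show "superpose M w Y \<phi> x = 0" if "x \<notin> {x + y |x y. x \<in> K \<and> y \<in> cball 0 C}" for x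
    proof -
      have "w \<omega> * \<phi> (x + Y \<omega>) = 0" for \<omega>
      proof (rule ccontr)
        assume "w \<omega> * \<phi> (x + Y \<omega>) \<noteq> 0"
        then have "x + Y \<omega> \<in> K" "- Y \<omega> \<in> cball 0 C" using K(2) Y_bound by auto
        moreover have "x = (x + Y \<omega>) + (- Y \<omega>)" by simp
        ultimately show False using that by blast
      qed
      then show ?thesis unfolding superpose_def by (simp only: Bochner_Integration.integral_zero)
    qed
  qed
qed

lemma iter_deriv_superpose:
  assumes "\<phi> \<in> test_functions" "set bs \<subseteq> Basis"
  shows "iter_deriv bs (superpose M w Y \<phi>) = superpose M w Y (iter_deriv bs \<phi>)"
  using assms(2)
  by (induction bs) (auto simp: iter_deriv_Cons directional_deriv_superpose test_functions_iter_deriv assms(1))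

end

lemma lborel_translate:
  fixes f :: "'a::euclidean_space \<Rightarrow> real"
  assumes [measurable]: "f \<in> borel_measurable borel"
  shows "integrable lborel (\<lambda>x. f (x + c)) \<longleftrightarrow> integrable lborel f"
    and "(\<integral>x. f (x + c) \<partial>lborel) = (\<integral>x. f x \<partial>lborel)"
proof -
  have *: "distr lborel borel (\<lambda>x. x + c) = (lborel :: 'a measure)"
  proof -
    have "(\<lambda>x. x + c) = (+) c" by (auto simp: fun_eq_iff add.commute)
    then show ?thesis using lborel_distr_plus[of c] by simp
  qed
  show "integrable lborel (\<lambda>x. f (x + c)) \<longleftrightarrow> integrable lborel f"
    using integrable_distr_eq[of "\<lambda>x. x + c" lborel borel f] by (simp add: *)
  show "(\<integral>x. f (x + c) \<partial>lborel) = (\<integral>x. f x \<partial>lborel)"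
    using integral_distr[of "\<lambda>x. x + c" lborel borel f] by (simp add: *)
qed

section \<open>The fundamental lemma of the calculus of variations\<close>

text \<open>For fixed \<open>\<omega>\<close> the integral over \<open>K\<close> of the translated
  |h| is at most the integral of |h| over \<open>K\<close> enlarged by \<open>C\<close>, a number
  that does not depend on \<open>\<omega>\<close>. Hence the iterated integral is finite because
  \<open>w\<close> is integrable.\<close>

lemma (in displacement) loc_int_kernel:
  assumes h: "loc_int h" and K: "compact K"
  shows "integrable (M \<Otimes>\<^sub>M lborel) (\<lambda>(\<omega>, z). indicator K z * (w \<omega> * h (z + Y \<omega>)))"
proof -
  interpret P: pair_sigma_finite M "lborel :: 'a measure" ..
  note [measurable] = loc_int_borel[OF h]
  have [measurable]: "K \<in> sets borel" using K by (simp add: borel_compact)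
  define K' where "K' = {x + y |x y. x \<in> K \<and> y \<in> cball 0 C}"
  have K': "compact K'" unfolding K'_def by (rule compact_sums[OF K compact_cball])
  have [measurable]: "K' \<in> sets borel" using K' by (simp add: borel_compact)
  define I where "I = (\<integral>x. indicator K' x * \<bar>h x\<bar> \<partial>lborel)"
  have int': "integrable lborel (\<lambda>x. indicator K' x * \<bar>h x\<bar>)"
    using integrable_abs[OF loc_int_integrable[OF h K']] by (simp add: abs_mult)
  have bnd: "\<bar>indicator K z * (w \<omega> * h (z + Y \<omega>))\<bar> \<le> \<bar>w \<omega>\<bar> * (indicator K' (z + Y \<omega>) * \<bar>h (z + Y \<omega>)\<bar>)" for z \<omega>
  proof (cases "z \<in> K \<and> w \<omega> \<noteq> 0")
    case True
    then have "z + Y \<omega> \<in> K'" using Y_bound[of \<omega>] by (auto simp: K'_def)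
    then show ?thesis by (simp add: abs_mult indicator_def)
  qed (auto simp: indicator_def)
  have int_tr: "integrable lborel (\<lambda>z. indicator K' (z + Y \<omega>) * \<bar>h (z + Y \<omega>)\<bar>)" for \<omega>
    using int' by (subst lborel_translate(1)[of "\<lambda>x. indicator K' x * \<bar>h x\<bar>"]) auto
  have eq_tr: "(\<integral>z. indicator K' (z + Y \<omega>) * \<bar>h (z + Y \<omega>)\<bar> \<partial>lborel) = I" for \<omega>
    unfolding I_def by (subst lborel_translate(2)[of "\<lambda>x. indicator K' x * \<bar>h x\<bar>"]) auto
  have int_z: "integrable lborel (\<lambda>z. indicator K z * (w \<omega> * h (z + Y \<omega>)))" for \<omega>
    by (rule Bochner_Integration.integrable_bound[OF integrable_mult_right[OF int_tr, of "\<bar>w \<omega>\<bar>"]])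
      (use bnd in \<open>auto simp: abs_mult\<close>)
  show ?thesis
  proof (rule P.Fubini_integrable)
    show "integrable M (\<lambda>\<omega>. \<integral>z. norm (case (\<omega>, z) of (\<omega>, z) \<Rightarrow> indicator K z * (w \<omega> * h (z + Y \<omega>))) \<partial>lborel)"
    proof (rule Bochner_Integration.integrable_bound[OF integrable_mult_left[OF w_integrable, of I]])
      show "AE \<omega> in M. norm (\<integral>z. norm (case (\<omega>, z) of (\<omega>, z) \<Rightarrow> indicator K z * (w \<omega> * h (z + Y \<omega>))) \<partial>lborel) \<le> norm (w \<omega> * I)"
      proof (rule AE_I2)
        fix \<omega>
        have "(\<integral>z. \<bar>indicator K z * (w \<omega> * h (z + Y \<omega>))\<bar> \<partial>lborel)
           \<le> (\<integral>z. \<bar>w \<omega>\<bar> * (indicator K' (z + Y \<omega>) * \<bar>h (z + Y \<omega>)\<bar>) \<partial>lborel)"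
          by (intro integral_mono integrable_abs int_z integrable_mult_right int_tr bnd)
        also have "\<dots> = \<bar>w \<omega>\<bar> * I" by (simp add: eq_tr)
        also have "\<dots> \<le> \<bar>w \<omega> * I\<bar>" by (simp add: abs_mult mult_left_mono)
        finally show "norm (\<integral>z. norm (case (\<omega>, z) of (\<omega>, z) \<Rightarrow> indicator K z * (w \<omega> * h (z + Y \<omega>))) \<partial>lborel) \<le> norm (w \<omega> * I)"
          by simp
      qed
    qed measurable
    show "AE \<omega> in M. integrable lborel (\<lambda>z. case (\<omega>, z) of (\<omega>, z) \<Rightarrow> indicator K z * (w \<omega> * h (z + Y \<omega>)))"
      using int_z by simp
  qed measurable
qed

lemma (in displacement) loc_int_superpose:
  assumes h: "loc_int h"
  shows "loc_int (superpose M w Y h)"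
    and "AE z in lborel. integrable M (\<lambda>\<omega>. w \<omega> * h (z + Y \<omega>))"
proof -
  interpret P: pair_sigma_finite M "lborel :: 'a measure" ..
  interpret Q: pair_sigma_finite "lborel :: 'a measure" M ..
  note [measurable] = loc_int_borel[OF h]
  have int: "integrable (lborel \<Otimes>\<^sub>M M) (\<lambda>(z, \<omega>). indicator K z * (w \<omega> * h (z + Y \<omega>)))"
    if "compact K" for K
    using P.integrable_product_swap[OF loc_int_kernel[OF h that]] by (simp add: case_prod_beta')
  show "loc_int (superpose M w Y h)"
    unfolding loc_int_def
  proof (intro conjI allI impI)
    show "superpose M w Y h \<in> borel_measurable borel"
      unfolding superpose_def by measurable
    fix K :: "'a set" assume "compact K"
    from Q.integrable_fst'[OF int[OF this]]
    show "integrable lborel (\<lambda>x. indicator K x * superpose M w Y h x)"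
      unfolding superpose_def by simp
  qed
  \<comment> \<open>Fubini's theorem gives the claim on each compact set; countably many balls
    exhaust the space, and their indicators are removed afterwards.\<close>
  have "AE z in lborel. \<forall>n::nat. integrable M (\<lambda>\<omega>. indicator (cball 0 (real n)) z * (w \<omega> * h (z + Y \<omega>)))"
    unfolding AE_all_countable
  proof
    fix n :: nat
    from Q.AE_integrable_fst'[OF int[OF compact_cball[of 0 "real n"]]]
    show "AE z in lborel. integrable M (\<lambda>\<omega>. indicator (cball 0 (real n)) z * (w \<omega> * h (z + Y \<omega>)))"
      by simp
  qed
  then show "AE z in lborel. integrable M (\<lambda>\<omega>. w \<omega> * h (z + Y \<omega>))"
  proof eventually_elim
    case (elim z)
    obtain n :: nat where "norm z \<le> real n" using real_arch_simple by blast
    then show ?case using elim[rule_format, of n] by simp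
  qed
qed

text \<open>Transposition: after exchanging the integrals, the substitution x = z + Y \<omega> moves
  the averaging from \<open>h\<close> to \<open>\<phi>\<close> and reverses the displacement. Every
  identity between weak derivatives below passes through this formula.\<close>

lemma (in displacement) integral_superpose:
  assumes h: "loc_int h" and \<phi>: "\<phi> \<in> test_functions"
  shows "(\<integral>z. superpose M w Y h z * \<phi> z \<partial>lborel)
    = (\<integral>x. h x * superpose M w (\<lambda>\<omega>. - Y \<omega>) \<phi> x \<partial>lborel)"
proof -
  interpret P: pair_sigma_finite M "lborel :: 'a measure" ..
  note [measurable] = loc_int_borel[OF h] test_functions_borel[OF \<phi>]
  obtain B K where B: "B \<ge> 0" and K: "compact K" and BK: "\<And>x. \<bar>\<phi> x\<bar> \<le> B * indicator K x"
    by (rule test_functions_dominated[OF \<phi>]) blast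
  define K' where "K' = {x + y |x y. x \<in> K \<and> y \<in> cball 0 C}"
  have K': "compact K'" unfolding K'_def by (rule compact_sums[OF K compact_cball])
  have [measurable]: "K' \<in> sets borel" using K' by (simp add: borel_compact)
  \<comment> \<open>The kernel estimate with zero displacement dominates the integrand after the
    substitution. \<open>max C 0\<close> appears because the sign of \<open>C\<close> is
    unknown.\<close>
  have "displacement M w (\<lambda>\<omega>. 0 :: 'a) (max C 0)"
    by unfold_locales (auto simp: w_integrable)
  note int0 = displacement.loc_int_kernel[OF this h K']
  have int1: "integrable (M \<Otimes>\<^sub>M lborel) (\<lambda>(\<omega>, z). w \<omega> * h (z + Y \<omega>) * \<phi> z)"
  proof (rule Bochner_Integration.integrable_bound[OF integrable_mult_right[OF loc_int_kernel[OF h K], of B]])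
    show "AE x in M \<Otimes>\<^sub>M lborel. norm (case x of (\<omega>, z) \<Rightarrow> w \<omega> * h (z + Y \<omega>) * \<phi> z)
      \<le> norm (B * (case x of (\<omega>, z) \<Rightarrow> indicator K z * (w \<omega> * h (z + Y \<omega>))))"
    proof (rule AE_I2, clarsimp simp: abs_mult)
      fix \<omega> z
      show "\<bar>w \<omega>\<bar> * \<bar>h (z + Y \<omega>)\<bar> * \<bar>\<phi> z\<bar> \<le> \<bar>B\<bar> * (indicator K z * (\<bar>w \<omega>\<bar> * \<bar>h (z + Y \<omega>)\<bar>))"
        using mult_left_mono[OF BK[of z], of "\<bar>w \<omega>\<bar> * \<bar>h (z + Y \<omega>)\<bar>"] B by (simp add: mult_ac)
    qed
  qed measurable
  have int2: "integrable (M \<Otimes>\<^sub>M lborel) (\<lambda>(\<omega>, x). w \<omega> * h x * \<phi> (x - Y \<omega>))"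
  proof (rule Bochner_Integration.integrable_bound[OF integrable_mult_right[OF int0, of B]])
    show "AE x in M \<Otimes>\<^sub>M lborel. norm (case x of (\<omega>, x) \<Rightarrow> w \<omega> * h x * \<phi> (x - Y \<omega>))
      \<le> norm (B * (case x of (\<omega>, z) \<Rightarrow> indicator K' z * (w \<omega> * h (z + 0))))"
    proof (rule AE_I2, clarsimp simp: abs_mult)
      fix \<omega> x
      have "\<bar>w \<omega>\<bar> * \<bar>\<phi> (x - Y \<omega>)\<bar> \<le> \<bar>w \<omega>\<bar> * (B * indicator K' x)"
      proof (cases "w \<omega> \<noteq> 0 \<and> x - Y \<omega> \<in> K")
        case True
        then have "(x - Y \<omega>) + Y \<omega> \<in> K'" unfolding K'_def using Y_bound[of \<omega>] by force
        then have "x \<in> K'" by simp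
        then show ?thesis using BK[of "x - Y \<omega>"] True by (auto intro: mult_left_mono)
      next
        case False
        then show ?thesis using BK[of "x - Y \<omega>"] B by (auto simp: indicator_def)
      qed
      from mult_left_mono[OF this, of "\<bar>h x\<bar>"] B
      show "\<bar>w \<omega>\<bar> * \<bar>h x\<bar> * \<bar>\<phi> (x - Y \<omega>)\<bar> \<le> \<bar>B\<bar> * (indicator K' x * (\<bar>w \<omega>\<bar> * \<bar>h x\<bar>))"
        by (simp add: mult_ac)
    qed
  qed measurable
  have "(\<integral>z. superpose M w Y h z * \<phi> z \<partial>lborel) = (\<integral>z. (\<integral>\<omega>. w \<omega> * h (z + Y \<omega>) * \<phi> z \<partial>M) \<partial>lborel)"
    unfolding superpose_def by simp
  also have "\<dots> = (\<integral>\<omega>. (\<integral>z. w \<omega> * h (z + Y \<omega>) * \<phi> z \<partial>lborel) \<partial>M)"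
    by (rule P.Fubini_integral[OF int1])
  also have "\<dots> = (\<integral>\<omega>. (\<integral>x. w \<omega> * h x * \<phi> (x - Y \<omega>) \<partial>lborel) \<partial>M)"
  proof (rule Bochner_Integration.integral_cong[OF refl])
    fix \<omega>
    show "(\<integral>z. w \<omega> * h (z + Y \<omega>) * \<phi> z \<partial>lborel) = (\<integral>x. w \<omega> * h x * \<phi> (x - Y \<omega>) \<partial>lborel)"
      using lborel_translate(2)[of "\<lambda>x. w \<omega> * h x * \<phi> (x - Y \<omega>)" "Y \<omega>"] by simp
  qed
  also have "\<dots> = (\<integral>x. (\<integral>\<omega>. w \<omega> * h x * \<phi> (x - Y \<omega>) \<partial>M) \<partial>lborel)"
    by (rule P.Fubini_integral[OF int2, symmetric])
  also have "\<dots> = (\<integral>x. h x * superpose M w (\<lambda>\<omega>. - Y \<omega>) \<phi> x \<partial>lborel)"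
    unfolding superpose_def by (simp add: mult_ac flip: integral_mult_right_zero)
  finally show ?thesis .
qed

section \<open>Bumps on boxes and the vanishing criterion\<close>

text \<open>Each factor is flat at one face of the box, so the product is positive exactly inside; a
  large scale \<open>k\<close> lifts every interior value towards 1, so that indicators of boxes
  become limits of test functions.\<close>

definition box_bump :: "'a::euclidean_space \<Rightarrow> 'a \<Rightarrow> real \<Rightarrow> 'a \<Rightarrow> real" where
  "box_bump a b k x = (\<Prod>i\<in>Basis. flat_mono 0 (k * (x \<bullet> i) - k * (a \<bullet> i)) * flat_mono 0 (k * (b \<bullet> i) - k * (x \<bullet> i)))"

lemma flat_mono_0: "0 \<le> flat_mono 0 t" "flat_mono 0 t \<le> 1" "flat_mono 0 t > 0 \<longleftrightarrow> t > 0" "t \<le> 0 \<Longrightarrow> flat_mono 0 t = 0"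
  by (auto simp: flat_mono_def)

lemma smooth_box_bump: "smooth (box_bump a b k)"
proof -
  have "smooth (\<lambda>x. \<Prod>i\<in>Basis. flat_mono 0 (k * (x \<bullet> i) + (- k * (a \<bullet> i))) * flat_mono 0 ((-k) * (x \<bullet> i) + k * (b \<bullet> i)))"
    by (intro smooth_prod smooth_mult smooth_affine smooth_flat_mono)
  moreover have "(\<lambda>x. \<Prod>i\<in>Basis. flat_mono 0 (k * (x \<bullet> i) + (- k * (a \<bullet> i))) * flat_mono 0 ((-k) * (x \<bullet> i) + k * (b \<bullet> i)))
     = box_bump a b k"
    by (auto simp: box_bump_def algebra_simps)
  ultimately show ?thesis by simp
qed

lemma box_bump_bounds: "0 \<le> box_bump a b k x" "box_bump a b k x \<le> 1"
  unfolding box_bump_def by (auto intro!: prod_nonneg prod_le_1 mult_nonneg_nonneg mult_le_one simp: flat_mono_0)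

lemma box_bump_pos_iff: "k > 0 \<Longrightarrow> box_bump a b k x > 0 \<longleftrightarrow> x \<in> box a b"
proof -
  assume k: "k > 0"
  have "box_bump a b k x > 0 \<longleftrightarrow> (\<forall>i\<in>Basis. flat_mono 0 (k * (x \<bullet> i) - k * (a \<bullet> i)) * flat_mono 0 (k * (b \<bullet> i) - k * (x \<bullet> i)) \<noteq> 0)"
    using box_bump_bounds(1)[of a b k x] by (auto simp: box_bump_def less_le)
  also have "\<dots> \<longleftrightarrow> (\<forall>i\<in>Basis. flat_mono 0 (k * (x \<bullet> i) - k * (a \<bullet> i)) > 0 \<and> flat_mono 0 (k * (b \<bullet> i) - k * (x \<bullet> i)) > 0)"
    using flat_mono_0(1) by (force simp: less_le)
  also have "\<dots> \<longleftrightarrow> x \<in> box a b" using k by (simp add: flat_mono_0(3) mem_box)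
  finally show ?thesis .
qed

lemma box_bump_outside: "k > 0 \<Longrightarrow> x \<notin> box a b \<Longrightarrow> box_bump a b k x = 0"
  using box_bump_pos_iff box_bump_bounds(1) by (metis less_eq_real_def)

lemma box_bump_test: "k > 0 \<Longrightarrow> box_bump a b k \<in> test_functions"
  by (rule test_functionsI[OF smooth_box_bump compact_cbox[of a b]])
    (metis box_bump_outside box_subset_cbox subsetD)

lemma box_bump_tendsto: "(\<lambda>n. box_bump a b (real (Suc n)) x) \<longlonglongrightarrow> indicator (box a b) x"
proof (cases "x \<in> box a b")
  case True
  have *: "(\<lambda>n. flat_mono 0 (real (Suc n) * c)) \<longlonglongrightarrow> 1" if "c > 0" for c
  proof -
    have "(\<lambda>n. exp (- (inverse (real (Suc n)) * (1 / c)))) \<longlonglongrightarrow> exp (- (0 * (1 / c)))"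
      by (intro tendsto_intros LIMSEQ_inverse_real_of_nat)
    moreover have "flat_mono 0 (real (Suc n) * c) = exp (- (inverse (real (Suc n)) * (1 / c)))" for n
      using that by (simp add: flat_mono_def divide_simps)
    ultimately show ?thesis by simp
  qed
  have "(\<lambda>n. \<Prod>i\<in>Basis. flat_mono 0 (real (Suc n) * (x \<bullet> i - a \<bullet> i)) * flat_mono 0 (real (Suc n) * (b \<bullet> i - x \<bullet> i)))
      \<longlonglongrightarrow> (\<Prod>i\<in>(Basis::'a set). 1 * 1)"
    by (intro tendsto_prod tendsto_mult *) (use True in \<open>auto simp: mem_box\<close>)
  then show ?thesis using True by (simp add: box_bump_def right_diff_distrib)
qed (simp add: box_bump_outside)

lemma loc_int_box_integral_zero:
  assumes h: "loc_int h" and zero: "\<And>\<phi>. \<phi> \<in> test_functions \<Longrightarrow> (\<integral>x. h x * \<phi> x \<partial>lborel) = 0"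
  shows "(\<integral>x. indicator (box a b) x * h x \<partial>lborel) = 0"
proof -
  note [measurable] = loc_int_borel[OF h]
  have [measurable]: "box_bump a b (real (Suc n)) \<in> borel_measurable borel" for n
    by (rule test_functions_borel[OF box_bump_test]) simp
  have "(\<lambda>n. \<integral>x. h x * box_bump a b (real (Suc n)) x \<partial>lborel) \<longlonglongrightarrow> (\<integral>x. h x * indicator (box a b) x \<partial>lborel)"
  proof (rule integral_dominated_convergence)
    show "integrable lborel (\<lambda>x. \<bar>indicator (cbox a b) x * h x\<bar>)"
      by (intro integrable_abs loc_int_integrable[OF h] compact_cbox)
    show "AE x in lborel. (\<lambda>n. h x * box_bump a b (real (Suc n)) x) \<longlonglongrightarrow> h x * indicator (box a b) x"
      by (intro AE_I2 tendsto_mult tendsto_const box_bump_tendsto)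
    show "AE x in lborel. norm (h x * box_bump a b (real (Suc n)) x) \<le> \<bar>indicator (cbox a b) x * h x\<bar>" for n
    proof (rule AE_I2)
      fix x
      show "norm (h x * box_bump a b (real (Suc n)) x) \<le> \<bar>indicator (cbox a b) x * h x\<bar>"
        using box_bump_bounds[of a b "real (Suc n)" x] box_bump_outside[of "real (Suc n)" x a b] box_subset_cbox[of a b]
        by (cases "x \<in> box a b") (auto simp: abs_mult mult_left_le subset_iff)
    qed
  qed measurable
  moreover have "(\<integral>x. h x * box_bump a b (real (Suc n)) x \<partial>lborel) = 0" for n
    by (intro zero box_bump_test) simp
  ultimately have "(\<integral>x. h x * indicator (box a b) x \<partial>lborel) = 0"
    by (simp add: LIMSEQ_const_iff)
  then show ?thesis by (simp add: mult.commute)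
qed

text \<open>The positive and the negative part of \<open>h\<close> are densities of two measures.
  They agree on boxes by \<open>loc_int_box_integral_zero\<close>, and boxes form an
  intersection-stable generator, so the measures coincide. Equal densities leave only
  \<open>h = 0\<close>, because the two parts are never positive at the same point. The parameter
  \<open>s\<close>, taken as 1 and -1, treats both parts at once.\<close>

lemma du_Bois_Reymond:
  assumes h: "loc_int h" and zero: "\<And>\<phi>. \<phi> \<in> test_functions \<Longrightarrow> (\<integral>x. h x * \<phi> x \<partial>lborel) = 0"
  shows "AE x in lborel. h x = 0"
proof -
  note [measurable] = loc_int_borel[OF h]
  have int: "integrable lborel (\<lambda>x. indicator (box a b) x * h x)" for a b
    using loc_int_integrable_bounded[OF h compact_cbox[of a b], of "indicator (box a b)" 1] box_subset_cbox[of a b]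
    by (auto simp: indicator_def mult.commute)
  have E: "emeasure (density lborel (\<lambda>x. ennreal (max 0 (s * h x)))) (box a b)
     = ennreal (\<integral>x. indicator (box a b) x * max 0 (s * h x) \<partial>lborel)" for s a b
  proof -
    have "emeasure (density lborel (\<lambda>x. ennreal (max 0 (s * h x)))) (box a b)
      = (\<integral>\<^sup>+x. ennreal (indicator (box a b) x * max 0 (s * h x)) \<partial>lborel)"
      by (subst emeasure_density) (auto intro!: nn_integral_cong simp: indicator_def)
    also have "\<dots> = ennreal (\<integral>x. indicator (box a b) x * max 0 (s * h x) \<partial>lborel)"
    proof (rule nn_integral_eq_integral)
      have "integrable lborel (\<lambda>x. max 0 (s * (indicator (box a b) x * h x)))"
        by (intro integrable_max integrable_mult_right int) simp
      then show "integrable lborel (\<lambda>x. indicator (box a b) x * max 0 (s * h x))"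
        by (rule Bochner_Integration.integrable_cong[THEN iffD1, rotated -1]) (auto simp: indicator_def)
    qed auto
    finally show ?thesis .
  qed
  have eq: "(\<integral>x. indicator (box a b) x * max 0 (1 * h x) \<partial>lborel) = (\<integral>x. indicator (box a b) x * max 0 (- 1 * h x) \<partial>lborel)" for a b
  proof -
    have i: "integrable lborel (\<lambda>x. max 0 (s * (indicator (box a b) x * h x)))" for s
      by (intro integrable_max integrable_mult_right int) simp
    have "(\<integral>x. max 0 (1 * (indicator (box a b) x * h x)) \<partial>lborel) - (\<integral>x. max 0 (- 1 * (indicator (box a b) x * h x)) \<partial>lborel)
      = (\<integral>x. indicator (box a b) x * h x \<partial>lborel)"
      by (subst Bochner_Integration.integral_diff[symmetric, OF i i])
        (auto intro!: Bochner_Integration.integral_cong)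
    also have "\<dots> = 0" by (rule loc_int_box_integral_zero[OF assms])
    finally have "(\<integral>x. max 0 (1 * (indicator (box a b) x * h x)) \<partial>lborel) = (\<integral>x. max 0 (- 1 * (indicator (box a b) x * h x)) \<partial>lborel)"
      by simp
    moreover have "max 0 (s * (indicator (box a b) x * h x)) = indicator (box a b) x * max 0 (s * h x)" for s x
      by (auto simp: indicator_def)
    ultimately show ?thesis by (simp only:)
  qed
  have "density lborel (\<lambda>x. ennreal (max 0 (1 * h x))) = density lborel (\<lambda>x. ennreal (max 0 (- 1 * h x)))"
  proof (rule measure_eqI_generator_eq[where \<Omega>=UNIV and E="range (\<lambda>(a, b). box a b)" and A="\<lambda>n. box (- (real n *\<^sub>R One)) (real n *\<^sub>R One)"])
    show "Int_stable (range (\<lambda>(a, b). box a b :: 'a set))"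
      by (auto simp: Int_stable_def Int_interval box_Int_box)
    show "emeasure (density lborel (\<lambda>x. ennreal (max 0 (1 * h x)))) X = emeasure (density lborel (\<lambda>x. ennreal (max 0 (- 1 * h x)))) X"
      if "X \<in> range (\<lambda>(a, b). box a b)" for X
      using that E[of 1] E[of "-1"] eq by auto
    show "(\<Union>n. box (- (real n *\<^sub>R One)) (real n *\<^sub>R One)) = (UNIV :: 'a set)"
      by (rule UN_box_eq_UNIV)
    show "emeasure (density lborel (\<lambda>x. ennreal (max 0 (1 * h x)))) (box (- (real n *\<^sub>R One)) (real n *\<^sub>R One)) \<noteq> \<infinity>" for n
      by (subst E) simp
  qed (auto simp: borel_eq_box)
  then have "AE x in lborel. ennreal (max 0 (1 * h x)) = ennreal (max 0 (- 1 * h x))"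
    by (intro sigma_finite_measure.density_unique[OF lborel.sigma_finite_measure_axioms]) auto
  then show ?thesis
    by eventually_elim (auto simp: max_def split: if_splits)
qed

section \<open>Differentiation of one-dimensional primitives\<close>

text \<open>The bad set is covered, by Vitali's theorem, by disjoint intervals whose total length Henstock's lemma
  makes arbitrarily small.\<close>

lemma negligible_not_differentiable_primitive_aux:
  fixes f :: "real \<Rightarrow> real"
  assumes f: "f integrable_on {a..b}" and "\<eta> > 0"
  defines "F \<equiv> \<lambda>y. integral {a..y} f"
  shows "negligible {x \<in> {a..b}. \<forall>d>0. \<exists>y\<in>{a..b}. y \<noteq> x \<and> \<bar>y - x\<bar> < d \<and> \<bar>F y - F x - f x * (y - x)\<bar> > \<eta> * \<bar>y - x\<bar>}"
    (is "negligible ?E")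
  unfolding negligible_outer
proof (intro allI impI)
  fix e :: real assume "e > 0"
  \<comment> \<open>A bad interval contributes to the Henstock sum more than \<open>\<eta>\<close>
    times its length, so this tolerance bounds the total length of disjoint bad intervals by
    \<open>e / 2\<close>.\<close>
  obtain \<gamma> where \<gamma>: "gauge \<gamma>"
    "\<And>p. p tagged_partial_division_of (cbox a b) \<Longrightarrow> \<gamma> fine p \<Longrightarrow> (\<Sum>(x,k)\<in>p. norm (measure lborel k *\<^sub>R f x - integral k f)) < \<eta> * (e / 2)"
    using Henstock_lemma[of f a b "\<eta> * (e / 2)"] f \<open>e > 0\<close> \<open>\<eta> > 0\<close> by (auto simp: cbox_interval)
  define I :: "real \<times> real \<Rightarrow> real set" where "I = (\<lambda>(x,y). {min x y..max x y})"
  \<comment> \<open>A pair stores the tag \<open>x\<close>, which is one endpoint, and the other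
    endpoint \<open>y\<close>. The interval between them is the closed ball
    \<open>cball (c i) (r i)\<close>, the form required by Vitali's covering theorem.\<close>
  define K where "K = {(x,y). x \<in> ?E \<and> y \<in> {a..b} \<and> y \<noteq> x \<and> I (x,y) \<subseteq> \<gamma> x \<and> \<bar>F y - F x - f x * (y - x)\<bar> > \<eta> * \<bar>y - x\<bar>}"
  define c :: "real \<times> real \<Rightarrow> real" where "c = (\<lambda>(x,y). (x + y) / 2)"
  define r :: "real \<times> real \<Rightarrow> real" where "r = (\<lambda>(x,y). \<bar>y - x\<bar> / 2)"
  have ball: "cball (c i) (r i) = I i" for i
    by (cases i) (auto simp: c_def r_def I_def cball_eq_atLeastAtMost min_def max_def field_simps)
  have Vit: "\<exists>i. i \<in> K \<and> x \<in> cball (c i) (r i) \<and> r i < d" if "x \<in> ?E" "0 < d" for x d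
  proof -
    have "open (\<gamma> x)" "x \<in> \<gamma> x" using \<gamma>(1) by (auto simp: gauge_def)
    then obtain d' where d': "d' > 0" "ball x d' \<subseteq> \<gamma> x" using open_contains_ball by blast
    have "min d d' > 0" using \<open>d > 0\<close> d' by simp
    with \<open>x \<in> ?E\<close> obtain y where y: "y \<in> {a..b}" "y \<noteq> x" "\<bar>y - x\<bar> < min d d'" "\<bar>F y - F x - f x * (y - x)\<bar> > \<eta> * \<bar>y - x\<bar>"
      by blast
    have "I (x,y) \<subseteq> ball x d'" using y by (auto simp: I_def dist_real_def)
    then have "(x,y) \<in> K" using y that d' by (auto simp: K_def)
    moreover have "x \<in> cball (c (x,y)) (r (x,y))" unfolding ball by (simp add: I_def)
    moreover have "r (x,y) < d" using y \<open>d > 0\<close> by (simp add: r_def)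
    ultimately show ?thesis by blast
  qed
  have "0 < r i" if "i \<in> K" for i using that by (auto simp: K_def r_def)
  then obtain C where C: "countable C" "C \<subseteq> K"
     "pairwise (\<lambda>i j. disjnt (cball (c i) (r i)) (cball (c j) (r j))) C"
     "negligible (?E - (\<Union>i \<in> C. cball (c i) (r i)))"
    using Vitali_covering_theorem_cballs[of K r ?E c] Vit by blast
  have bound: "measure lebesgue (\<Union>i\<in>C'. I i) \<le> e / 2" if C': "C' \<subseteq> C" "finite C'" for C'
  proof -
    have inj: "inj_on (\<lambda>i. (fst i, I i)) C'"
    proof (rule inj_onI)
      fix i j assume ij: "i \<in> C'" "j \<in> C'" "(fst i, I i) = (fst j, I j)"
      have "I i \<noteq> {}" by (cases i) (auto simp: I_def)
      then show "i = j" using C(3) C' ij unfolding pairwise_def ball disjnt_def by blast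
    qed
    let ?p = "(\<lambda>i. (fst i, I i)) ` C'"
    have pmem: "\<exists>y. (x, y) \<in> C' \<and> k = I (x, y)" if "(x, k) \<in> ?p" for x k
    proof -
      from that obtain i where "(x, k) = (fst i, I i)" "i \<in> C'" by (rule imageE)
      then show ?thesis by (intro exI[of _ "snd i"]) simp
    qed
    have "?p tagged_partial_division_of cbox a b"
      unfolding tagged_partial_division_of_def
    proof (intro conjI allI impI)
      fix x k assume "(x, k) \<in> ?p"
      with pmem obtain y where xy: "(x,y) \<in> C'" "k = I (x,y)" by blast
      then have "(x,y) \<in> K" using C C' by auto
      then show "x \<in> k" "k \<subseteq> cbox a b" "\<exists>a b. k = cbox a b"
        using xy by (auto simp: I_def K_def cbox_interval)
    next
      fix x k x' k' assume asm: "(x, k) \<in> ?p \<and> (x',k') \<in> ?p \<and> (x, k) \<noteq> (x', k')"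
      with pmem obtain y where xy: "(x,y) \<in> C'" "k = I (x,y)" by blast
      from asm obtain y' where xy': "(x',y') \<in> C'" "k' = I (x',y')" "(x, k) \<noteq> (x', k')" using pmem by blast
      have "(x,y) \<noteq> (x',y')" using xy xy' by auto
      then have "I (x,y) \<inter> I (x',y') = {}"
        using C(3) C' xy xy' unfolding pairwise_def ball disjnt_def by blast
      then show "interior k \<inter> interior k' = {}"
        using xy(2) xy'(2) interior_subset by blast
    qed (use C' in auto)
    moreover have "\<gamma> fine ?p" using C C' by (force simp: fine_def K_def)
    ultimately have "(\<Sum>(x,k)\<in>?p. norm (measure lborel k *\<^sub>R f x - integral k f)) < \<eta> * (e / 2)" by (rule \<gamma>(2))
    also have "(\<Sum>(x,k)\<in>?p. norm (measure lborel k *\<^sub>R f x - integral k f)) = (\<Sum>i\<in>C'. norm (measure lborel (I i) *\<^sub>R f (fst i) - integral (I i) f))"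
      by (subst sum.reindex[OF inj]) (simp add: o_def)
    finally have less: "(\<Sum>i\<in>C'. norm (measure lborel (I i) *\<^sub>R f (fst i) - integral (I i) f)) < \<eta> * (e / 2)" .
    have "\<eta> * (\<Sum>i\<in>C'. measure lborel (I i)) = (\<Sum>i\<in>C'. \<eta> * measure lborel (I i))" by (simp add: sum_distrib_left)
    also have "\<dots> \<le> (\<Sum>i\<in>C'. norm (measure lborel (I i) *\<^sub>R f (fst i) - integral (I i) f))"
    proof (rule sum_mono)
      fix i assume "i \<in> C'"
      then obtain x y where i: "i = (x,y)" "(x,y) \<in> K" using C C' by (cases i) auto
      then have xy: "x \<in> {a..b}" "y \<in> {a..b}" "y \<noteq> x" "\<bar>F y - F x - f x * (y - x)\<bar> > \<eta> * \<bar>y - x\<bar>" by (auto simp: K_def)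
      have comb: "integral {u..v} f = F v - F u" if "u \<in> {a..b}" "v \<in> {a..b}" "u \<le> v" for u v
      proof -
        have "f integrable_on {a..v}" using f that by (auto intro: integrable_subinterval_real)
        then show ?thesis using Henstock_Kurzweil_Integration.integral_combine[of a u v f] that by (auto simp: F_def)
      qed
      show "\<eta> * measure lborel (I i) \<le> norm (measure lborel (I i) *\<^sub>R f (fst i) - integral (I i) f)"
      proof (cases "x < y")
        case True
        then show ?thesis using xy comb[of x y] i(1) by (simp add: I_def algebra_simps abs_minus_commute)
      next
        case False
        then have "y < x" using xy by simp
        then show ?thesis using xy comb[of y x] i(1) by (simp add: I_def algebra_simps abs_minus_commute)
      qed
    qed
    also note less
    finally have "(\<Sum>i\<in>C'. measure lborel (I i)) < e / 2" using \<open>\<eta> > 0\<close> by simp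
    moreover have "measure lebesgue (\<Union>i\<in>C'. I i) \<le> (\<Sum>i\<in>C'. measure lebesgue (I i))"
      by (rule measure_UNION_le[OF C'(2)]) (auto simp: I_def)
    moreover have "measure lebesgue (I i) = measure lborel (I i)" for i
      by (cases i) (simp add: I_def)
    ultimately show ?thesis by simp
  qed
  have I_lm: "I i \<in> lmeasurable" for i by (cases i) (simp add: I_def)
  have U: "(\<Union>i\<in>C. I i) \<in> lmeasurable" "measure lebesgue (\<Union>i\<in>C. I i) \<le> e / 2"
    using fmeasurable_UN_bound[OF C(1) I_lm bound] measure_UN_bound[OF C(1) I_lm bound] by auto
  have N: "?E - (\<Union>i\<in>C. I i) \<in> lmeasurable" "measure lebesgue (?E - (\<Union>i\<in>C. I i)) = 0"
    using C(4) by (simp_all add: ball negligible_imp_measurable negligible_imp_measure0)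
  show "\<exists>T. ?E \<subseteq> T \<and> T \<in> lmeasurable \<and> measure lebesgue T < e"
  proof (intro exI conjI)
    show "?E \<subseteq> (\<Union>i\<in>C. I i) \<union> (?E - (\<Union>i\<in>C. I i))" by blast
    show "(\<Union>i\<in>C. I i) \<union> (?E - (\<Union>i\<in>C. I i)) \<in> lmeasurable" by (intro fmeasurable.Un U N)
    have "measure lebesgue ((\<Union>i\<in>C. I i) \<union> (?E - (\<Union>i\<in>C. I i))) \<le> e / 2 + 0"
      using measure_Un_le[of "\<Union>i\<in>C. I i" lebesgue "?E - (\<Union>i\<in>C. I i)"] U N by (auto dest: fmeasurableD)
    then show "measure lebesgue ((\<Union>i\<in>C. I i) \<union> (?E - (\<Union>i\<in>C. I i))) < e" using \<open>e > 0\<close> by simp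
  qed
qed

lemma negligible_not_differentiable_primitive:
  fixes f :: "real \<Rightarrow> real"
  assumes f: "f integrable_on {a..b}"
  shows "negligible {x \<in> {a<..<b}. \<not> ((\<lambda>y. integral {a..y} f) has_real_derivative f x) (at x)}"
proof -
  define F where "F = (\<lambda>y. integral {a..y} f)"
  define E where "E = (\<lambda>\<eta>. {x \<in> {a..b}. \<forall>d>0. \<exists>y\<in>{a..b}. y \<noteq> x \<and> \<bar>y - x\<bar> < d \<and> \<bar>F y - F x - f x * (y - x)\<bar> > \<eta> * \<bar>y - x\<bar>})"
  have "negligible (\<Union>n. E (inverse (real (Suc n))))"
    unfolding E_def F_def
    by (intro negligible_Union_nat negligible_not_differentiable_primitive_aux[OF f]) simp
  moreover have "{x \<in> {a<..<b}. \<not> (F has_real_derivative f x) (at x)} \<subseteq> (\<Union>n. E (inverse (real (Suc n))))"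
  proof (rule subsetI, rule ccontr)
    fix x assume "x \<in> {x \<in> {a<..<b}. \<not> (F has_real_derivative f x) (at x)}"
      and *: "x \<notin> (\<Union>n. E (inverse (real (Suc n))))"
    then have x: "a < x" "x < b" "\<not> (F has_real_derivative f x) (at x)" by auto
    have "(F has_derivative (*) (f x)) (at x within {a..b})"
    proof (subst has_derivative_within_alt, intro conjI allI impI)
      fix e :: real assume "e > 0"
      then obtain n where n: "inverse (real (Suc n)) < e" using reals_Archimedean by blast
      have "x \<notin> E (inverse (real (Suc n)))" using * by blast
      then have "\<exists>d>0. \<forall>y\<in>{a..b}. y = x \<or> d \<le> \<bar>y - x\<bar> \<or> \<bar>F y - F x - f x * (y - x)\<bar> \<le> inverse (real (Suc n)) * \<bar>y - x\<bar>"
        using x unfolding E_def by (simp add: not_less del: of_nat_Suc)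
      then obtain d where d: "d > 0" "\<And>y. y \<in> {a..b} \<Longrightarrow> y \<noteq> x \<Longrightarrow> \<bar>y - x\<bar> < d \<Longrightarrow> \<bar>F y - F x - f x * (y - x)\<bar> \<le> inverse (real (Suc n)) * \<bar>y - x\<bar>"
        by (metis not_less)
      have "norm (F y - F x - f x * (y - x)) \<le> e * norm (y - x)" if "y \<in> {a..b}" "norm (y - x) < d" for y
      proof (cases "y = x")
        case False
        have "norm (F y - F x - f x * (y - x)) \<le> inverse (real (Suc n)) * \<bar>y - x\<bar>" using d(2)[of y] that False by simp
        also have "\<dots> \<le> e * norm (y - x)" using n by (auto intro!: mult_right_mono)
        finally show ?thesis .
      qed simp
      then show "\<exists>d>0. \<forall>y\<in>{a..b}. norm (y - x) < d \<longrightarrow> norm (F y - F x - f x * (y - x)) \<le> e * norm (y - x)"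
        using d(1) by blast
    qed (rule bounded_linear_mult_right)
    then have "(F has_real_derivative f x) (at x within {a..b})" by (simp add: has_field_derivative_def)
    then show False using x by (simp add: at_within_Icc_at)
  qed
  ultimately show ?thesis unfolding F_def by (rule negligible_subset)
qed

section \<open>Primitives of locally integrable functions\<close>

definition ray_integral :: "(real \<Rightarrow> real) \<Rightarrow> real \<Rightarrow> real" where
  "ray_integral f t = (\<integral>s. (if 0 \<le> s \<and> s \<le> t then 1 else 0) * f s \<partial>lborel)"

lemma loc_int_real_integrable_on:
  fixes f :: "real \<Rightarrow> real"
  assumes "loc_int f"
  shows "f integrable_on {a..b}" and "(\<integral>s. indicator {a..b} s * f s \<partial>lborel) = integral {a..b} f"
proof -
  have "set_integrable lborel {a..b} f"
    using loc_int_integrable[OF assms, of "{a..b}"] by (simp add: set_integrable_def)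
  from set_borel_integral_eq_integral[OF this]
  show "f integrable_on {a..b}" and "(\<integral>s. indicator {a..b} s * f s \<partial>lborel) = integral {a..b} f"
    by (simp_all add: set_lebesgue_integral_def)
qed

lemma ray_integral_eq:
  assumes "loc_int f"
  shows "ray_integral f t = integral {0..t} f"
proof -
  have "ray_integral f t = (\<integral>s. indicator {0..t} s * f s \<partial>lborel)"
    unfolding ray_integral_def by (intro Bochner_Integration.integral_cong) (auto simp: indicator_def)
  then show ?thesis using loc_int_real_integrable_on(2)[OF assms] by simp
qed

lemma loc_int_primitive_differentiable:
  fixes f :: "real \<Rightarrow> real"
  assumes "loc_int f"
  shows "AE x in lborel. a < x \<longrightarrow> ((\<lambda>y. integral {a..y} f) has_real_derivative f x) (at x)"
proof -
  have "negligible (\<Union>n. {x \<in> {a<..<real n}. \<not> ((\<lambda>y. integral {a..y} f) has_real_derivative f x) (at x)})"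
    by (intro negligible_Union_nat negligible_not_differentiable_primitive loc_int_real_integrable_on assms)
  moreover have "{x. \<not> (a < x \<longrightarrow> ((\<lambda>y. integral {a..y} f) has_real_derivative f x) (at x))}
    \<subseteq> (\<Union>n. {x \<in> {a<..<real n}. \<not> ((\<lambda>y. integral {a..y} f) has_real_derivative f x) (at x)})"
    using reals_Archimedean2 by auto
  ultimately have "negligible {x. \<not> (a < x \<longrightarrow> ((\<lambda>y. integral {a..y} f) has_real_derivative f x) (at x))}"
    by (rule negligible_subset)
  then have "AE x in lebesgue. a < x \<longrightarrow> ((\<lambda>y. integral {a..y} f) has_real_derivative f x) (at x)"
    by (intro AE_I'[of "{x. \<not> (a < x \<longrightarrow> ((\<lambda>y. integral {a..y} f) has_real_derivative f x) (at x))}"])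
      (auto simp: negligible_iff_null_sets)
  then show ?thesis by (simp add: AE_completion_iff)
qed

section \<open>Preimages of null sets\<close>

text \<open>Near a point with nonzero derivative \<open>G\<close> expands distances from that point
  by a definite factor. Sorting the points by this factor and cutting into short cells leaves
  countably many pieces on which \<open>G\<close> is injective with Lipschitz inverse; such an
  inverse maps the null set of values back to a null set.\<close>

lemma negligible_critical_preimage:
  fixes G :: "real \<Rightarrow> real"
  assumes N: "negligible N"
    and G: "\<And>r. r \<in> S \<Longrightarrow> G r \<in> N \<and> (\<exists>d. d \<noteq> 0 \<and> (G has_real_derivative d) (at r))"
  shows "negligible S"
proof -
  define A where "A = (\<lambda>n. {r \<in> S. \<forall>s. \<bar>s - r\<bar> < inverse (real (Suc n)) \<longrightarrow> \<bar>G s - G r\<bar> \<ge> inverse (real (Suc n)) * \<bar>s - r\<bar>})"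
  \<comment> \<open>Cells of length 1 / (2 (n + 1)): two points of a cell are closer than the radius
    1 / (n + 1) on which the expansion in \<open>A n\<close> is valid.\<close>
  define J where "J = (\<lambda>n j. {r. \<lfloor>r * (2 * real (Suc n))\<rfloor> = j})"
  have cell: "negligible (A n \<inter> J n j)" for n j
  proof -
    let ?B = "A n \<inter> J n j"
    have lip: "inverse (real (Suc n)) * \<bar>s - r\<bar> \<le> \<bar>G s - G r\<bar>" if "r \<in> ?B" "s \<in> ?B" for r s
    proof -
      have "\<bar>s * (2 * real (Suc n)) - r * (2 * real (Suc n))\<bar> < 1"
        using that by (simp add: J_def) linarith
      then have "\<bar>s - r\<bar> * (2 * real (Suc n)) < 1" by (simp add: left_diff_distrib[symmetric] abs_mult)
      then have "\<bar>s - r\<bar> < inverse (real (Suc n))"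
        by (simp add: field_simps)
      then show ?thesis using that(1) by (auto simp: A_def)
    qed
    have inj: "inj_on G ?B"
    proof (rule inj_onI)
      fix r s assume "r \<in> ?B" "s \<in> ?B" "G r = G s"
      with lip[of r s] have "inverse (real (Suc n)) * \<bar>s - r\<bar> \<le> 0" by simp
      then show "r = s" by (simp add: mult_le_0_iff)
    qed
    have "negligible (inv_into ?B G ` (G ` ?B))"
    proof (rule negligible_locally_Lipschitz_image)
      show "negligible (G ` ?B)" by (rule negligible_subset[OF N]) (use G in \<open>auto simp: A_def\<close>)
      fix x assume "x \<in> G ` ?B"
      then obtain r where r: "r \<in> ?B" "x = G r" by blast
      show "\<exists>T B. open T \<and> x \<in> T \<and> (\<forall>y\<in>G ` ?B \<inter> T. norm (inv_into ?B G y - inv_into ?B G x) \<le> B * norm (y - x))"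
      proof (intro exI[of _ UNIV] exI[of _ "real (Suc n)"] conjI ballI)
        fix y assume "y \<in> G ` ?B \<inter> UNIV"
        then obtain s where s: "s \<in> ?B" "y = G s" by blast
        have "\<bar>s - r\<bar> \<le> real (Suc n) * \<bar>G s - G r\<bar>"
          using lip[OF r(1) s(1)] by (simp add: field_simps)
        then show "norm (inv_into ?B G y - inv_into ?B G x) \<le> real (Suc n) * norm (y - x)"
          using r s inj by (simp add: inv_into_f_f)
      qed auto
    qed simp
    moreover have "inv_into ?B G ` (G ` ?B) = ?B"
      by (rule inv_into_image_cancel[OF inj order_refl])
    ultimately show ?thesis by simp
  qed
  have "S \<subseteq> (\<Union>n. \<Union>j\<in>UNIV. A n \<inter> J n j)"
  proof
    fix r assume r: "r \<in> S"
    then obtain d where d: "d \<noteq> 0" "(G has_real_derivative d) (at r)" using G by blast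
    have "((\<lambda>s. (G s - G r) / (s - r)) \<longlongrightarrow> d) (at r)"
      using d(2) by (simp add: has_field_derivative_iff)
    then have "eventually (\<lambda>s. dist ((G s - G r) / (s - r)) d < \<bar>d\<bar> / 2) (at r)"
      using d(1) by (intro tendstoD) auto
    then obtain e where e: "e > 0" "\<And>s. s \<noteq> r \<Longrightarrow> \<bar>s - r\<bar> < e \<Longrightarrow> \<bar>(G s - G r) / (s - r) - d\<bar> < \<bar>d\<bar> / 2"
      by (auto simp: eventually_at dist_real_def)
    have "min e (\<bar>d\<bar> / 2) > 0" using e(1) d(1) by simp
    then obtain n where n: "inverse (real (Suc n)) < min e (\<bar>d\<bar> / 2)" using reals_Archimedean by blast
    have "inverse (real (Suc n)) * \<bar>s - r\<bar> \<le> \<bar>G s - G r\<bar>" if "\<bar>s - r\<bar> < inverse (real (Suc n))" for s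
    proof (cases "s = r")
      case False
      then have "\<bar>(G s - G r) / (s - r) - d\<bar> < \<bar>d\<bar> / 2" using e(2) that n by auto
      then have "\<bar>(G s - G r) / (s - r)\<bar> > inverse (real (Suc n))" using n by linarith
      then show ?thesis using False by (simp add: abs_divide field_simps)
    qed simp
    then have "r \<in> A n" using r by (auto simp: A_def)
    then show "r \<in> (\<Union>n. \<Union>j\<in>UNIV. A n \<inter> J n j)" by (auto simp: J_def)
  qed
  moreover have "negligible (\<Union>n. \<Union>j\<in>UNIV. A n \<inter> J n j)"
    by (intro negligible_Union_nat negligible_countable_Union cell) (auto intro: cell negligible_countable_Union)
  ultimately show ?thesis by (rule negligible_subset[rotated])
qed

section \<open>Weak derivatives along lines\<close>

definition weak_deriv :: "'a::euclidean_space \<Rightarrow> ('a \<Rightarrow> real) \<Rightarrow> ('a \<Rightarrow> real) \<Rightarrow> bool" where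
  "weak_deriv b u h \<longleftrightarrow> loc_int u \<and> loc_int h \<and>
     (\<forall>\<phi>\<in>test_functions. (\<integral>x. u x * directional_deriv b \<phi> x \<partial>lborel) = - (\<integral>x. h x * \<phi> x \<partial>lborel))"

text \<open>The indicator of [0, t], written as a condition that is visibly measurable in
  \<open>t\<close> and \<open>s\<close> jointly. Exchanging "for almost every t" with "for almost
  every z" depends on this.\<close>

definition ray_weight :: "real \<Rightarrow> real \<Rightarrow> real" where
  "ray_weight t s = (if 0 \<le> s \<and> s \<le> t then 1 else 0)"

lemma ray_weight_measurable [measurable]:
  "(\<lambda>x. ray_weight (f x) (g x)) \<in> borel_measurable M"
  if [measurable]: "f \<in> borel_measurable M" "g \<in> borel_measurable M"
  unfolding ray_weight_def by measurable

lemma interval_displacement: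
  fixes v :: "'a::euclidean_space"
  shows "displacement lborel (indicator {a..b}) (\<lambda>s. s *\<^sub>R v) (max \<bar>a\<bar> \<bar>b\<bar> * norm v)"
proof (intro displacement.intro displacement_axioms.intro lborel.sigma_finite_measure_axioms)
  show "integrable lborel (indicator {a..b} :: real \<Rightarrow> real)"
    by (rule integrable_real_indicator) (auto simp: emeasure_lborel_Icc_eq)
  show "(\<lambda>s. s *\<^sub>R v) \<in> borel_measurable lborel" by simp
  fix s :: real assume "indicator {a..b} s \<noteq> (0::real)"
  then have "\<bar>s\<bar> \<le> max \<bar>a\<bar> \<bar>b\<bar>" by (auto simp: indicator_def split: if_splits)
  then show "norm (s *\<^sub>R v) \<le> max \<bar>a\<bar> \<bar>b\<bar> * norm v" by (simp add: mult_right_mono)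
qed

lemma ray_displacement:
  fixes b :: "'a::euclidean_space"
  shows "displacement lborel (ray_weight t) (\<lambda>s. s *\<^sub>R b) (max \<bar>0\<bar> \<bar>t\<bar> * norm b)"
proof -
  have "ray_weight t = indicator {0..t}" by (auto simp: fun_eq_iff ray_weight_def indicator_def)
  then show ?thesis by (simp only: interval_displacement)
qed

lemma loc_int_translate:
  fixes h :: "'a::euclidean_space \<Rightarrow> real"
  assumes "loc_int h"
  shows "loc_int (\<lambda>x. h (x + c))"
  unfolding loc_int_def
proof (intro conjI allI impI)
  note [measurable] = loc_int_borel[OF assms]
  show "(\<lambda>x. h (x + c)) \<in> borel_measurable borel" by measurable
  fix K :: "'a set" assume K: "compact K"
  define K' where "K' = (\<lambda>x. x + c) ` K"
  have K': "compact K'" unfolding K'_def by (intro compact_continuous_image K continuous_intros)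
  then have [measurable]: "K' \<in> sets borel" by (simp add: borel_compact)
  have "integrable lborel (\<lambda>x. indicator K' (x + c) * h (x + c))"
    by (subst lborel_translate(1)[of "\<lambda>x. indicator K' x * h x"]) (auto intro: loc_int_integrable[OF assms K'])
  moreover have "indicator K' (x + c) = (indicator K x :: real)" for x by (auto simp: K'_def indicator_def)
  ultimately show "integrable lborel (\<lambda>x. indicator K x * h (x + c))" by simp
qed

lemma loc_int_diff: "loc_int f \<Longrightarrow> loc_int g \<Longrightarrow> loc_int (\<lambda>x. f x - g x)"
  unfolding loc_int_def by (auto simp: right_diff_distrib intro: Bochner_Integration.integrable_diff)

lemma loc_int_add: "loc_int f \<Longrightarrow> loc_int g \<Longrightarrow> loc_int (\<lambda>x. f x + g x)"
  unfolding loc_int_def by (auto simp: distrib_left intro: Bochner_Integration.integrable_add)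

lemma superpose_ray_directional_deriv:
  assumes \<phi>: "\<phi> \<in> test_functions" and t: "t \<ge> 0"
  shows "superpose lborel (ray_weight t) (\<lambda>s. - (s *\<^sub>R b)) (directional_deriv b \<phi>) x = \<phi> x - \<phi> (x - t *\<^sub>R b)"
proof -
  let ?f = "\<lambda>s. directional_deriv b \<phi> (x + s *\<^sub>R (- b))"
  have der: "((\<lambda>s. - \<phi> (x + s *\<^sub>R (- b))) has_real_derivative ?f s) (at s)" for s
  proof -
    have "((\<lambda>s. - \<phi> (x + s *\<^sub>R (- b))) has_real_derivative - directional_deriv (- b) \<phi> (x + s *\<^sub>R (- b))) (at s)"
      by (intro derivative_intros smooth_line_deriv test_functionsD(1)[OF \<phi>])
    then show ?thesis
      using directional_deriv_scaleR[OF smooth_differentiable[OF test_functionsD(1)[OF \<phi>]], of "-1" b] by simp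
  qed
  have "continuous_on UNIV (\<lambda>s. \<Sum>i\<in>Basis. (b \<bullet> i) * directional_deriv i \<phi> (x + s *\<^sub>R (- b)))"
    by (intro continuous_intros continuous_on_compose2[OF smooth_continuous_on[of "directional_deriv _ \<phi>" UNIV]]
          smooth_directional_deriv test_functionsD(1)[OF \<phi>]) auto
  then have cont: "continuous_on UNIV ?f"
    by (subst ext[OF directional_deriv_Basis_sum[OF smooth_differentiable[OF test_functionsD(1)[OF \<phi>]]]])
  have "has_bochner_integral lborel (\<lambda>s. ?f s * indicator {0..t} s) (- \<phi> (x + t *\<^sub>R (- b)) - - \<phi> (x + 0 *\<^sub>R (- b)))"
    by (rule has_bochner_integral_FTC_Icc_real)
      (use t der cont in \<open>auto simp: continuous_on_eq_continuous_at\<close>)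
  then have "(\<integral>s. ?f s * indicator {0..t} s \<partial>lborel) = \<phi> x - \<phi> (x - t *\<^sub>R b)"
    by (simp add: has_bochner_integral_integral_eq)
  moreover have "superpose lborel (ray_weight t) (\<lambda>s. - (s *\<^sub>R b)) (directional_deriv b \<phi>) x = (\<integral>s. ?f s * indicator {0..t} s \<partial>lborel)"
    unfolding superpose_def
    by (intro Bochner_Integration.integral_cong) (auto simp: ray_weight_def indicator_def)
  ultimately show ?thesis by simp
qed

text \<open>The difference between a test function and its translate is the derivative of the
  average of that test function along the segment. Testing the weak derivative on this average and
  transposing gives the claim after integration against every test function;
  \<open>du_Bois_Reymond\<close> removes the test function.\<close>

lemma weak_deriv_increment:
  assumes wd: "weak_deriv b u h" and b: "b \<in> Basis" and t: "t \<ge> 0"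
  shows "AE x in lborel. u (x + t *\<^sub>R b) - u x = superpose lborel (ray_weight t) (\<lambda>s. s *\<^sub>R b) h x"
proof -
  interpret D: displacement lborel "ray_weight t" "\<lambda>s. s *\<^sub>R b" "max \<bar>0\<bar> \<bar>t\<bar> * norm b" by (rule ray_displacement)
  interpret D': displacement lborel "ray_weight t" "\<lambda>s. - (s *\<^sub>R b)" "max \<bar>0\<bar> \<bar>t\<bar> * norm b" by (rule D.uminus_displacement)
  have u: "loc_int u" and h: "loc_int h" using wd by (auto simp: weak_deriv_def)
  let ?H = "superpose lborel (ray_weight t) (\<lambda>s. s *\<^sub>R b) h"
  have H: "loc_int ?H" by (rule D.loc_int_superpose[OF h])
  have ut: "loc_int (\<lambda>x. u (x + t *\<^sub>R b))" by (rule loc_int_translate[OF u])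
  have "AE x in lborel. u (x + t *\<^sub>R b) - u x - ?H x = 0"
  proof (rule du_Bois_Reymond)
    show "loc_int (\<lambda>x. u (x + t *\<^sub>R b) - u x - ?H x)" by (intro loc_int_diff ut u H)
    fix \<phi> :: "'a \<Rightarrow> real" assume \<phi>: "\<phi> \<in> test_functions"
    have [measurable]: "u \<in> borel_measurable borel" "\<phi> \<in> borel_measurable borel"
      by (auto intro: loc_int_borel u test_functions_borel \<phi>)
    define \<psi> where "\<psi> = superpose lborel (ray_weight t) (\<lambda>s. - (s *\<^sub>R b)) \<phi>"
    have \<psi>: "\<psi> \<in> test_functions" unfolding \<psi>_def by (rule D'.superpose_test[OF \<phi>])
    have d\<psi>: "directional_deriv b \<psi> x = \<phi> x - \<phi> (x - t *\<^sub>R b)" for x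
      unfolding \<psi>_def D'.directional_deriv_superpose[OF \<phi>] by (rule superpose_ray_directional_deriv[OF \<phi> t])
    have shift: "(\<integral>x. u (x + t *\<^sub>R b) * \<phi> x \<partial>lborel) = (\<integral>x. u x * \<phi> (x - t *\<^sub>R b) \<partial>lborel)"
      using lborel_translate(2)[of "\<lambda>x. u x * \<phi> (x - t *\<^sub>R b)" "t *\<^sub>R b"] by simp
    have int_shift: "integrable lborel (\<lambda>x. u x * \<phi> (x - t *\<^sub>R b))"
      using loc_int_integrable_test[OF ut \<phi>] lborel_translate(1)[of "\<lambda>x. u x * \<phi> (x - t *\<^sub>R b)" "t *\<^sub>R b"] by simp
    have "(\<integral>x. (u (x + t *\<^sub>R b) - u x - ?H x) * \<phi> x \<partial>lborel)
      = (\<integral>x. u (x + t *\<^sub>R b) * \<phi> x \<partial>lborel) - (\<integral>x. u x * \<phi> x \<partial>lborel) - (\<integral>x. ?H x * \<phi> x \<partial>lborel)"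
      by (simp add: left_diff_distrib loc_int_integrable_test[OF ut \<phi>] loc_int_integrable_test[OF u \<phi>] loc_int_integrable_test[OF H \<phi>])
    also have "(\<integral>x. ?H x * \<phi> x \<partial>lborel) = (\<integral>x. h x * \<psi> x \<partial>lborel)"
      unfolding \<psi>_def by (rule D.integral_superpose[OF h \<phi>])
    also have "\<dots> = - (\<integral>x. u x * directional_deriv b \<psi> x \<partial>lborel)"
      using wd \<psi> by (simp add: weak_deriv_def)
    also have "\<dots> = - (\<integral>x. u x * \<phi> x - u x * \<phi> (x - t *\<^sub>R b) \<partial>lborel)"
      by (simp add: d\<psi> right_diff_distrib)
    also have "\<dots> = - ((\<integral>x. u x * \<phi> x \<partial>lborel) - (\<integral>x. u x * \<phi> (x - t *\<^sub>R b) \<partial>lborel))"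
      by (subst Bochner_Integration.integral_diff[OF loc_int_integrable_test[OF u \<phi>] int_shift]) simp
    finally show "(\<integral>x. (u (x + t *\<^sub>R b) - u x - ?H x) * \<phi> x \<partial>lborel) = 0"
      using shift by simp
  qed
  then show ?thesis by eventually_elim simp
qed

section \<open>Passing between the space and lines\<close>

lemma AE_lborel_translate:
  fixes c :: "'a::euclidean_space"
  assumes "AE z in lborel. P z"
  shows "AE z in lborel. P (z + c)"
proof -
  have *: "distr lborel borel (\<lambda>x. x + c) = (lborel :: 'a measure)"
  proof -
    have "(\<lambda>x. x + c) = (+) c" by (auto simp: fun_eq_iff add.commute)
    then show ?thesis using lborel_distr_plus[of c] by simp
  qed
  have "AE z in distr lborel borel (\<lambda>x. x + c). P z" unfolding * by (rule assms)
  moreover have "(\<lambda>x::'a. x + c) \<in> measurable lborel borel" by measurable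
  ultimately show ?thesis by (rule AE_distrD[rotated])
qed

lemma AE_on_lines:
  fixes b :: "'a::euclidean_space"
  assumes "AE z in lborel. P z"
  shows "AE z in lborel. AE t in (lborel :: real measure). P (z + t *\<^sub>R b)"
proof -
  obtain N where N: "N \<in> null_sets lborel" "{z. \<not> P z} \<subseteq> N"
    using assms by (auto simp: eventually_ae_filter)
  then have [measurable]: "N \<in> sets borel" by auto
  have "AE t in (lborel::real measure). AE z in lborel. z + t *\<^sub>R b \<notin> N"
    using AE_lborel_translate[OF AE_not_in[OF N(1)]] by simp
  then have "AE z in lborel. AE t in (lborel::real measure). z + t *\<^sub>R b \<notin> N"
  proof (subst lborel_pair.AE_commute)
    show "{x \<in> space (lborel \<Otimes>\<^sub>M lborel). fst x + snd x *\<^sub>R b \<notin> N} \<in> sets (lborel \<Otimes>\<^sub>M lborel)"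
      by measurable
  qed
  then show ?thesis by eventually_elim (use N(2) in \<open>auto elim!: eventually_mono\<close>)
qed

text \<open>By Fubini's theorem there is one \<open>t > 0\<close> for which the property holds at
  \<open>z + t *\<^sub>R b\<close> for almost every \<open>z\<close>, and translation invariance
  removes the shift. Only positive \<open>t\<close> are asked for, because the primitives on a ray
  are taken from its starting point.\<close>

lemma AE_from_rays:
  fixes b :: "'a::euclidean_space"
  assumes [measurable]: "Measurable.pred borel P"
    and rays: "AE z in lborel. AE t in (lborel :: real measure). t > 0 \<longrightarrow> P (z + t *\<^sub>R b)"
  shows "AE z in lborel. P z"
proof -
  have "AE t in (lborel :: real measure). AE z in lborel. t > 0 \<longrightarrow> P (z + t *\<^sub>R b)"
    by (subst lborel_pair.AE_commute) (measurable, rule rays)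
  then have *: "AE t in (lborel :: real measure). t > 0 \<longrightarrow> (AE z in lborel. P (z + t *\<^sub>R b))"
    by eventually_elim auto
  have "\<exists>t::real. t > 0 \<and> (AE z in lborel. P (z + t *\<^sub>R b))"
  proof (rule ccontr)
    assume "\<not> ?thesis"
    with * have "AE t in (lborel :: real measure). t \<notin> {0<..<1::real}"
      by (auto elim!: eventually_mono)
    then have "{0<..<1::real} \<in> null_sets lborel" by (subst AE_iff_null_sets) auto
    then show False by (simp add: null_sets_def)
  qed
  then obtain t :: real where "AE z in lborel. P (z + t *\<^sub>R b)" by blast
  from AE_lborel_translate[OF this, of "- (t *\<^sub>R b)"] show ?thesis by simp
qed

lemma superpose_ray: "superpose lborel (ray_weight t) (\<lambda>s. s *\<^sub>R b) h z = ray_integral (\<lambda>s. h (z + s *\<^sub>R b)) t"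
  by (simp add: superpose_def ray_weight_def ray_integral_def)

lemma loc_int_on_lines:
  fixes b :: "'a::euclidean_space"
  assumes h: "loc_int h"
  shows "AE z in lborel. loc_int (\<lambda>s. h (z + s *\<^sub>R b))"
proof -
  note [measurable] = loc_int_borel[OF h]
  have "AE z in lborel. \<forall>n::nat. integrable lborel (\<lambda>s. indicator {- real n..real n} s * h (z + s *\<^sub>R b))"
    unfolding AE_all_countable
  proof
    fix n :: nat
    interpret displacement lborel "indicator {- real n..real n}" "\<lambda>s. s *\<^sub>R b" "max \<bar>- real n\<bar> \<bar>real n\<bar> * norm b"
      by (rule interval_displacement)
    show "AE z in lborel. integrable lborel (\<lambda>s. indicator {- real n..real n} s * h (z + s *\<^sub>R b))"
      by (rule loc_int_superpose[OF h])
  qed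
  then show ?thesis
  proof eventually_elim
    case (elim z)
    show ?case unfolding loc_int_def
    proof (intro conjI allI impI)
      fix K :: "real set" assume K: "compact K"
      then have [measurable]: "K \<in> sets borel" by (simp add: borel_compact)
      obtain B where "\<forall>x\<in>K. \<bar>x\<bar> \<le> B" using compact_imp_bounded[OF K] by (auto simp: bounded_iff)
      then obtain n :: nat where "\<forall>x\<in>K. \<bar>x\<bar> \<le> real n" using real_arch_simple[of B] order_trans by blast
      then have sub: "K \<subseteq> {- real n..real n}" by (auto simp: abs_le_iff)
      show "integrable lborel (\<lambda>x. indicator K x * h (z + x *\<^sub>R b))"
        by (rule Bochner_Integration.integrable_bound[OF elim[rule_format, of n]])
          (auto simp: indicator_def dest: subsetD[OF sub] intro!: AE_I2)
    qed measurable
  qed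
qed

text \<open>In \<open>weak_deriv_increment\<close> the exceptional set of points depends on
  \<open>t\<close>. Fubini's theorem turns this into one exceptional set of rays, at the price of
  losing a null set of \<open>t\<close> on each of the others.\<close>

lemma weak_deriv_on_rays:
  assumes wd: "weak_deriv b u h" and b: "b \<in> Basis"
  shows "AE z in lborel. AE t in lborel. t \<ge> 0 \<longrightarrow> u (z + t *\<^sub>R b) = u z + integral {0..t} (\<lambda>s. h (z + s *\<^sub>R b))"
proof -
  have u: "loc_int u" and h: "loc_int h" using wd by (auto simp: weak_deriv_def)
  note [measurable] = loc_int_borel[OF u] loc_int_borel[OF h]
  have *: "AE t in lborel. AE z in lborel. t \<ge> 0 \<longrightarrow> u (z + t *\<^sub>R b) = u z + superpose lborel (ray_weight t) (\<lambda>s. s *\<^sub>R b) h z"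
  proof (rule AE_I2)
    fix t :: real
    show "AE z in lborel. t \<ge> 0 \<longrightarrow> u (z + t *\<^sub>R b) = u z + superpose lborel (ray_weight t) (\<lambda>s. s *\<^sub>R b) h z"
    proof (cases "t \<ge> 0")
      case True
      from weak_deriv_increment[OF wd b this] show ?thesis by eventually_elim simp
    qed simp
  qed
  have "AE z in lborel. AE t in lborel. t \<ge> 0 \<longrightarrow> u (z + t *\<^sub>R b) = u z + superpose lborel (ray_weight t) (\<lambda>s. s *\<^sub>R b) h z"
    by (subst lborel_pair.AE_commute) (unfold superpose_def, measurable, use * in \<open>simp add: superpose_def\<close>)
  with loc_int_on_lines[OF h, of b] show ?thesis
    by eventually_elim (auto elim!: eventually_mono simp: superpose_ray ray_integral_eq)
qed

text \<open>Countability matters: an identity that holds almost everywhere holds, for almost every \<open>x\<close>, at all the points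
  \<open>x + t b\<close> with \<open>t\<close> in this set simultaneously.\<close>

definition harmonic_points :: "real set" where
  "harmonic_points = insert 0 (range (\<lambda>n. inverse (real (Suc n))))"

lemma harmonic_points_derivative_iff:
  "(F has_real_derivative d) (at 0 within harmonic_points) \<longleftrightarrow>
    (\<lambda>n. (F (inverse (real (Suc n))) - F 0) * real (Suc n)) \<longlonglongrightarrow> d"
proof
  assume "(F has_real_derivative d) (at 0 within harmonic_points)"
  then have lim: "((\<lambda>y. (F y - F 0) / (y - 0)) \<longlongrightarrow> d) (at 0 within harmonic_points)"
    by (simp add: has_field_derivative_iff)
  have "filterlim (\<lambda>n. inverse (real (Suc n))) (at 0 within harmonic_points) sequentially"
    unfolding filterlim_at
    using LIMSEQ_inverse_real_of_nat by (auto simp: harmonic_points_def)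
  from filterlim_compose[OF lim this] show "(\<lambda>n. (F (inverse (real (Suc n))) - F 0) * real (Suc n)) \<longlonglongrightarrow> d"
    by (simp add: divide_inverse)
next
  assume lim: "(\<lambda>n. (F (inverse (real (Suc n))) - F 0) * real (Suc n)) \<longlonglongrightarrow> d"
  show "(F has_real_derivative d) (at 0 within harmonic_points)"
    unfolding has_field_derivative_iff
  proof (rule tendstoI)
    fix e :: real assume "e > 0"
    from tendstoD[OF lim this] obtain N where N: "\<And>n. n \<ge> N \<Longrightarrow> dist ((F (inverse (real (Suc n))) - F 0) * real (Suc n)) d < e"
      by (auto simp: eventually_sequentially)
    show "\<forall>\<^sub>F x in at 0 within harmonic_points. dist ((F x - F 0) / (x - 0)) d < e"
      unfolding eventually_at
    proof (intro exI[of _ "inverse (real (Suc N))"] conjI ballI impI)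
      fix x assume "x \<in> harmonic_points" and x: "x \<noteq> 0 \<and> dist x 0 < inverse (real (Suc N))"
      then obtain n where n: "x = inverse (real (Suc n))" by (auto simp: harmonic_points_def)
      with x have "inverse (real (Suc n)) < inverse (real (Suc N))" by (simp add: dist_real_def)
      then have "N \<le> n" by (simp add: field_simps)
      from N[OF this] show "dist ((F x - F 0) / (x - 0)) d < e" by (simp add: n divide_inverse)
    qed simp
  qed
qed

lemma has_real_derivative_harmonic_points_unique:
  assumes "(F has_real_derivative d) (at 0 within harmonic_points)" "(F has_real_derivative d') (at 0 within harmonic_points)"
  shows "d = d'"
  using assms unfolding harmonic_points_derivative_iff by (rule LIMSEQ_unique)

text \<open>For the countably many steps 1/(n+1) the increments are segment integrals of
  \<open>h\<close> at almost every point simultaneously. What remains is that the averages of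
  \<open>h\<close> over shrinking segments tend to \<open>h x\<close>. On a ray this is the
  differentiation of a one-dimensional primitive, and \<open>AE_from_rays\<close> carries it to the
  space.\<close>

lemma weak_deriv_has_derivative_harmonic:
  assumes wd: "weak_deriv b u h" and b: "b \<in> Basis"
  shows "AE x in lborel. ((\<lambda>t. u (x + t *\<^sub>R b)) has_real_derivative h x) (at 0 within harmonic_points)"
proof -
  have u: "loc_int u" and h: "loc_int h" using wd by (auto simp: weak_deriv_def)
  note [measurable] = loc_int_borel[OF u] loc_int_borel[OF h]
  let ?P = "\<lambda>x. (\<lambda>n. superpose lborel (ray_weight (inverse (real (Suc n)))) (\<lambda>s. s *\<^sub>R b) h x * real (Suc n)) \<longlonglongrightarrow> h x"
  have inc: "AE x in lborel. \<forall>n. u (x + inverse (real (Suc n)) *\<^sub>R b) - u x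
      = superpose lborel (ray_weight (inverse (real (Suc n)))) (\<lambda>s. s *\<^sub>R b) h x"
    unfolding AE_all_countable by (intro allI weak_deriv_increment[OF wd b]) simp
  have "AE x in lborel. ?P x"
  proof (rule AE_from_rays)
    show "Measurable.pred borel ?P" unfolding superpose_def by measurable
    show "AE z in lborel. AE t in lborel. t > 0 \<longrightarrow> ?P (z + t *\<^sub>R b)"
      using loc_int_on_lines[OF h, of b]
    proof eventually_elim
      case (elim z)
      from loc_int_primitive_differentiable[OF elim, of 0] show ?case
      proof eventually_elim
        case (elim t)
        show ?case
        proof
          assume "t > 0"
          define G where "G = (\<lambda>y. integral {0..y} (\<lambda>s. h (z + s *\<^sub>R b)))"
          have G: "(G has_real_derivative h (z + t *\<^sub>R b)) (at t)" using elim \<open>t > 0\<close> by (simp add: G_def)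
          \<comment> \<open>The segment starting at \<open>z + t *\<^sub>R b\<close> is part of the
            ray from \<open>z\<close>, so its integral is an increment of the primitive
            \<open>G\<close>.\<close>
          have eq: "superpose lborel (ray_weight e) (\<lambda>s. s *\<^sub>R b) h (z + t *\<^sub>R b) = G (t + e) - G t" if "e > 0" for e
          proof -
            have "superpose lborel (ray_weight e) (\<lambda>s. s *\<^sub>R b) h (z + t *\<^sub>R b)
              = (\<integral>s. ray_weight e s * h (z + (s + t) *\<^sub>R b) \<partial>lborel)"
              by (simp add: superpose_def algebra_simps)
            also have "\<dots> = (\<integral>s. ray_weight e (s - t) * h (z + s *\<^sub>R b) \<partial>lborel)"
              using lborel_translate(2)[of "\<lambda>s. ray_weight e (s - t) * h (z + s *\<^sub>R b)" t] by simp
            also have "\<dots> = (\<integral>s. indicator {t..t+e} s * h (z + s *\<^sub>R b) \<partial>lborel)"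
              by (intro Bochner_Integration.integral_cong) (auto simp: ray_weight_def indicator_def)
            also have "\<dots> = integral {t..t+e} (\<lambda>s. h (z + s *\<^sub>R b))"
              by (rule loc_int_real_integrable_on(2)[OF \<open>loc_int (\<lambda>s. h (z + s *\<^sub>R b))\<close>])
            also have "\<dots> = G (t + e) - G t"
              using Henstock_Kurzweil_Integration.integral_combine[of 0 t "t + e" "\<lambda>s. h (z + s *\<^sub>R b)"]
                loc_int_real_integrable_on(1)[OF \<open>loc_int (\<lambda>s. h (z + s *\<^sub>R b))\<close>] \<open>t > 0\<close> that
              by (simp add: G_def)
            finally show ?thesis .
          qed
          have "((\<lambda>y. G (t + y)) has_real_derivative h (z + t *\<^sub>R b)) (at 0)"
            using DERIV_shift[of G "h (z + t *\<^sub>R b)" 0 t] G by (simp add: add.commute)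
          then have "((\<lambda>y. G (t + y)) has_real_derivative h (z + t *\<^sub>R b)) (at 0 within harmonic_points)"
            by (rule has_field_derivative_at_within)
          then show "?P (z + t *\<^sub>R b)"
            unfolding harmonic_points_derivative_iff by (simp add: eq)
        qed
      qed
    qed
  qed
  with inc show ?thesis
    by eventually_elim (simp add: harmonic_points_derivative_iff)
qed

text \<open>On almost every ray \<open>g\<close> agrees almost everywhere with a primitive
  \<open>G\<close> whose derivative is \<open>h\<close> almost everywhere. A point where
  \<open>G\<close> lies in \<open>N\<close> and \<open>h\<close> is nonzero would be one of those
  that \<open>negligible_critical_preimage\<close> shows to be negligible. This is what makes the
  top-order term independent of the representative of the outer derivative.\<close>

lemma weak_deriv_zero_on_null_preimage:
  assumes wd: "weak_deriv b g h" and b: "b \<in> Basis" and N: "N \<in> null_sets lborel"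
  shows "AE x in lborel. g x \<in> N \<longrightarrow> h x = 0"
proof -
  have u: "loc_int g" and h: "loc_int h" using wd by (auto simp: weak_deriv_def)
  note [measurable] = loc_int_borel[OF u] loc_int_borel[OF h]
  have [measurable]: "N \<in> sets borel" using N by auto
  show ?thesis
  proof (rule AE_from_rays)
    show "Measurable.pred borel (\<lambda>x. g x \<in> N \<longrightarrow> h x = 0)" by measurable
    show "AE z in lborel. AE t in lborel. t > 0 \<longrightarrow> g (z + t *\<^sub>R b) \<in> N \<longrightarrow> h (z + t *\<^sub>R b) = 0"
      using loc_int_on_lines[OF h, of b] weak_deriv_on_rays[OF wd b]
    proof eventually_elim
      case (elim z)
      define G where "G = (\<lambda>y. g z + integral {0..y} (\<lambda>s. h (z + s *\<^sub>R b)))"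
      define S where "S = {t. G t \<in> N \<and> (\<exists>d. d \<noteq> 0 \<and> (G has_real_derivative d) (at t))}"
      have "negligible N"
        using N by (simp add: negligible_iff_null_sets null_sets_completionI)
      then have "negligible S" by (rule negligible_critical_preimage) (auto simp: S_def)
      then have "AE t in lebesgue. t \<notin> S" by (simp add: negligible_iff_null_sets AE_not_in)
      then have "AE t in lborel. t \<notin> S" by (simp add: AE_completion_iff)
      with loc_int_primitive_differentiable[OF elim(1), of 0] elim(2)
      show ?case
      proof eventually_elim
        case (elim t)
        show ?case
        proof (intro impI, rule ccontr)
          assume *: "t > 0" "g (z + t *\<^sub>R b) \<in> N" "h (z + t *\<^sub>R b) \<noteq> 0"
          have "(G has_real_derivative h (z + t *\<^sub>R b)) (at t)"
            unfolding G_def using elim(1) * by (auto intro!: derivative_eq_intros)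
          moreover have "G t \<in> N" using elim(2) * by (simp add: G_def)
          ultimately show False using elim(3) * by (auto simp: S_def)
        qed
      qed
    qed
  qed
qed

section \<open>Lower-order derivatives from the gradient\<close>

lemma integrable_bounded_compact_support:
  fixes w :: "'a::euclidean_space \<Rightarrow> real"
  assumes [measurable]: "w \<in> borel_measurable borel" and "compact K" "\<And>x. \<bar>w x\<bar> \<le> B * indicator K x"
  shows "integrable lborel w"
proof (rule Bochner_Integration.integrable_bound)
  have [measurable]: "K \<in> sets borel" using \<open>compact K\<close> by (simp add: borel_compact)
  show "integrable lborel (\<lambda>x. B * indicator K x)"
    using emeasure_bounded_finite[OF compact_imp_bounded[OF \<open>compact K\<close>]]
    by (intro integrable_mult_right integrable_real_indicator) auto
  have "\<bar>w x\<bar> \<le> \<bar>B * indicator K x\<bar>" for x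
    using assms(3)[of x] by linarith
  then show "AE x in lborel. norm (w x) \<le> norm (B * indicator K x)" by simp
qed simp

lemma loc_intI_bounded:
  fixes w :: "'a::euclidean_space \<Rightarrow> real"
  assumes [measurable]: "w \<in> borel_measurable borel" and "\<And>x. \<bar>w x\<bar> \<le> B"
  shows "loc_int w"
  unfolding loc_int_def
proof (intro conjI allI impI)
  fix K :: "'a set" assume K: "compact K"
  then have [measurable]: "K \<in> sets borel" by (simp add: borel_compact)
  show "integrable lborel (\<lambda>x. indicator K x * w x)"
    by (rule integrable_bounded_compact_support[OF _ K, of _ B])
      (use assms(2) in \<open>auto simp: indicator_def\<close>)
qed simp

lemma test_functions_integrable:
  assumes "\<phi> \<in> test_functions"
  shows "integrable lborel \<phi>"
  by (rule test_functions_dominated[OF assms])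
    (rule integrable_bounded_compact_support[OF test_functions_borel[OF assms]])

lemma test_functions_loc_int: "\<phi> \<in> test_functions \<Longrightarrow> loc_int \<phi>"
  by (rule test_functions_bounded, assumption, rule loc_intI_bounded[OF test_functions_borel])

lemma lborel_reflect:
  fixes f :: "'a::euclidean_space \<Rightarrow> real"
  assumes [measurable]: "f \<in> borel_measurable borel"
  shows "(\<integral>y. f (x - y) \<partial>lborel) = (\<integral>y. f y \<partial>lborel)"
proof -
  have "(lborel :: 'a measure) = distr lborel borel (\<lambda>y. x - y)"
    using lborel_affine[of "-1" x] by (simp add: density_1)
  then have "(\<integral>y. f y \<partial>lborel) = (\<integral>y. f y \<partial>distr lborel borel (\<lambda>y. x - y))" by simp
  also have "\<dots> = (\<integral>y. f (x - y) \<partial>lborel)" by (rule integral_distr) auto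
  finally show ?thesis ..
qed

lemma convolution_displacement:
  assumes "w \<in> test_functions"
  obtains C where "displacement lborel w (\<lambda>y::'a::euclidean_space. y) C"
proof -
  obtain K where K: "compact K" "\<And>x. x \<notin> K \<Longrightarrow> w x = 0"
    by (rule test_functions_obtain_support[OF assms]) blast
  obtain C where C: "\<And>x. x \<in> K \<Longrightarrow> norm x \<le> C"
    using compact_imp_bounded[OF K(1)] by (auto simp: bounded_iff)
  have "displacement lborel w (\<lambda>y. y) C"
    by (intro displacement.intro displacement_axioms.intro lborel.sigma_finite_measure_axioms)
      (use assms C K(2) in \<open>auto intro: test_functions_integrable\<close>)
  then show thesis by (rule that)
qed

text \<open>Convolution is commutative, so the derivatives can be moved to the mollifier. In
  \<open>loc_int_of_gradient\<close> this frees the test function from derivatives.\<close>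

lemma iter_deriv_convolution_swap:
  assumes "\<rho> \<in> test_functions" "\<phi> \<in> test_functions" "set bs \<subseteq> Basis"
  shows "iter_deriv bs (superpose lborel \<rho> (\<lambda>y. - y) \<phi>) = superpose lborel (iter_deriv bs \<rho>) (\<lambda>y. - y) \<phi>"
proof -
  have swap: "superpose lborel \<alpha> (\<lambda>y. - y) \<beta> = superpose lborel \<beta> (\<lambda>y. - y) \<alpha>"
    if [THEN test_functions_borel, measurable]: "\<alpha> \<in> test_functions" "\<beta> \<in> test_functions" for \<alpha> \<beta> :: "'a \<Rightarrow> real"
  proof
    fix x
    show "superpose lborel \<alpha> (\<lambda>y. - y) \<beta> x = superpose lborel \<beta> (\<lambda>y. - y) \<alpha> x"
      using lborel_reflect[of "\<lambda>y. \<alpha> y * \<beta> (x - y)" x] by (simp add: superpose_def mult.commute)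
  qed
  obtain C where "displacement lborel \<phi> (\<lambda>y. y) C" by (rule convolution_displacement[OF assms(2)])
  then interpret displacement lborel \<phi> "\<lambda>y. - y" C by (rule displacement.uminus_displacement)
  have "iter_deriv bs (superpose lborel \<rho> (\<lambda>y. - y) \<phi>) = iter_deriv bs (superpose lborel \<phi> (\<lambda>y. - y) \<rho>)"
    by (simp add: swap assms)
  also have "\<dots> = superpose lborel \<phi> (\<lambda>y. - y) (iter_deriv bs \<rho>)"
    by (rule iter_deriv_superpose[OF assms(1,3)])
  also have "\<dots> = superpose lborel (iter_deriv bs \<rho>) (\<lambda>y. - y) \<phi>"
    by (intro swap test_functions_iter_deriv assms)
  finally show ?thesis .
qed

lemma iter_deriv_add:
  assumes "smooth f" "smooth g" "set bs \<subseteq> Basis"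
  shows "iter_deriv bs (\<lambda>x. f x + g x) = (\<lambda>x. iter_deriv bs f x + iter_deriv bs g x)"
  using assms(3) by (induction bs)
    (auto simp: iter_deriv_Cons directional_deriv_add smooth_differentiable smooth_iter_deriv assms)

lemma iter_deriv_scale:
  assumes "smooth f" "set bs \<subseteq> Basis"
  shows "iter_deriv bs (\<lambda>x. c * f x) = (\<lambda>x. c * iter_deriv bs f x)"
  using assms(2) by (induction bs)
    (auto simp: iter_deriv_Cons directional_deriv_scale smooth_differentiable smooth_iter_deriv assms)

lemma test_functions_sum:
  assumes "finite I" "\<And>i. i \<in> I \<Longrightarrow> \<psi> i \<in> test_functions"
  shows "(\<lambda>x. \<Sum>i\<in>I. \<psi> i x) \<in> test_functions"
  using assms
proof (induction I)
  case empty
  then show ?case by (auto intro!: test_functionsI[of _ "{}"] smooth_const)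
qed (auto intro: test_functions_add)

lemma iter_deriv_sum:
  fixes \<psi> :: "'i \<Rightarrow> 'a::euclidean_space \<Rightarrow> real"
  assumes "finite I" "\<And>i. i \<in> I \<Longrightarrow> \<psi> i \<in> test_functions" "set bs \<subseteq> Basis"
  shows "iter_deriv bs (\<lambda>x. \<Sum>i\<in>I. \<psi> i x) = (\<lambda>x. \<Sum>i\<in>I. iter_deriv bs (\<psi> i) x)"
  using assms(1,2)
proof (induction I)
  case empty
  have "iter_deriv bs (\<lambda>x. 0 * 0) = (\<lambda>x. 0 * iter_deriv bs (\<lambda>x::'a. 0) x)"
    by (rule iter_deriv_scale[OF smooth_const assms(3)])
  then show ?case by simp
next
  case (insert i I)
  then show ?case
    using iter_deriv_add[of "\<psi> i" "\<lambda>x. \<Sum>i\<in>I. \<psi> i x" bs] test_functions_sum[of I \<psi>] assms(3)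
    by (simp add: test_functionsD(1))
qed

text \<open>The distribution \<open>\<phi> \<mapsto> (-1)\<^sup>n \<integral> g \<partial>\<^bsub>bs\<^esub> \<phi>\<close> is recovered from its gradient: subtracting from a test function
  its mollification leaves a divergence,
  \<open>\<phi> x - (\<phi> * \<rho>) x = \<Sum>\<^sub>i \<partial>\<^sub>i \<integral>\<integral> \<rho> y y\<^sub>i \<phi> (x - s y) ds dy\<close>.\<close>

lemma mollifier_divergence:
  fixes \<phi> :: "'a::euclidean_space \<Rightarrow> real"
  assumes \<rho>: "\<rho> \<in> test_functions" "(\<integral>y. \<rho> y \<partial>lborel) = 1" and \<phi>: "\<phi> \<in> test_functions"
  defines "w \<equiv> \<lambda>i (y, s). \<rho> y * (y \<bullet> i) * indicator {0..1::real} s"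
  shows "\<exists>C. \<forall>i\<in>Basis. displacement lborel (w i) (\<lambda>(y, s). s *\<^sub>R y) C"
    and "\<phi> x = superpose lborel \<rho> (\<lambda>y. - y) \<phi> x
       + (\<Sum>i\<in>Basis. superpose lborel (w i) (\<lambda>(y, s). - (s *\<^sub>R y)) (directional_deriv i \<phi>) x)"
proof -
  note [measurable] = test_functions_borel[OF \<rho>(1)] test_functions_borel[OF \<phi>]
  have wm [measurable]: "w i \<in> borel_measurable borel" for i
  proof -
    have "w i \<in> borel_measurable (borel \<Otimes>\<^sub>M borel)" unfolding w_def by measurable
    then show ?thesis by (simp add: borel_prod)
  qed
  have Ym [measurable]: "(\<lambda>(y::'a, s::real). s *\<^sub>R y) \<in> borel_measurable borel"
  proof -
    have "(\<lambda>(y::'a, s::real). s *\<^sub>R y) \<in> borel_measurable (borel \<Otimes>\<^sub>M borel)" by measurable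
    then show ?thesis unfolding borel_prod .
  qed
  obtain K where K: "compact K" "\<And>x. x \<notin> K \<Longrightarrow> \<rho> x = 0"
    by (rule test_functions_obtain_support[OF \<rho>(1)]) blast
  obtain B where B: "B \<ge> 0" "\<And>x. \<bar>\<rho> x\<bar> \<le> B" by (rule test_functions_bounded[OF \<rho>(1)]) blast
  obtain C where C: "\<And>x. x \<in> K \<Longrightarrow> norm x \<le> C" "C > 0"
    using compact_imp_bounded[OF K(1)] by (auto simp: bounded_pos)
  have disp: "displacement lborel (w i) (\<lambda>(y, s). s *\<^sub>R y) C" if i: "i \<in> Basis" for i
  proof (intro displacement.intro displacement_axioms.intro lborel.sigma_finite_measure_axioms)
    show "integrable lborel (w i)"
    proof (rule integrable_bounded_compact_support[OF wm])
      show "compact (K \<times> {0..1::real})" by (intro compact_Times K) simp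
      fix x :: "'a \<times> real"
      obtain y s where x: "x = (y, s)" by (cases x)
      have "\<bar>\<rho> y * (y \<bullet> i)\<bar> \<le> B * C" if "y \<in> K"
        unfolding abs_mult
        by (intro mult_mono B order_trans[OF Basis_le_norm[OF i] C(1)] that) (use B in auto)
      then show "\<bar>w i x\<bar> \<le> (B * C) * indicator (K \<times> {0..1}) x"
        using K(2)[of y] by (auto simp: x w_def indicator_def)
    qed
    show "(\<lambda>(y, s). s *\<^sub>R y) \<in> borel_measurable (lborel :: ('a \<times> real) measure)"
      using Ym by simp
    fix \<omega> :: "'a \<times> real" assume "w i \<omega> \<noteq> 0"
    moreover obtain y s where \<omega>: "\<omega> = (y, s)" by (cases \<omega>)
    ultimately have ys: "\<rho> y \<noteq> 0" "s \<in> {0..1}" by (auto simp: w_def indicator_def split: if_splits)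
    then have "y \<in> K" using K(2) by blast
    then have "norm (s *\<^sub>R y) \<le> 1 * C" unfolding norm_scaleR using ys C by (intro mult_mono) auto
    then show "norm (case \<omega> of (y, s) \<Rightarrow> s *\<^sub>R y) \<le> C" by (simp add: \<omega>)
  qed
  then show "\<exists>C. \<forall>i\<in>Basis. displacement lborel (w i) (\<lambda>(y, s). s *\<^sub>R y) C" by blast
  obtain C' where "displacement lborel \<rho> (\<lambda>y. y) C'" by (rule convolution_displacement[OF \<rho>(1)])
  then interpret R: displacement lborel \<rho> "\<lambda>y. - y" C' by (rule displacement.uminus_displacement)
  have sm: "smooth \<phi>" by (rule test_functionsD(1)[OF \<phi>])
  have int_w: "integrable (lborel \<Otimes>\<^sub>M lborel) (\<lambda>(y, s). w i (y, s) * directional_deriv i \<phi> (x - s *\<^sub>R y))" if "i \<in> Basis" for i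
    using displacement.integrable_test[OF displacement.uminus_displacement[OF disp[OF that]] test_functions_directional_deriv[OF \<phi> that], of x]
    by (simp add: lborel_prod case_prod_beta')
  \<comment> \<open>For fixed \<open>y\<close> this is the fundamental theorem of calculus along the
    segment from \<open>x\<close> to \<open>x - y\<close>. Expanding the derivative along
    \<open>y\<close> in coordinates produces the factor \<open>y \<bullet> i\<close> in
    \<open>w\<close>.\<close>
  have inner: "(\<integral>s. (\<Sum>i\<in>Basis. w i (y, s) * directional_deriv i \<phi> (x - s *\<^sub>R y)) \<partial>lborel) = \<rho> y * (\<phi> x - \<phi> (x - y))" for y
  proof -
    let ?f = "\<lambda>s. directional_deriv y \<phi> (x + s *\<^sub>R (- y))"
    have der: "((\<lambda>s. - \<phi> (x + s *\<^sub>R (- y))) has_real_derivative ?f s) (at s)" for s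
    proof -
      have "((\<lambda>s. - \<phi> (x + s *\<^sub>R (- y))) has_real_derivative - directional_deriv (- y) \<phi> (x + s *\<^sub>R (- y))) (at s)"
        by (intro derivative_intros smooth_line_deriv sm)
      then show ?thesis
        using directional_deriv_scaleR[OF smooth_differentiable[OF sm], of "-1" y] by simp
    qed
    have "continuous_on UNIV (\<lambda>s. \<Sum>i\<in>Basis. (y \<bullet> i) * directional_deriv i \<phi> (x + s *\<^sub>R (- y)))"
      by (intro continuous_intros continuous_on_compose2[OF smooth_continuous_on[of "directional_deriv _ \<phi>" UNIV]]
            smooth_directional_deriv sm) auto
    then have cont: "continuous_on UNIV ?f"
      by (subst ext[OF directional_deriv_Basis_sum[OF smooth_differentiable[OF sm]]])
    have "has_bochner_integral lborel (\<lambda>s. ?f s * indicator {0..1} s) (- \<phi> (x + 1 *\<^sub>R (- y)) - - \<phi> (x + 0 *\<^sub>R (- y)))"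
      by (rule has_bochner_integral_FTC_Icc_real) (use der cont in \<open>auto simp: continuous_on_eq_continuous_at\<close>)
    then have 1: "(\<integral>s. ?f s * indicator {0..1} s \<partial>lborel) = \<phi> x - \<phi> (x - y)"
      by (simp add: has_bochner_integral_integral_eq)
    have "(\<Sum>i\<in>Basis. w i (y, s) * directional_deriv i \<phi> (x - s *\<^sub>R y)) = \<rho> y * (?f s * indicator {0..1} s)" for s
      by (subst directional_deriv_Basis_sum[OF smooth_differentiable[OF sm], of y])
        (simp add: w_def sum_distrib_left sum_distrib_right mult_ac)
    then show ?thesis using 1 by simp
  qed
  have "(\<Sum>i\<in>Basis. superpose lborel (w i) (\<lambda>(y, s). - (s *\<^sub>R y)) (directional_deriv i \<phi>) x)
    = (\<Sum>i\<in>Basis. \<integral>z. (case z of (y, s) \<Rightarrow> w i (y, s) * directional_deriv i \<phi> (x - s *\<^sub>R y)) \<partial>(lborel \<Otimes>\<^sub>M lborel))"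
    unfolding superpose_def by (simp add: lborel_prod case_prod_beta')
  also have "\<dots> = (\<integral>z. (\<Sum>i\<in>Basis. case z of (y, s) \<Rightarrow> w i (y, s) * directional_deriv i \<phi> (x - s *\<^sub>R y)) \<partial>(lborel \<Otimes>\<^sub>M lborel))"
    by (rule Bochner_Integration.integral_sum[symmetric]) (rule int_w)
  also have "\<dots> = (\<integral>y. (\<integral>s. (\<Sum>i\<in>Basis. w i (y, s) * directional_deriv i \<phi> (x - s *\<^sub>R y)) \<partial>lborel) \<partial>lborel)"
    by (subst lborel_pair.integral_fst'[symmetric]) (use int_w in \<open>auto intro!: Bochner_Integration.integrable_sum\<close>)
  also have "\<dots> = (\<integral>y. \<rho> y * (\<phi> x - \<phi> (x - y)) \<partial>lborel)" by (simp only: inner)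
  also have "\<dots> = (\<integral>y. \<rho> y * \<phi> x \<partial>lborel) - (\<integral>y. \<rho> y * \<phi> (x - y) \<partial>lborel)"
    using R.integrable_test[OF \<phi>, of x] test_functions_integrable[OF \<rho>(1)]
    by (simp add: right_diff_distrib)
  also have "\<dots> = \<phi> x - superpose lborel \<rho> (\<lambda>y. - y) \<phi> x" using \<rho>(2) by (simp add: superpose_def)
  finally show "\<phi> x = superpose lborel \<rho> (\<lambda>y. - y) \<phi> x
       + (\<Sum>i\<in>Basis. superpose lborel (w i) (\<lambda>(y, s). - (s *\<^sub>R y)) (directional_deriv i \<phi>) x)" by simp
qed

lemma unit_mollifier_exists:
  obtains \<rho> :: "'a::euclidean_space \<Rightarrow> real" where "\<rho> \<in> test_functions" "(\<integral>y. \<rho> y \<partial>lborel) = 1"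
proof -
  let ?b = "box_bump (- One) One 1 :: 'a \<Rightarrow> real"
  have b: "?b \<in> test_functions" by (rule box_bump_test) simp
  have "(\<integral>y. ?b y \<partial>lborel) \<noteq> 0"
  proof
    assume "(\<integral>y. ?b y \<partial>lborel) = 0"
    then have "AE y in lborel. ?b y = 0"
      by (subst (asm) integral_nonneg_eq_0_iff_AE[OF test_functions_integrable[OF b]]) (simp_all add: box_bump_bounds)
    then have "AE y in lborel. y \<notin> box (- One) (One::'a)"
    proof eventually_elim
      case (elim y)
      then show ?case using box_bump_pos_iff[of 1 "- One" "One :: 'a" y] by auto
    qed
    then have "box (- One) (One::'a) \<in> null_sets lborel" by (subst AE_iff_null_sets) auto
    then have "emeasure lborel (box (- One) (One::'a)) = 0" by (simp add: null_sets_def)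
    then have "(\<Prod>b\<in>(Basis :: 'a set). (One - (- One)) \<bullet> b) \<le> (0::real)"
      by (subst (asm) emeasure_lborel_box) (auto simp: prod_ennreal inner_diff_left ennreal_eq_0_iff)
    moreover have "0 < (\<Prod>b\<in>(Basis :: 'a set). (One - (- One)) \<bullet> b)"
      by (rule prod_pos) (simp add: inner_add_left)
    ultimately show False by simp
  qed
  then show thesis
    by (intro that[of "\<lambda>y. inverse (\<integral>y. ?b y \<partial>lborel) * ?b y"] test_functions_scale b) simp
qed

lemma loc_int_scale: "loc_int f \<Longrightarrow> loc_int (\<lambda>x. c * f x)"
  unfolding loc_int_def by (auto simp: mult.left_commute)

lemma loc_int_sum: "finite I \<Longrightarrow> (\<And>i. i \<in> I \<Longrightarrow> loc_int (f i)) \<Longrightarrow> loc_int (\<lambda>x. \<Sum>i\<in>I. f i x)"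
proof (induction I rule: finite_induct)
  case empty
  then show ?case by (simp add: loc_int_def)
qed (auto intro: loc_int_add)

text \<open>Split the test function by \<open>mollifier_divergence\<close>. In the mollified part
  all derivatives fall on \<open>\<rho>\<close>, and transposition gives an average of
  \<open>g\<close> (\<open>k0\<close>). In the divergence part each summand is itself a derivative
  \<open>directional_deriv i (\<psi> i)\<close>, so \<open>grad\<close> applies and transposition
  gives an average of \<open>h i\<close> (\<open>k1\<close>).\<close>

lemma loc_int_of_gradient:
  fixes g :: "'a::euclidean_space \<Rightarrow> real"
  assumes g: "loc_int g" and bs: "set bs \<subseteq> Basis" and h: "\<And>i. i \<in> Basis \<Longrightarrow> loc_int (h i)"
    and grad: "\<And>i \<phi>. i \<in> Basis \<Longrightarrow> \<phi> \<in> test_functions \<Longrightarrow>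
      (\<integral>x. g x * iter_deriv bs (directional_deriv i \<phi>) x \<partial>lborel) = (\<integral>x. h i x * \<phi> x \<partial>lborel)"
  obtains k where "loc_int k" "\<And>\<phi>. \<phi> \<in> test_functions \<Longrightarrow> (\<integral>x. g x * iter_deriv bs \<phi> x \<partial>lborel) = (\<integral>x. k x * \<phi> x \<partial>lborel)"
proof -
  obtain \<rho> :: "'a \<Rightarrow> real" where \<rho>: "\<rho> \<in> test_functions" "(\<integral>y. \<rho> y \<partial>lborel) = 1" by (rule unit_mollifier_exists)
  define w :: "'a \<Rightarrow> 'a \<times> real \<Rightarrow> real" where "w = (\<lambda>i (y, s). \<rho> y * (y \<bullet> i) * indicator {0..1} s)"
  obtain C where disp: "\<And>i. i \<in> Basis \<Longrightarrow> displacement lborel (w i) (\<lambda>(y, s). s *\<^sub>R y) C"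
    using mollifier_divergence(1)[OF \<rho> \<rho>(1)] unfolding w_def by blast
  have neg: "(\<lambda>\<omega>. - (case \<omega> of (y::'a, s::real) \<Rightarrow> s *\<^sub>R y)) = (\<lambda>(y, s). - (s *\<^sub>R y))" by auto
  have disp': "displacement lborel (w i) (\<lambda>(y, s). - (s *\<^sub>R y)) C" if "i \<in> Basis" for i
    using displacement.uminus_displacement[OF disp[OF that]] by (simp only: neg)
  let ?\<rho>' = "iter_deriv bs \<rho>"
  have \<rho>': "?\<rho>' \<in> test_functions" by (rule test_functions_iter_deriv[OF \<rho>(1) bs])
  obtain C' where D': "displacement lborel ?\<rho>' (\<lambda>y. y) C'" by (rule convolution_displacement[OF \<rho>'])
  define k0 where "k0 = superpose lborel ?\<rho>' (\<lambda>y. y) g"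
  define k1 where "k1 = (\<lambda>i. superpose lborel (w i) (\<lambda>(y, s). s *\<^sub>R y) (h i))"
  have k0: "loc_int k0" unfolding k0_def by (rule displacement.loc_int_superpose(1)[OF D' g])
  have k1: "loc_int (k1 i)" if "i \<in> Basis" for i unfolding k1_def
    by (rule displacement.loc_int_superpose(1)[OF disp[OF that] h[OF that]])
  show thesis
  proof (rule that)
    show "loc_int (\<lambda>x. k0 x + (\<Sum>i\<in>Basis. k1 i x))" by (intro loc_int_add loc_int_sum k0 k1) auto
    fix \<phi> :: "'a \<Rightarrow> real" assume \<phi>: "\<phi> \<in> test_functions"
    define \<psi> where "\<psi> = (\<lambda>i. superpose lborel (w i) (\<lambda>(y, s). - (s *\<^sub>R y)) \<phi>)"
    have \<psi>: "\<psi> i \<in> test_functions" if "i \<in> Basis" for i unfolding \<psi>_def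
      by (rule displacement.superpose_test[OF disp'[OF that] \<phi>])
    have d\<psi>: "directional_deriv i (\<psi> i) = superpose lborel (w i) (\<lambda>(y, s). - (s *\<^sub>R y)) (directional_deriv i \<phi>)" if "i \<in> Basis" for i
      unfolding \<psi>_def by (rule displacement.directional_deriv_superpose[OF disp'[OF that] \<phi>])
    define \<phi>\<rho> where "\<phi>\<rho> = superpose lborel \<rho> (\<lambda>y. - y) \<phi>"
    obtain C'' where "displacement lborel \<rho> (\<lambda>y. y) C''" by (rule convolution_displacement[OF \<rho>(1)])
    then have \<phi>\<rho>: "\<phi>\<rho> \<in> test_functions" unfolding \<phi>\<rho>_def
      by (intro displacement.superpose_test[OF displacement.uminus_displacement] \<phi>)
    have d\<psi>t: "directional_deriv i (\<psi> i) \<in> test_functions" if "i \<in> Basis" for i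
      by (intro test_functions_directional_deriv \<psi> that)
    have decomp: "\<phi> = (\<lambda>x. \<phi>\<rho> x + (\<Sum>i\<in>Basis. directional_deriv i (\<psi> i) x))"
      using mollifier_divergence(2)[OF \<rho> \<phi>] by (simp add: fun_eq_iff d\<psi> \<phi>\<rho>_def w_def)
    have "iter_deriv bs \<phi> = (\<lambda>x. iter_deriv bs \<phi>\<rho> x + (\<Sum>i\<in>Basis. iter_deriv bs (directional_deriv i (\<psi> i)) x))"
      by (subst decomp, subst iter_deriv_add)
        (auto intro!: test_functionsD(1) \<phi>\<rho> test_functions_sum d\<psi>t bs simp: iter_deriv_sum[OF _ d\<psi>t bs])
    then have "(\<integral>x. g x * iter_deriv bs \<phi> x \<partial>lborel)
      = (\<integral>x. g x * iter_deriv bs \<phi>\<rho> x + (\<Sum>i\<in>Basis. g x * iter_deriv bs (directional_deriv i (\<psi> i)) x) \<partial>lborel)"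
      by (simp add: distrib_left sum_distrib_left)
    also have "\<dots> = (\<integral>x. g x * iter_deriv bs \<phi>\<rho> x \<partial>lborel) + (\<Sum>i\<in>Basis. \<integral>x. g x * iter_deriv bs (directional_deriv i (\<psi> i)) x \<partial>lborel)"
      by (subst Bochner_Integration.integral_add)
        (auto intro!: loc_int_integrable_test[OF g] test_functions_iter_deriv \<phi>\<rho> d\<psi>t bs Bochner_Integration.integrable_sum
          Bochner_Integration.integral_sum)
    also have "(\<integral>x. g x * iter_deriv bs \<phi>\<rho> x \<partial>lborel) = (\<integral>x. k0 x * \<phi> x \<partial>lborel)"
      unfolding \<phi>\<rho>_def k0_def iter_deriv_convolution_swap[OF \<rho>(1) \<phi> bs]
      by (rule displacement.integral_superpose[OF D' g \<phi>, symmetric])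
    also have "(\<Sum>i\<in>Basis. \<integral>x. g x * iter_deriv bs (directional_deriv i (\<psi> i)) x \<partial>lborel) = (\<Sum>i\<in>Basis. \<integral>x. k1 i x * \<phi> x \<partial>lborel)"
    proof (rule sum.cong[OF refl])
      fix i :: 'a assume i: "i \<in> Basis"
      have "(\<integral>x. g x * iter_deriv bs (directional_deriv i (\<psi> i)) x \<partial>lborel) = (\<integral>x. h i x * \<psi> i x \<partial>lborel)"
        by (rule grad[OF i \<psi>[OF i]])
      also have "\<dots> = (\<integral>x. k1 i x * \<phi> x \<partial>lborel)"
        unfolding \<psi>_def k1_def using displacement.integral_superpose[OF disp[OF i] h[OF i] \<phi>] by (simp add: neg)
      finally show "(\<integral>x. g x * iter_deriv bs (directional_deriv i (\<psi> i)) x \<partial>lborel) = (\<integral>x. k1 i x * \<phi> x \<partial>lborel)" .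
    qed
    also have "(\<integral>x. k0 x * \<phi> x \<partial>lborel) + (\<Sum>i\<in>Basis. \<integral>x. k1 i x * \<phi> x \<partial>lborel) = (\<integral>x. (k0 x + (\<Sum>i\<in>Basis. k1 i x)) * \<phi> x \<partial>lborel)"
      by (simp add: distrib_right sum_distrib_right loc_int_integrable_test[OF k0 \<phi>] loc_int_integrable_test[OF k1 \<phi>])
    finally show "(\<integral>x. g x * iter_deriv bs \<phi> x \<partial>lborel) = (\<integral>x. (k0 x + (\<Sum>i\<in>Basis. k1 i x)) * \<phi> x \<partial>lborel)" .
  qed
qed

section \<open>Distributions represented by functions\<close>

lemma locally_integrable_borel_version:
  assumes "locally_integrable u"
  obtains u' where "loc_int u'" "AE x in lebesgue. u x = u' x"
proof -
  have int: "integrable lebesgue (\<lambda>x. indicator K x * u x)" if "compact K" for K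
    using assms that by (simp add: locally_integrable_def set_integrable_def)
  have "u \<in> borel_measurable lebesgue"
  proof (rule borel_measurable_LIMSEQ_real)
    show "(\<lambda>n. indicator (cball 0 (real n)) x * u x) \<longlonglongrightarrow> u x" for x
    proof (rule tendsto_eventually)
      obtain N :: nat where "norm x \<le> real N" using real_arch_simple by blast
      then show "\<forall>\<^sub>F n in sequentially. indicator (cball 0 (real n)) x * u x = u x"
        by (intro eventually_sequentiallyI[of N]) (auto simp: indicator_def)
    qed
    show "(\<lambda>x. indicator (cball 0 (real n)) x * u x) \<in> borel_measurable lebesgue" for n
      using int[of "cball 0 (real n)"] by auto
  qed
  then obtain u' where u': "u' \<in> borel_measurable lborel" "AE x in lborel. u x = u' x"
    using completion_ex_borel_measurable_real by blast
  have ae: "AE x in lebesgue. u x = u' x" by (rule AE_completion[OF u'(2)])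
  have "loc_int u'"
    unfolding loc_int_def
  proof (intro conjI allI impI)
    show u'm: "u' \<in> borel_measurable borel" using u'(1) by simp
    fix K :: "'a set" assume K: "compact K"
    then have [measurable]: "K \<in> sets borel" by (simp add: borel_compact)
    have m: "(\<lambda>x. indicator K x * u' x) \<in> borel_measurable lborel" using u'm by simp
    have "integrable lebesgue (\<lambda>x. indicator K x * u' x)"
    proof (rule integrable_cong_AE_imp[OF int[OF K]])
      show "(\<lambda>x. indicator K x * u' x) \<in> borel_measurable lebesgue"
        using measurable_completion[OF m] .
      show "AE x in lebesgue. indicator K x * u x = indicator K x * u' x" using ae by eventually_elim simp
    qed
    then show "integrable lborel (\<lambda>x. indicator K x * u' x)"
      using integrable_completion[OF m] by blast
  qed
  with ae show thesis by (rule that[rotated])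
qed

lemma borel_measurable_lebesgue_cong_AE:
  fixes u v :: "'a::euclidean_space \<Rightarrow> real"
  assumes "u \<in> borel_measurable lebesgue" "AE x in lebesgue. u x = v x"
  shows "v \<in> borel_measurable lebesgue"
proof (rule measurableI)
  fix A :: "real set" assume A: "A \<in> sets borel"
  have "AE x in lebesgue. x \<in> u -` A \<inter> space lebesgue \<longleftrightarrow> x \<in> v -` A \<inter> space lebesgue"
    using assms(2) by eventually_elim auto
  then show "v -` A \<inter> space lebesgue \<in> sets lebesgue"
    by (rule completion.in_sets_AE) (use measurable_sets[OF assms(1) A] in auto)
qed simp

lemma locally_integrableI:
  assumes "loc_int u'" "AE x in lebesgue. u x = u' x"
  shows "locally_integrable u"
  unfolding locally_integrable_def set_integrable_def
proof (intro allI impI)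
  fix K :: "'a set" assume K: "compact K"
  then have [measurable]: "K \<in> sets borel" by (simp add: borel_compact)
  note [measurable] = loc_int_borel[OF assms(1)]
  have m: "(\<lambda>x. indicator K x * u' x) \<in> borel_measurable lborel" by simp
  have i: "integrable lebesgue (\<lambda>x. indicator K x * u' x)"
    using integrable_completion[OF m] loc_int_integrable[OF assms(1) K] by blast
  have "AE x in lebesgue. u' x = u x" using assms(2) by eventually_elim simp
  moreover have "u' \<in> borel_measurable lebesgue"
    by (rule measurable_completion) simp
  ultimately have um: "u \<in> borel_measurable lebesgue"
    by (rule borel_measurable_lebesgue_cong_AE[rotated])
  show "integrable lebesgue (\<lambda>x. indicator K x *\<^sub>R u x)"
  proof (rule integrable_cong_AE_imp[OF i])
    show "(\<lambda>x. indicator K x *\<^sub>R u x) \<in> borel_measurable lebesgue"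
      unfolding real_scaleR_def
      by (intro borel_measurable_times borel_measurable_indicator um) (use K in \<open>simp add: borel_compact\<close>)
    show "AE x in lebesgue. indicator K x * u' x = indicator K x *\<^sub>R u x" using assms(2) by eventually_elim simp
  qed
qed

lemma dist_of_cong:
  assumes "loc_int u'" "AE x in lebesgue. u x = u' x"
  shows "dist_of u = dist_of u'"
  unfolding dist_of_def
proof (rule restrict_ext)
  fix \<phi> :: "'a \<Rightarrow> real" assume \<phi>: "\<phi> \<in> test_functions"
  have m: "(\<lambda>x. u' x * \<phi> x) \<in> borel_measurable lebesgue"
    using measurable_completion[of "\<lambda>x. u' x * \<phi> x" lborel borel] loc_int_borel[OF assms(1)] test_functions_borel[OF \<phi>] by simp
  show "(\<integral>x. u x * \<phi> x \<partial>lebesgue) = (\<integral>x. u' x * \<phi> x \<partial>lebesgue)"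
  proof (rule Bochner_Integration.integral_cong_AE[OF _ m])
    show "AE x in lebesgue. u x * \<phi> x = u' x * \<phi> x" using assms(2) by eventually_elim simp
    have "AE x in lebesgue. u' x * \<phi> x = u x * \<phi> x" using assms(2) by eventually_elim simp
    then show "(\<lambda>x. u x * \<phi> x) \<in> borel_measurable lebesgue"
      by (rule borel_measurable_lebesgue_cong_AE[OF m])
  qed
qed

lemma dist_of_apply:
  assumes "loc_int u" "\<phi> \<in> test_functions"
  shows "dist_of u \<phi> = (\<integral>x. u x * \<phi> x \<partial>lborel)"
  using assms loc_int_borel[OF assms(1)] test_functions_borel[OF assms(2)]
  by (simp add: dist_of_def integral_completion)

lemma represents_iff:
  "represents u T \<longleftrightarrow> (\<exists>u'. loc_int u' \<and> (AE x in lebesgue. u x = u' x) \<and> T = dist_of u')"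
  unfolding represents_def
  by (metis locally_integrable_borel_version locally_integrableI dist_of_cong)

lemma dist_of_eqD:
  assumes "loc_int u" "loc_int v" "dist_of u = dist_of v"
  shows "AE x in lebesgue. u x = v x"
proof -
  have "AE x in lborel. u x - v x = 0"
  proof (rule du_Bois_Reymond[OF loc_int_diff[OF assms(1,2)]])
    fix \<phi> :: "'a \<Rightarrow> real" assume \<phi>: "\<phi> \<in> test_functions"
    have "(\<integral>x. u x * \<phi> x \<partial>lborel) = (\<integral>x. v x * \<phi> x \<partial>lborel)"
      using assms(3) by (simp flip: dist_of_apply[OF _ \<phi>] add: assms)
    then show "(\<integral>x. (u x - v x) * \<phi> x \<partial>lborel) = 0"
      by (simp add: left_diff_distrib loc_int_integrable_test[OF _ \<phi>] assms)
  qed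
  from AE_completion[OF this] show ?thesis by eventually_elim simp
qed

lemma represents_unique:
  assumes "represents u T" "represents v T"
  shows "AE x in lebesgue. u x = v x"
proof -
  obtain u' v' where *: "loc_int u'" "AE x in lebesgue. u x = u' x" "T = dist_of u'"
      "loc_int v'" "AE x in lebesgue. v x = v' x" "T = dist_of v'"
    using assms unfolding represents_iff by blast
  then have "AE x in lebesgue. u' x = v' x" by (intro dist_of_eqD) auto
  with *(2,5) show ?thesis by eventually_elim simp
qed

lemma represents_cong_AE:
  assumes "represents u T" "AE x in lebesgue. v x = u x"
  shows "represents v T"
proof -
  obtain u' where *: "loc_int u'" "AE x in lebesgue. u x = u' x" "T = dist_of u'"
    using assms(1) unfolding represents_iff by blast
  have "AE x in lebesgue. v x = u' x" using *(2) assms(2) by eventually_elim simp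
  with * show ?thesis unfolding represents_iff by blast
qed

lemma distribution_eqI:
  assumes "S \<in> extensional test_functions" "T \<in> extensional test_functions"
    "\<And>\<phi>. \<phi> \<in> test_functions \<Longrightarrow> S \<phi> = T \<phi>"
  shows "S = T"
  using assms by (rule extensionalityI)

lemma dist_of_extensional [simp]: "dist_of u \<in> extensional test_functions"
  by (simp add: dist_of_def)

lemma dist_deriv_extensional [simp]: "dist_deriv bs T \<in> extensional test_functions"
  by (simp add: dist_deriv_def)

lemma mderiv_extensional [simp]: "mderiv \<beta> T \<in> extensional test_functions"
  by (simp add: mderiv_def)

section \<open>Derivatives indexed by multi-indices\<close>

abbreviation axes :: "'n::finite multi_index \<Rightarrow> (real^'n) list" where
  "axes \<beta> \<equiv> map (\<lambda>i. axis i 1) (mi_list \<beta>)"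

lemma count_mi_list: "count_list (mi_list \<beta>) i = \<beta> i"
proof -
  have "\<exists>is. \<forall>i. count_list is i = \<beta> i"
  proof -
    obtain xs where "mset xs = (\<Sum>i\<in>UNIV. replicate_mset (\<beta> i) i)" by (meson ex_mset)
    then have "count_list xs i = \<beta> i" for i
      unfolding count_mset[symmetric] by (simp add: count_sum)
    then show ?thesis by blast
  qed
  then show ?thesis unfolding mi_list_def by (rule someI2_ex) blast
qed

lemma length_mi_list: "length (mi_list \<beta>) = mi_order \<beta>"
  unfolding mi_order_def using sum_count_set[of "mi_list \<beta>" UNIV] by (simp add: count_mi_list)

lemma mset_mi_list_upd: "mset (mi_list (\<beta>(i := Suc (\<beta> i)))) = add_mset i (mset (mi_list \<beta>))"
  by (rule multiset_eqI) (simp add: count_mset count_mi_list)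

lemma axis_in_Basis: "axis i 1 \<in> (Basis :: (real^'n) set)"
  by (auto simp: Basis_vec_def)

lemma set_axes: "set (axes \<beta>) \<subseteq> Basis"
  by (auto simp: axis_in_Basis)

lemma mi_order_upd: "mi_order (\<beta>(i := Suc (\<beta> i))) = Suc (mi_order \<beta>)"
  unfolding length_mi_list[symmetric] by (metis mset_mi_list_upd size_add_mset size_mset)

lemma mderiv_apply:
  "\<phi> \<in> test_functions \<Longrightarrow> mderiv \<beta> T \<phi> = (-1) ^ mi_order \<beta> * T (iter_deriv (axes \<beta>) \<phi>)"
  by (simp add: mderiv_def dist_deriv_def length_mi_list)

text \<open>The list that \<open>mi_list\<close> chooses for the raised index need not extend the
  one chosen for \<open>\<beta>\<close>. Only the multisets are related, and the symmetry of mixed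
  derivatives does the rest.\<close>

lemma mderiv_upd_apply:
  assumes \<phi>: "\<phi> \<in> test_functions"
  shows "mderiv (\<beta>(i := Suc (\<beta> i))) T \<phi> = - mderiv \<beta> T (directional_deriv (axis i 1) \<phi>)"
proof -
  have "mset (axes (\<beta>(i := Suc (\<beta> i)))) = mset (axes \<beta> @ [axis i 1])"
    using arg_cong[OF mset_mi_list_upd[of \<beta> i], of "image_mset (\<lambda>i. axis i (1::real))"] by simp
  then have "iter_deriv (axes (\<beta>(i := Suc (\<beta> i)))) \<phi> = iter_deriv (axes \<beta> @ [axis i 1]) \<phi>"
    by (intro iter_deriv_mset_eq test_functionsD(1)[OF \<phi>] set_axes)
  then show ?thesis
    by (simp add: mderiv_apply \<phi> test_functions_directional_deriv[OF \<phi> axis_in_Basis] mi_order_upd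
        iter_deriv_append iter_deriv_Cons)
qed

lemma weak_deriv_mderiv:
  assumes "loc_int u" "loc_int h" "mderiv \<beta> T = dist_of u" "mderiv (\<beta>(i := Suc (\<beta> i))) T = dist_of h"
  shows "weak_deriv (axis i 1) u h"
  unfolding weak_deriv_def
proof (intro conjI ballI assms)
  fix \<phi> :: "real^'a \<Rightarrow> real" assume \<phi>: "\<phi> \<in> test_functions"
  have d: "directional_deriv (axis i 1) \<phi> \<in> test_functions"
    by (rule test_functions_directional_deriv[OF \<phi> axis_in_Basis])
  have "(\<integral>x. u x * directional_deriv (axis i 1) \<phi> x \<partial>lborel) = mderiv \<beta> T (directional_deriv (axis i 1) \<phi>)"
    by (simp only: assms(3) dist_of_apply[OF assms(1) d])
  also have "\<dots> = - mderiv (\<beta>(i := Suc (\<beta> i))) T \<phi>"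
    by (simp add: mderiv_upd_apply[OF \<phi>])
  also have "\<dots> = - (\<integral>x. h x * \<phi> x \<partial>lborel)"
    by (simp only: assms(4) dist_of_apply[OF assms(2) \<phi>])
  finally show "(\<integral>x. u x * directional_deriv (axis i 1) \<phi> x \<partial>lborel) = - (\<integral>x. h x * \<phi> x \<partial>lborel)" .
qed

text \<open>Downward induction on the order: the gradient of a derivative consists of derivatives of
  the next order, which are functions by induction, and \<open>loc_int_of_gradient\<close> then
  makes the derivative itself a function.\<close>

lemma mderiv_loc_int_lower:
  fixes g :: "real^'n::finite \<Rightarrow> real"
  assumes g: "loc_int g"
    and top: "\<And>\<beta>. mi_order \<beta> = m \<Longrightarrow> \<exists>h. loc_int h \<and> mderiv \<beta> (dist_of g) = dist_of h"
    and "mi_order \<beta> \<le> m"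
  shows "\<exists>h. loc_int h \<and> mderiv \<beta> (dist_of g) = dist_of h"
  using assms(3)
proof (induction "m - mi_order \<beta>" arbitrary: \<beta>)
  case 0
  then show ?case by (intro top) simp
next
  case (Suc d)
  have "\<exists>h. loc_int h \<and> mderiv (\<beta>(i := Suc (\<beta> i))) (dist_of g) = dist_of h" for i
    using Suc.hyps(2) by (intro Suc.hyps(1)) (auto simp: mi_order_upd)
  then obtain h where h: "\<And>i. loc_int (h i)" "\<And>i. mderiv (\<beta>(i := Suc (\<beta> i))) (dist_of g) = dist_of (h i)"
    by metis
  define idx where "idx = (\<lambda>b :: real^'n. SOME i. b = axis i 1)"
  have idx: "b = axis (idx b) 1" if "b \<in> Basis" for b
    unfolding idx_def by (rule someI_ex) (use that in \<open>auto simp: Basis_vec_def\<close>)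
  \<comment> \<open>The sign built into \<open>mderiv\<close>; raising the order by one adds another
    minus sign, which is why the gradient is fed in with the factor \<open>- s\<close>.\<close>
  define s where "s = (-1::real) ^ mi_order \<beta>"
  have ss: "s * s = 1" by (simp add: s_def flip: power_add mult_2)
  obtain k where k: "loc_int k" "\<And>\<phi>. \<phi> \<in> test_functions \<Longrightarrow>
      (\<integral>x. g x * iter_deriv (axes \<beta>) \<phi> x \<partial>lborel) = (\<integral>x. k x * \<phi> x \<partial>lborel)"
  proof (rule loc_int_of_gradient[OF g set_axes, where h="\<lambda>b x. (- s) * h (idx b) x"])
    show "loc_int (\<lambda>x. (- s) * h (idx b) x)" for b by (rule loc_int_scale[OF h(1)])
    fix b :: "real^'n" and \<phi> :: "real^'n \<Rightarrow> real" assume b: "b \<in> Basis" and \<phi>: "\<phi> \<in> test_functions"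
    have d: "directional_deriv b \<phi> \<in> test_functions" by (rule test_functions_directional_deriv[OF \<phi> b])
    have "(\<integral>x. h (idx b) x * \<phi> x \<partial>lborel) = - mderiv \<beta> (dist_of g) (directional_deriv b \<phi>)"
      using mderiv_upd_apply[OF \<phi>, of \<beta> "idx b" "dist_of g"] idx[OF b]
      by (simp add: h(2) dist_of_apply[OF h(1) \<phi>])
    also have "\<dots> = - s * (\<integral>x. g x * iter_deriv (axes \<beta>) (directional_deriv b \<phi>) x \<partial>lborel)"
      by (simp add: mderiv_apply[OF d] dist_of_apply[OF g test_functions_iter_deriv[OF d set_axes]] s_def)
    finally have "(- s) * (\<integral>x. h (idx b) x * \<phi> x \<partial>lborel) = s * s * (\<integral>x. g x * iter_deriv (axes \<beta>) (directional_deriv b \<phi>) x \<partial>lborel)"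
      by simp
    then show "(\<integral>x. g x * iter_deriv (axes \<beta>) (directional_deriv b \<phi>) x \<partial>lborel) = (\<integral>x. (- s) * h (idx b) x * \<phi> x \<partial>lborel)"
      by (simp only: ss mult.assoc integral_mult_right_zero)
  qed blast
  show ?case
  proof (intro exI conjI)
    show "loc_int (\<lambda>x. s * k x)" by (rule loc_int_scale[OF k(1)])
    show "mderiv \<beta> (dist_of g) = dist_of (\<lambda>x. s * k x)"
    proof (rule distribution_eqI)
      fix \<phi> :: "real^'n \<Rightarrow> real" assume \<phi>: "\<phi> \<in> test_functions"
      show "mderiv \<beta> (dist_of g) \<phi> = dist_of (\<lambda>x. s * k x) \<phi>"
        by (simp add: mderiv_apply[OF \<phi>] dist_of_apply[OF g test_functions_iter_deriv[OF \<phi> set_axes]]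
            dist_of_apply[OF loc_int_scale[OF k(1)] \<phi>] k(2)[OF \<phi>] s_def mult.assoc)
    qed simp_all
  qed
qed

section \<open>Members of the Adams-Frazier space\<close>

lemma Lebesgue_space_locally_integrable:
  assumes u: "u \<in> Lebesgue_space q" and q: "1 \<le> q"
  shows "locally_integrable u"
  unfolding locally_integrable_def set_integrable_def
proof (intro allI impI)
  fix K :: "'a set" assume K: "compact K"
  then have Km: "K \<in> sets lebesgue" by (simp add: borel_compact)
  have um: "u \<in> borel_measurable lebesgue" and ui: "integrable lebesgue (\<lambda>x. \<bar>u x\<bar> powr q)"
    using u by (auto simp: Lebesgue_space_def)
  show "integrable lebesgue (\<lambda>x. indicator K x *\<^sub>R u x)"
  proof (rule Bochner_Integration.integrable_bound)
    have "integrable lebesgue (indicator K :: 'a \<Rightarrow> real)"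
      using lmeasurable_compact[OF K] by (intro integrable_real_indicator) (auto simp: fmeasurable_def)
    then show "integrable lebesgue (\<lambda>x. indicator K x + \<bar>u x\<bar> powr q)" using ui by (rule Bochner_Integration.integrable_add)
    show "(\<lambda>x. indicator K x *\<^sub>R u x) \<in> borel_measurable lebesgue" using um Km by simp
    have "\<bar>u x\<bar> \<le> 1 + \<bar>u x\<bar> powr q" for x
    proof (cases "\<bar>u x\<bar> \<le> 1")
      case False
      then have "\<bar>u x\<bar> powr 1 \<le> \<bar>u x\<bar> powr q" using q by (intro powr_mono) auto
      then show ?thesis using False by simp
    qed (simp add: add_increasing2)
    then show "AE x in lebesgue. norm (indicator K x *\<^sub>R u x) \<le> norm (indicator K x + \<bar>u x\<bar> powr q)"
      by (auto simp: indicator_def)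
  qed
qed

lemma adams_frazier_mderiv_loc_int:
  fixes G :: "(real^'n::finite) distribution"
  assumes G: "G \<in> adams_frazier m p" and p: "1 \<le> p" and rep: "represents g G" and \<beta>: "mi_order \<beta> \<le> m"
  shows "\<exists>h. loc_int h \<and> mderiv \<beta> G = dist_of h"
proof -
  obtain g' where g': "loc_int g'" "G = dist_of g'" using rep unfolding represents_iff by blast
  show ?thesis unfolding g'(2)
  proof (rule mderiv_loc_int_lower[OF g'(1) _ \<beta>])
    fix \<gamma> :: "'n multi_index" assume "mi_order \<gamma> = m"
    then obtain u where u: "u \<in> Lebesgue_space p" "mderiv \<gamma> G = dist_of u"
      using G by (auto simp: adams_frazier_def homogeneous_Sobolev_def)
    obtain u' where u': "loc_int u'" "AE x in lebesgue. u x = u' x"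
      by (rule locally_integrable_borel_version[OF Lebesgue_space_locally_integrable[OF u(1) p]])
    then show "\<exists>h. loc_int h \<and> mderiv \<gamma> (dist_of g') = dist_of h"
      using u(2) dist_of_cong[OF u'] g'(2) by auto
  qed
qed

text \<open>Averaging the constant 1 over a unit segment gives 1 again. Transposed, this replaces
  the derivative by the difference of \<open>\<phi>\<close> and its translate, whose integral is
  zero.\<close>

lemma test_functions_integral_deriv_zero:
  assumes \<phi>: "\<phi> \<in> test_functions" and b: "b \<in> Basis"
  shows "(\<integral>x. directional_deriv b \<phi> x \<partial>lborel) = 0"
proof -
  interpret displacement lborel "ray_weight 1" "\<lambda>s. s *\<^sub>R b" "max \<bar>0\<bar> \<bar>1\<bar> * norm b" by (rule ray_displacement)
  have one: "loc_int (\<lambda>x::'a. 1)" by (rule loc_intI_bounded[of _ 1]) auto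
  have d: "directional_deriv b \<phi> \<in> test_functions" by (rule test_functions_directional_deriv[OF \<phi> b])
  have m: "\<phi> \<in> borel_measurable borel" by (rule test_functions_borel[OF \<phi>])
  have "ray_weight 1 = indicator {0..1}" by (auto simp: fun_eq_iff ray_weight_def indicator_def)
  then have "superpose lborel (ray_weight 1) (\<lambda>s. s *\<^sub>R b) (\<lambda>x. 1) = (\<lambda>x. 1)"
    by (simp add: superpose_def fun_eq_iff)
  with integral_superpose[OF one d]
  have "(\<integral>x. directional_deriv b \<phi> x \<partial>lborel) = (\<integral>x. \<phi> x - \<phi> (x - b) \<partial>lborel)"
    using superpose_ray_directional_deriv[OF \<phi>, of 1 b] by simp
  also have "\<dots> = 0"
    using lborel_translate[OF m, of "- b"] test_functions_integrable[OF \<phi>]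
    by (subst Bochner_Integration.integral_diff) auto
  finally show ?thesis .
qed

lemma test_functions_integration_by_parts:
  assumes \<phi>: "\<phi> \<in> test_functions" and \<psi>: "\<psi> \<in> test_functions" and b: "b \<in> Basis"
  shows "(\<integral>x. \<phi> x * directional_deriv b \<psi> x \<partial>lborel) = - (\<integral>x. directional_deriv b \<phi> x * \<psi> x \<partial>lborel)"
proof -
  have p: "(\<lambda>x. \<phi> x * \<psi> x) \<in> test_functions" by (rule test_functions_mult[OF test_functionsD(1)[OF \<phi>] \<psi>])
  have "0 = (\<integral>x. \<phi> x * directional_deriv b \<psi> x + directional_deriv b \<phi> x * \<psi> x \<partial>lborel)"
    using test_functions_integral_deriv_zero[OF p b]
    by (subst (asm) directional_deriv_mult) (auto intro: smooth_differentiable test_functionsD(1) \<phi> \<psi>)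
  also have "\<dots> = (\<integral>x. \<phi> x * directional_deriv b \<psi> x \<partial>lborel) + (\<integral>x. directional_deriv b \<phi> x * \<psi> x \<partial>lborel)"
    by (intro Bochner_Integration.integral_add loc_int_integrable_test test_functions_loc_int
        test_functions_directional_deriv \<phi> \<psi> b)
  finally show ?thesis by simp
qed

lemma iter_deriv_integration_by_parts:
  assumes \<phi>: "\<phi> \<in> test_functions" and \<psi>: "\<psi> \<in> test_functions" and bs: "set bs \<subseteq> Basis"
  shows "(\<integral>x. \<phi> x * iter_deriv bs \<psi> x \<partial>lborel) = (-1) ^ length bs * (\<integral>x. iter_deriv (rev bs) \<phi> x * \<psi> x \<partial>lborel)"
  using \<phi> bs
proof (induction bs arbitrary: \<phi>)
  case (Cons b bs)
  have "(\<integral>x. \<phi> x * iter_deriv (b # bs) \<psi> x \<partial>lborel) = - (\<integral>x. directional_deriv b \<phi> x * iter_deriv bs \<psi> x \<partial>lborel)"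
    unfolding iter_deriv_Cons
    using Cons.prems by (intro test_functions_integration_by_parts test_functions_iter_deriv \<psi>) auto
  also have "\<dots> = - ((-1) ^ length bs * (\<integral>x. iter_deriv (rev bs) (directional_deriv b \<phi>) x * \<psi> x \<partial>lborel))"
    using Cons.prems by (subst Cons.IH) (auto intro: test_functions_directional_deriv)
  finally show ?case by (simp add: iter_deriv_append iter_deriv_Cons)
qed simp

lemma test_functions_Lebesgue_space:
  assumes \<phi>: "\<phi> \<in> test_functions" and q: "q > 0"
  shows "\<phi> \<in> Lebesgue_space q"
proof -
  obtain B K where B: "B \<ge> 0" "compact K" "\<And>x. \<bar>\<phi> x\<bar> \<le> B * indicator K x"
    by (rule test_functions_dominated[OF \<phi>]) blast
  have [measurable]: "\<phi> \<in> borel_measurable borel" by (rule test_functions_borel[OF \<phi>])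
  have le: "\<bar>\<bar>\<phi> x\<bar> powr q\<bar> \<le> B powr q * indicator K x" for x
  proof (cases "x \<in> K")
    case True
    then show ?thesis using B(3)[of x] q by (auto intro!: powr_mono2)
  next
    case False
    then show ?thesis using B(3)[of x] by simp
  qed
  have "integrable lborel (\<lambda>x. \<bar>\<phi> x\<bar> powr q)"
    by (rule integrable_bounded_compact_support[OF _ B(2) le]) measurable
  then show ?thesis
    unfolding Lebesgue_space_def
    using measurable_completion[of \<phi> lborel borel] by (simp add: integrable_completion)
qed

lemma dist_of_distribution:
  assumes u: "loc_int u"
  shows "dist_of u \<in> distributions"
  unfolding distributions_def mem_Collect_eq
proof (intro conjI ballI allI impI)
  fix \<phi> \<psi> :: "'a \<Rightarrow> real" and a b :: real
  assume t: "\<phi> \<in> test_functions" "\<psi> \<in> test_functions"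
  have c: "(\<lambda>x. a * \<phi> x + b * \<psi> x) \<in> test_functions" by (intro test_functions_add test_functions_scale t)
  have "(\<integral>x. u x * (a * \<phi> x + b * \<psi> x) \<partial>lborel) = (\<integral>x. a * (u x * \<phi> x) + b * (u x * \<psi> x) \<partial>lborel)"
    by (simp add: algebra_simps)
  also have "\<dots> = a * (\<integral>x. u x * \<phi> x \<partial>lborel) + b * (\<integral>x. u x * \<psi> x \<partial>lborel)"
    by (simp add: loc_int_integrable_test[OF u] t)
  finally show "dist_of u (\<lambda>x. a * \<phi> x + b * \<psi> x) = a * dist_of u \<phi> + b * dist_of u \<psi>"
    by (simp add: dist_of_apply[OF u] c t)
next
  fix K :: "'a set" assume K: "compact K"
  show "\<exists>C N. \<forall>\<phi>\<in>test_functions. \<forall>M. {x. \<phi> x \<noteq> 0} \<subseteq> K \<and>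
      (\<forall>bs x. set bs \<subseteq> Basis \<and> length bs \<le> N \<longrightarrow> \<bar>iter_deriv bs \<phi> x\<bar> \<le> M) \<longrightarrow> \<bar>dist_of u \<phi>\<bar> \<le> C * M"
  proof (intro exI ballI allI impI, elim conjE)
    fix \<phi> :: "'a \<Rightarrow> real" and M :: real
    assume \<phi>: "\<phi> \<in> test_functions" and sub: "{x. \<phi> x \<noteq> 0} \<subseteq> K"
      and bd: "\<forall>bs x. set bs \<subseteq> Basis \<and> length bs \<le> 0 \<longrightarrow> \<bar>iter_deriv bs \<phi> x\<bar> \<le> M"
    have M: "\<bar>\<phi> x\<bar> \<le> M" for x using bd[rule_format, of "[]" x] by simp
    have "\<bar>\<integral>x. u x * \<phi> x \<partial>lborel\<bar> \<le> (\<integral>x. \<bar>indicator K x * u x\<bar> * M \<partial>lborel)"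
    proof (rule order_trans[OF integral_abs_bound integral_mono])
      show "integrable lborel (\<lambda>x. \<bar>u x * \<phi> x\<bar>)" by (intro integrable_abs loc_int_integrable_test u \<phi>)
      show "integrable lborel (\<lambda>x. \<bar>indicator K x * u x\<bar> * M)"
        by (intro integrable_mult_left integrable_abs loc_int_integrable u K)
      show "\<bar>u x * \<phi> x\<bar> \<le> \<bar>indicator K x * u x\<bar> * M" for x
      proof (cases "x \<in> K")
        case False
        with sub have "\<phi> x = 0" by auto
        then show ?thesis using False by simp
      qed (use M[of x] in \<open>auto simp: abs_mult intro: mult_left_mono\<close>)
    qed
    then show "\<bar>dist_of u \<phi>\<bar> \<le> (\<integral>x. \<bar>indicator K x * u x\<bar> \<partial>lborel) * M"
      by (simp add: dist_of_apply[OF u \<phi>])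
  qed
qed simp

text \<open>Provides the functions to which the hypothesis on \<open>f\<close> is applied when its
  regularity is derived.\<close>

lemma test_functions_adams_frazier:
  fixes \<phi> :: "real^'n::finite \<Rightarrow> real"
  assumes \<phi>: "\<phi> \<in> test_functions" and p: "p > 0" and m: "m > 0"
  shows "dist_of \<phi> \<in> adams_frazier m p"
proof -
  have "dist_of \<phi> \<in> homogeneous_Sobolev k q" if "q > 0" for k q
    unfolding homogeneous_Sobolev_def mem_Collect_eq
  proof (intro conjI allI impI)
    show "dist_of \<phi> \<in> distributions" by (intro dist_of_distribution test_functions_loc_int \<phi>)
    fix \<alpha> :: "'n multi_index"
    define \<psi> where "\<psi> = iter_deriv (rev (axes \<alpha>)) \<phi>"
    have \<psi>: "\<psi> \<in> test_functions" unfolding \<psi>_def using set_axes[of \<alpha>] by (intro test_functions_iter_deriv \<phi>) auto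
    have "mderiv \<alpha> (dist_of \<phi>) = dist_of \<psi>"
    proof (rule distribution_eqI)
      fix \<eta> :: "real^'n \<Rightarrow> real" assume \<eta>: "\<eta> \<in> test_functions"
      have "mderiv \<alpha> (dist_of \<phi>) \<eta> = (-1) ^ mi_order \<alpha> * (\<integral>x. \<phi> x * iter_deriv (axes \<alpha>) \<eta> x \<partial>lborel)"
        by (simp add: mderiv_apply[OF \<eta>] dist_of_apply[OF test_functions_loc_int[OF \<phi>] test_functions_iter_deriv[OF \<eta> set_axes]])
      also have "\<dots> = (\<integral>x. \<psi> x * \<eta> x \<partial>lborel)"
        unfolding iter_deriv_integration_by_parts[OF \<phi> \<eta> set_axes] \<psi>_def
        by (simp add: length_mi_list mult.assoc[symmetric] flip: power_mult_distrib)
      finally show "mderiv \<alpha> (dist_of \<phi>) \<eta> = dist_of \<psi> \<eta>"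
        by (simp add: dist_of_apply[OF test_functions_loc_int[OF \<psi>] \<eta>])
    qed simp_all
    then show "\<exists>u\<in>Lebesgue_space q. mderiv \<alpha> (dist_of \<phi>) = dist_of u"
      using test_functions_Lebesgue_space[OF \<psi> that] by blast
  qed
  then show ?thesis using p m by (simp add: adams_frazier_def)
qed

section \<open>Combinatorics of the chain rule\<close>

lemma finite_mi_below: "finite {\<beta> :: 'n::finite multi_index. \<beta> \<le> \<alpha>}"
proof (rule finite_subset)
  show "{\<beta>. \<beta> \<le> \<alpha>} \<subseteq> PiE UNIV (\<lambda>i. {..\<alpha> i})" by (auto simp: le_fun_def)
  show "finite (PiE UNIV (\<lambda>i. {..\<alpha> i}))" by (intro finite_PiE) auto
qed

definition mi_parts :: "'n::finite multi_index \<Rightarrow> 'n multi_index set" where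
  "mi_parts \<alpha> = {\<beta>. \<beta> \<le> \<alpha> \<and> \<beta> \<noteq> (\<lambda>_. 0)}"

lemma finite_mi_parts [simp]: "finite (mi_parts \<alpha>)"
  unfolding mi_parts_def by (rule finite_subset[OF _ finite_mi_below[of \<alpha>]]) auto

lemma mi_tuples_0: "mi_tuples 0 \<alpha> = (if \<alpha> = (\<lambda>_. 0) then {[]} else {})"
  by (auto simp: mi_tuples_def)

lemma mi_tuples_Suc:
  "mi_tuples (Suc s) \<alpha> = (\<lambda>(\<beta>, \<gamma>). \<beta> # \<gamma>) ` (SIGMA \<beta>:mi_parts \<alpha>. mi_tuples s (\<alpha> - \<beta>))"
proof (intro equalityI subsetI)
  fix \<delta> assume \<delta>: "\<delta> \<in> mi_tuples (Suc s) \<alpha>"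
  then obtain \<beta> \<gamma> where d: "\<delta> = \<beta> # \<gamma>" "length \<gamma> = s" by (auto simp: mi_tuples_def length_Suc_conv)
  have sum: "\<beta> i + (\<Sum>r<s. (\<gamma> ! r) i) = \<alpha> i" for i
    using \<delta> unfolding mi_tuples_def d(1) by (simp add: sum.lessThan_Suc_shift del: sum.lessThan_Suc)
  then have "\<beta> \<le> \<alpha>" unfolding le_fun_def by (metis le_add1)
  moreover have "\<beta> \<noteq> (\<lambda>_. 0)" "(\<lambda>_. 0) \<notin> set \<gamma>" using \<delta> by (auto simp: mi_tuples_def d(1))
  moreover have "(\<Sum>r<s. (\<gamma> ! r) i) = (\<alpha> - \<beta>) i" for i using sum[of i] by (simp add: fun_diff_def)
  ultimately show "\<delta> \<in> (\<lambda>(\<beta>, \<gamma>). \<beta> # \<gamma>) ` (SIGMA \<beta>:mi_parts \<alpha>. mi_tuples s (\<alpha> - \<beta>))"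
    unfolding d(1) by (intro rev_image_eqI[of "(\<beta>, \<gamma>)"]) (auto simp: mi_parts_def mi_tuples_def d(2))
next
  fix \<delta> assume "\<delta> \<in> (\<lambda>(\<beta>, \<gamma>). \<beta> # \<gamma>) ` (SIGMA \<beta>:mi_parts \<alpha>. mi_tuples s (\<alpha> - \<beta>))"
  then obtain \<beta> \<gamma> where d: "\<delta> = \<beta> # \<gamma>" "\<beta> \<le> \<alpha>" "\<beta> \<noteq> (\<lambda>_. 0)" "\<gamma> \<in> mi_tuples s (\<alpha> - \<beta>)"
    by (auto simp: mi_parts_def)
  then have "(\<Sum>r<Suc s. (\<delta> ! r) i) = \<alpha> i" for i
    using le_funD[OF d(2), of i] by (simp add: sum.lessThan_Suc_shift mi_tuples_def fun_diff_def del: sum.lessThan_Suc)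
  then show "\<delta> \<in> mi_tuples (Suc s) \<alpha>" using d by (auto simp: mi_tuples_def)
qed

lemma finite_mi_tuples [simp]: "finite (mi_tuples s \<alpha>)"
  by (induction s arbitrary: \<alpha>) (auto simp: mi_tuples_0 mi_tuples_Suc)

text \<open>If \<open>a \<beta>\<close> are the Taylor coefficients of a function vanishing at the
  base point, this is the coefficient of index \<open>\<alpha>\<close> of its \<open>s\<close>-th
  power; the recursion \<open>tuple_sum_Suc\<close> is multiplication by one more factor.\<close>

definition tuple_sum :: "nat \<Rightarrow> 'n::finite multi_index \<Rightarrow> ('n multi_index \<Rightarrow> real) \<Rightarrow> real" where
  "tuple_sum s \<alpha> a = (\<Sum>\<gamma>\<in>mi_tuples s \<alpha>. \<Prod>r<s. a (\<gamma> ! r))"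

lemma tuple_sum_0: "tuple_sum 0 \<alpha> a = (if \<alpha> = (\<lambda>_. 0) then 1 else 0)"
  by (simp add: tuple_sum_def mi_tuples_0)

lemma tuple_sum_Suc: "tuple_sum (Suc s) \<alpha> a = (\<Sum>\<beta>\<in>mi_parts \<alpha>. a \<beta> * tuple_sum s (\<alpha> - \<beta>) a)"
proof -
  have inj: "inj_on (\<lambda>(\<beta>, \<gamma>). \<beta> # \<gamma>) (SIGMA \<beta>:mi_parts \<alpha>. mi_tuples s (\<alpha> - \<beta>))"
    by (auto simp: inj_on_def)
  have "tuple_sum (Suc s) \<alpha> a = (\<Sum>(\<beta>, \<gamma>)\<in>(SIGMA \<beta>:mi_parts \<alpha>. mi_tuples s (\<alpha> - \<beta>)). a \<beta> * (\<Prod>r<s. a (\<gamma> ! r)))"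
    unfolding tuple_sum_def mi_tuples_Suc
    by (subst sum.reindex[OF inj]) (auto intro!: sum.cong simp: prod.lessThan_Suc_shift simp del: prod.lessThan_Suc)
  also have "\<dots> = (\<Sum>\<beta>\<in>mi_parts \<alpha>. \<Sum>\<gamma>\<in>mi_tuples s (\<alpha> - \<beta>). a \<beta> * (\<Prod>r<s. a (\<gamma> ! r)))"
    by (rule sum.Sigma[symmetric]) auto
  finally show ?thesis by (simp add: tuple_sum_def sum_distrib_left)
qed

lemma mi_order_diff: "\<beta> \<le> \<alpha> \<Longrightarrow> mi_order (\<alpha> - \<beta>) + mi_order \<beta> = mi_order \<alpha>"
  unfolding mi_order_def by (auto simp: fun_diff_def le_fun_def sum.distrib[symmetric])

lemma mi_order_pos_iff: "0 < mi_order \<beta> \<longleftrightarrow> \<beta> \<noteq> (\<lambda>_. 0)"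
  unfolding mi_order_def zero_less_iff_neq_zero by (auto simp: fun_eq_iff)

lemma tuple_sum_eq_0: "mi_order \<alpha> < s \<Longrightarrow> tuple_sum s \<alpha> a = 0"
proof (induction s arbitrary: \<alpha>)
  case (Suc s)
  have "tuple_sum s (\<alpha> - \<beta>) a = 0" if "\<beta> \<in> mi_parts \<alpha>" for \<beta>
  proof (rule Suc.IH)
    have "mi_order \<beta> > 0" "\<beta> \<le> \<alpha>" using that by (auto simp: mi_parts_def mi_order_pos_iff)
    then show "mi_order (\<alpha> - \<beta>) < s" using mi_order_diff[of \<beta> \<alpha>] Suc.prems by linarith
  qed
  then show ?case by (simp add: tuple_sum_Suc)
qed simp

text \<open>With as many parts as the total order every part has order one, so each product contains
  a vanishing factor. The condition \<open>s > 0\<close> excludes the empty product.\<close>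

lemma tuple_sum_top_eq_0:
  assumes "mi_order \<alpha> = s" "s > 0" and zero: "\<And>\<beta>. \<beta> \<le> \<alpha> \<Longrightarrow> mi_order \<beta> = 1 \<Longrightarrow> a \<beta> = 0"
  shows "tuple_sum s \<alpha> a = 0"
proof -
  obtain s' where s: "s = Suc s'" using assms(2) by (cases s) auto
  have "a \<beta> * tuple_sum s' (\<alpha> - \<beta>) a = 0" if "\<beta> \<in> mi_parts \<alpha>" for \<beta>
  proof (cases "mi_order \<beta> = 1")
    case True
    then show ?thesis using zero that by (simp add: mi_parts_def)
  next
    case False
    have "mi_order \<beta> > 0" "\<beta> \<le> \<alpha>" using that by (auto simp: mi_parts_def mi_order_pos_iff)
    then have "mi_order (\<alpha> - \<beta>) < s'" using mi_order_diff[of \<beta> \<alpha>] assms(1) s False by linarith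
    then show ?thesis by (simp add: tuple_sum_eq_0)
  qed
  then show ?thesis unfolding s tuple_sum_Suc by (rule sum.neutral[OF ballI])
qed

abbreviation mi_suc :: "'n multi_index \<Rightarrow> 'n \<Rightarrow> 'n multi_index" where
  "mi_suc \<alpha> i \<equiv> \<alpha>(i := Suc (\<alpha> i))"

abbreviation mi_unit :: "'n \<Rightarrow> 'n multi_index" where
  "mi_unit i \<equiv> mi_suc (\<lambda>_. 0) i"

text \<open>The product rule for power series at the coefficient of index \<open>\<alpha>\<close>:
  the weight \<open>Suc (\<alpha> i)\<close> is shared between the first part and the rest of the
  tuple. First parts with nonzero \<open>i\<close>-th entry are written
  \<open>mi_suc \<beta> i\<close>; the choice \<open>\<beta> = 0\<close> is not in
  \<open>mi_parts \<alpha>\<close> and yields the separate term with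
  \<open>mi_unit i\<close>.\<close>

lemma tuple_sum_mi_suc:
  "real (Suc (\<alpha> i)) * tuple_sum (Suc s) (mi_suc \<alpha> i) a
   = a (mi_unit i) * tuple_sum s \<alpha> a
   + (\<Sum>\<beta>\<in>mi_parts \<alpha>. real (Suc (\<beta> i)) * a (mi_suc \<beta> i) * tuple_sum s (\<alpha> - \<beta>) a
       + a \<beta> * (real (Suc ((\<alpha> - \<beta>) i)) * tuple_sum s (mi_suc (\<alpha> - \<beta>) i) a))"
proof -
  let ?t = "\<lambda>\<beta>. a \<beta> * tuple_sum s (mi_suc \<alpha> i - \<beta>) a"
  have split: "real (Suc (\<alpha> i)) = real (\<beta> i) + real (Suc (\<alpha> i) - \<beta> i)" if "\<beta> \<in> mi_parts (mi_suc \<alpha> i)" for \<beta>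
    using that by (auto simp: mi_parts_def le_fun_def dest: spec[of _ i])
  have "real (Suc (\<alpha> i)) * tuple_sum (Suc s) (mi_suc \<alpha> i) a
      = (\<Sum>\<beta>\<in>mi_parts (mi_suc \<alpha> i). real (\<beta> i) * ?t \<beta> + real (Suc (\<alpha> i) - \<beta> i) * ?t \<beta>)"
    unfolding tuple_sum_Suc sum_distrib_left
    by (intro sum.cong refl) (simp only: split distrib_right[symmetric])
  also have "\<dots> = (\<Sum>\<beta>\<in>mi_parts (mi_suc \<alpha> i). real (\<beta> i) * ?t \<beta>) + (\<Sum>\<beta>\<in>mi_parts (mi_suc \<alpha> i). real (Suc (\<alpha> i) - \<beta> i) * ?t \<beta>)"
    by (rule sum.distrib)
  also have "(\<Sum>\<beta>\<in>mi_parts (mi_suc \<alpha> i). real (\<beta> i) * ?t \<beta>)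
     = (\<Sum>\<beta>\<in>{\<beta>. \<beta> \<le> \<alpha>}. real (Suc (\<beta> i)) * a (mi_suc \<beta> i) * tuple_sum s (\<alpha> - \<beta>) a)"
  proof -
    have inj: "inj_on (\<lambda>\<beta>. mi_suc \<beta> i) {\<beta>. \<beta> \<le> \<alpha>}"
      by (auto simp: inj_on_def fun_eq_iff split: if_splits)
    have img: "(\<lambda>\<beta>. mi_suc \<beta> i) ` {\<beta>. \<beta> \<le> \<alpha>} = {\<beta> \<in> mi_parts (mi_suc \<alpha> i). \<beta> i \<noteq> 0}"
    proof (intro equalityI subsetI)
      fix \<beta> assume b: "\<beta> \<in> {\<beta> \<in> mi_parts (mi_suc \<alpha> i). \<beta> i \<noteq> 0}"
      then have "\<beta> = mi_suc (\<beta>(i := \<beta> i - 1)) i" by auto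
      moreover have "\<beta>(i := \<beta> i - 1) \<le> \<alpha>"
        unfolding le_fun_def
      proof
        fix j
        have "\<beta> j \<le> mi_suc \<alpha> i j" using b by (auto simp: mi_parts_def le_fun_def)
        then show "(\<beta>(i := \<beta> i - 1)) j \<le> \<alpha> j" by (cases "j = i") auto
      qed
      ultimately show "\<beta> \<in> (\<lambda>\<beta>. mi_suc \<beta> i) ` {\<beta>. \<beta> \<le> \<alpha>}" by blast
    qed (auto simp: mi_parts_def le_fun_def fun_eq_iff)
    have diff: "mi_suc \<alpha> i - mi_suc \<beta> i = \<alpha> - \<beta>" for \<beta> by (auto simp: fun_eq_iff fun_diff_def)
    have "(\<Sum>\<beta>\<in>mi_parts (mi_suc \<alpha> i). real (\<beta> i) * ?t \<beta>) = (\<Sum>\<beta>\<in>{\<beta> \<in> mi_parts (mi_suc \<alpha> i). \<beta> i \<noteq> 0}. real (\<beta> i) * ?t \<beta>)"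
      by (rule sum.mono_neutral_right) auto
    also have "\<dots> = (\<Sum>\<beta>\<in>{\<beta>. \<beta> \<le> \<alpha>}. real (mi_suc \<beta> i i) * ?t (mi_suc \<beta> i))"
      unfolding img[symmetric] by (rule sum.reindex[OF inj, unfolded o_def])
    finally show ?thesis by (simp add: diff mult.assoc)
  qed
  also have "{\<beta>. \<beta> \<le> \<alpha>} = insert (\<lambda>_. 0) (mi_parts \<alpha>)"
    by (auto simp: mi_parts_def le_fun_def)
  also have "(\<Sum>\<beta>\<in>insert (\<lambda>_. 0) (mi_parts \<alpha>). real (Suc (\<beta> i)) * a (mi_suc \<beta> i) * tuple_sum s (\<alpha> - \<beta>) a)
    = a (mi_unit i) * tuple_sum s \<alpha> a + (\<Sum>\<beta>\<in>mi_parts \<alpha>. real (Suc (\<beta> i)) * a (mi_suc \<beta> i) * tuple_sum s (\<alpha> - \<beta>) a)"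
    by (subst sum.insert[OF finite_mi_parts]) (simp_all add: mi_parts_def fun_diff_def)
  also have "(\<Sum>\<beta>\<in>mi_parts (mi_suc \<alpha> i). real (Suc (\<alpha> i) - \<beta> i) * ?t \<beta>)
     = (\<Sum>\<beta>\<in>mi_parts \<alpha>. a \<beta> * (real (Suc ((\<alpha> - \<beta>) i)) * tuple_sum s (mi_suc (\<alpha> - \<beta>) i) a))"
  proof -
    have "(\<Sum>\<beta>\<in>mi_parts (mi_suc \<alpha> i). real (Suc (\<alpha> i) - \<beta> i) * ?t \<beta>) = (\<Sum>\<beta>\<in>mi_parts \<alpha>. real (Suc (\<alpha> i) - \<beta> i) * ?t \<beta>)"
    proof (rule sum.mono_neutral_right)
      show "mi_parts \<alpha> \<subseteq> mi_parts (mi_suc \<alpha> i)"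
        by (auto simp: mi_parts_def le_fun_def intro: le_SucI)
      show "\<forall>\<beta>\<in>mi_parts (mi_suc \<alpha> i) - mi_parts \<alpha>. real (Suc (\<alpha> i) - \<beta> i) * ?t \<beta> = 0"
      proof
        fix \<beta> assume b: "\<beta> \<in> mi_parts (mi_suc \<alpha> i) - mi_parts \<alpha>"
        then obtain j where j: "\<not> \<beta> j \<le> \<alpha> j" by (auto simp: mi_parts_def le_fun_def)
        have "\<beta> j \<le> mi_suc \<alpha> i j" using b by (auto simp: mi_parts_def le_fun_def)
        with j have "j = i" by (auto split: if_splits)
        then show "real (Suc (\<alpha> i) - \<beta> i) * ?t \<beta> = 0" using j by simp
      qed
    qed simp
    also have "\<dots> = (\<Sum>\<beta>\<in>mi_parts \<alpha>. a \<beta> * (real (Suc ((\<alpha> - \<beta>) i)) * tuple_sum s (mi_suc (\<alpha> - \<beta>) i) a))"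
    proof (rule sum.cong[OF refl])
      fix \<beta> assume "\<beta> \<in> mi_parts \<alpha>"
      then have le: "\<beta> j \<le> \<alpha> j" for j by (auto simp: mi_parts_def le_fun_def)
      have "mi_suc \<alpha> i - \<beta> = mi_suc (\<alpha> - \<beta>) i"
        using le[of i] by (auto simp: fun_eq_iff fun_diff_def Suc_diff_le)
      moreover have "Suc (\<alpha> i) - \<beta> i = Suc ((\<alpha> - \<beta>) i)" using le[of i] by (simp add: fun_diff_def Suc_diff_le)
      ultimately show "real (Suc (\<alpha> i) - \<beta> i) * ?t \<beta> = a \<beta> * (real (Suc ((\<alpha> - \<beta>) i)) * tuple_sum s (mi_suc (\<alpha> - \<beta>) i) a)"
        by (simp only: mult_ac)
    qed
    finally show ?thesis .
  qed
  finally show ?thesis by (simp only: sum.distrib add.assoc)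
qed

text \<open>Let u(y) = g(x + y) - g(x), with Taylor coefficients \<open>a\<close>. Moving the base
  point in direction \<open>i\<close> changes u by its own partial derivative minus the constant
  \<open>a (mi_unit i)\<close>, since the subtracted value moves too. For the \<open>s\<close>-th
  power this gives the formal derivative minus s times that constant times the power s - 1. For
  \<open>s = 0\<close> the truncated \<open>s - 1\<close> is multiplied by 0.\<close>

lemma tuple_sum_has_derivative:
  fixes a :: "'n::finite multi_index \<Rightarrow> real \<Rightarrow> real"
  assumes "\<And>\<beta>. \<beta> \<in> mi_parts \<alpha> \<Longrightarrow> (a \<beta> has_real_derivative real (Suc (\<beta> i)) * a (mi_suc \<beta> i) x) (at x within S)"
  shows "((\<lambda>t. tuple_sum s \<alpha> (\<lambda>\<beta>. a \<beta> t)) has_real_derivative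
      real (Suc (\<alpha> i)) * tuple_sum s (mi_suc \<alpha> i) (\<lambda>\<beta>. a \<beta> x)
      - real s * a (mi_unit i) x * tuple_sum (s - 1) \<alpha> (\<lambda>\<beta>. a \<beta> x)) (at x within S)"
  using assms
proof (induction s arbitrary: \<alpha>)
  case 0
  have "mi_suc \<alpha> i \<noteq> (\<lambda>_. 0)" by (metis fun_upd_same nat.distinct(1))
  then show ?case by (simp add: tuple_sum_0 del: fun_upd_apply)
next
  case (Suc s)
  let ?a = "\<lambda>\<beta>. a \<beta> x"
  have sub: "mi_parts (\<alpha> - \<beta>) \<subseteq> mi_parts \<alpha>" for \<beta>
    by (auto simp: mi_parts_def le_fun_def fun_diff_def intro: order_trans[OF _ diff_le_self])
  have IH: "((\<lambda>t. tuple_sum s (\<alpha> - \<beta>) (\<lambda>\<beta>. a \<beta> t)) has_real_derivative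
      real (Suc ((\<alpha> - \<beta>) i)) * tuple_sum s (mi_suc (\<alpha> - \<beta>) i) ?a
      - real s * a (mi_unit i) x * tuple_sum (s - 1) (\<alpha> - \<beta>) ?a) (at x within S)" for \<beta>
    by (rule Suc.IH) (use Suc.prems sub in blast)
  have "((\<lambda>t. tuple_sum (Suc s) \<alpha> (\<lambda>\<beta>. a \<beta> t)) has_real_derivative
     (\<Sum>\<beta>\<in>mi_parts \<alpha>. (real (Suc (\<beta> i)) * a (mi_suc \<beta> i) x) * tuple_sum s (\<alpha> - \<beta>) ?a
       + (real (Suc ((\<alpha> - \<beta>) i)) * tuple_sum s (mi_suc (\<alpha> - \<beta>) i) ?a
      - real s * a (mi_unit i) x * tuple_sum (s - 1) (\<alpha> - \<beta>) ?a) * a \<beta> x)) (at x within S)"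
    unfolding tuple_sum_Suc
    by (intro DERIV_sum DERIV_mult Suc.prems IH)
  also have "(\<Sum>\<beta>\<in>mi_parts \<alpha>. (real (Suc (\<beta> i)) * a (mi_suc \<beta> i) x) * tuple_sum s (\<alpha> - \<beta>) ?a
       + (real (Suc ((\<alpha> - \<beta>) i)) * tuple_sum s (mi_suc (\<alpha> - \<beta>) i) ?a
      - real s * a (mi_unit i) x * tuple_sum (s - 1) (\<alpha> - \<beta>) ?a) * a \<beta> x)
    = (\<Sum>\<beta>\<in>mi_parts \<alpha>. real (Suc (\<beta> i)) * ?a (mi_suc \<beta> i) * tuple_sum s (\<alpha> - \<beta>) ?a
       + ?a \<beta> * (real (Suc ((\<alpha> - \<beta>) i)) * tuple_sum s (mi_suc (\<alpha> - \<beta>) i) ?a))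
      - real s * a (mi_unit i) x * (\<Sum>\<beta>\<in>mi_parts \<alpha>. ?a \<beta> * tuple_sum (s - 1) (\<alpha> - \<beta>) ?a)"
    unfolding sum_distrib_left sum_subtractf[symmetric] by (intro sum.cong refl) (simp add: algebra_simps)
  also have "\<dots> = real (Suc (\<alpha> i)) * tuple_sum (Suc s) (mi_suc \<alpha> i) ?a - a (mi_unit i) x * tuple_sum s \<alpha> ?a
      - real s * a (mi_unit i) x * (\<Sum>\<beta>\<in>mi_parts \<alpha>. ?a \<beta> * tuple_sum (s - 1) (\<alpha> - \<beta>) ?a)"
    using tuple_sum_mi_suc[of \<alpha> i s ?a] by simp
  also have "real s * a (mi_unit i) x * (\<Sum>\<beta>\<in>mi_parts \<alpha>. ?a \<beta> * tuple_sum (s - 1) (\<alpha> - \<beta>) ?a)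
      = real s * a (mi_unit i) x * tuple_sum s \<alpha> ?a"
    by (cases s) (simp_all add: tuple_sum_Suc)
  finally show ?case
    by (rule DERIV_cong) (simp add: algebra_simps del: fun_upd_apply)
qed

text \<open>The Taylor coefficient of the composition, without the factor
  \<open>mi_fact \<alpha>\<close>. The sum starts at 0, unlike the formula to be proved: for
  \<open>\<alpha> = 0\<close> the term \<open>s = 0\<close> is the value of the composition, which
  starts the induction, and for other \<open>\<alpha>\<close> it vanishes.\<close>

definition faa_sum :: "'n::finite multi_index \<Rightarrow> (nat \<Rightarrow> real) \<Rightarrow> ('n multi_index \<Rightarrow> real) \<Rightarrow> real" where
  "faa_sum \<alpha> c a = (\<Sum>s\<le>mi_order \<alpha>. c s / fact s * tuple_sum s \<alpha> a)"

lemma faa_di_bruno_eq_faa_sum: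
  assumes "0 < mi_order \<alpha>"
  shows "faa_di_bruno \<alpha> F g D x = mi_fact \<alpha> * faa_sum \<alpha> (\<lambda>s. F s (g x)) (\<lambda>\<beta>. D \<beta> x / mi_fact \<beta>)"
proof -
  have "tuple_sum 0 \<alpha> a = 0" for a using assms by (simp add: tuple_sum_0 mi_order_pos_iff)
  then have "faa_sum \<alpha> (\<lambda>s. F s (g x)) (\<lambda>\<beta>. D \<beta> x / mi_fact \<beta>)
     = (\<Sum>s=1..mi_order \<alpha>. F s (g x) / fact s * tuple_sum s \<alpha> (\<lambda>\<beta>. D \<beta> x / mi_fact \<beta>))"
    unfolding faa_sum_def by (intro sum.mono_neutral_right) (auto simp: not_le less_Suc_eq_0_disj)
  then show ?thesis
    unfolding faa_di_bruno_def tuple_sum_def sum_distrib_left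
    by (simp add: faa_coeff_def prod_dividef sum_distrib_left mult_ac)
qed

text \<open>Because \<open>v\<close> vanishes at the point, the difference quotient of the product
  is \<open>u t\<close> times that of \<open>v\<close>, so continuity of \<open>u\<close>
  suffices.\<close>

lemma DERIV_mult_zero_within:
  fixes u v :: "real \<Rightarrow> real"
  assumes "continuous (at x within S) u" "(v has_real_derivative d) (at x within S)" "v x = 0"
  shows "((\<lambda>t. u t * v t) has_real_derivative u x * d) (at x within S)"
proof -
  have "((\<lambda>t. u t * ((v t - v x) / (t - x))) \<longlongrightarrow> u x * d) (at x within S)"
    using assms(1,2) by (intro tendsto_mult) (auto simp: continuous_within has_field_derivative_iff)
  then show ?thesis using assms(3) by (simp add: has_field_derivative_iff)
qed

text \<open>The second term at s + 1 cancels the first term at s, since s / s! is 1 / (s - 1)!. Only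
  the first term at \<open>k\<close> survives.\<close>

lemma sum_fact_telescope:
  fixes c T :: "nat \<Rightarrow> real"
  shows "(\<Sum>s\<le>k. c (Suc s) * e * T s / fact s - c s * (real s * e * T (s - 1)) / fact s) = c (Suc k) * e * T k / fact k"
proof (induction k)
  case (Suc k)
  have "c (Suc k) * (real (Suc k) * e * T k) / fact (Suc k) = c (Suc k) * e * T k / fact k"
    by (simp add: divide_simps del: of_nat_Suc)
  with Suc.IH show ?case by (simp del: fact_Suc of_nat_Suc)
qed simp

text \<open>Only the top-order factor \<open>c (mi_order \<alpha>)\<close> may fail to be differentiable, and then at a point where its
  cofactor vanishes.\<close>

lemma faa_sum_has_derivative:
  fixes a :: "'n::finite multi_index \<Rightarrow> real \<Rightarrow> real" and c :: "nat \<Rightarrow> real \<Rightarrow> real"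
  assumes a: "\<And>\<beta>. \<beta> \<in> mi_parts \<alpha> \<Longrightarrow> (a \<beta> has_real_derivative real (Suc (\<beta> i)) * a (mi_suc \<beta> i) x) (at x within S)"
    and c: "\<And>s. s \<le> mi_order \<alpha> \<Longrightarrow> (c s has_real_derivative c (Suc s) x * a (mi_unit i) x) (at x within S) \<or>
       continuous (at x within S) (c s) \<and> tuple_sum s \<alpha> (\<lambda>\<beta>. a \<beta> x) = 0"
    and nontriv: "at x within S \<noteq> bot"
  shows "((\<lambda>t. faa_sum \<alpha> (\<lambda>s. c s t) (\<lambda>\<beta>. a \<beta> t)) has_real_derivative
      real (Suc (\<alpha> i)) * faa_sum (mi_suc \<alpha> i) (\<lambda>s. c s x) (\<lambda>\<beta>. a \<beta> x)) (at x within S)"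
proof -
  let ?a = "\<lambda>\<beta>. a \<beta> x" and ?e = "a (mi_unit i) x" and ?n = "mi_order \<alpha>"
  let ?T = "\<lambda>s. tuple_sum s \<alpha> (\<lambda>\<beta>. a \<beta> x)" and ?T' = "\<lambda>s. tuple_sum s (mi_suc \<alpha> i) (\<lambda>\<beta>. a \<beta> x)"
  have dT: "((\<lambda>t. tuple_sum s \<alpha> (\<lambda>\<beta>. a \<beta> t)) has_real_derivative
      real (Suc (\<alpha> i)) * ?T' s - real s * ?e * ?T (s - 1)) (at x within S)" for s
    by (rule tuple_sum_has_derivative[OF a])
  have summand: "((\<lambda>t. c s t * tuple_sum s \<alpha> (\<lambda>\<beta>. a \<beta> t)) has_real_derivative
      c (Suc s) x * ?e * ?T s + c s x * (real (Suc (\<alpha> i)) * ?T' s - real s * ?e * ?T (s - 1))) (at x within S)"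
    if s: "s \<le> ?n" for s
    using c[OF s]
  proof
    assume "(c s has_real_derivative c (Suc s) x * ?e) (at x within S)"
    from DERIV_mult[OF this dT] show ?thesis by (simp add: mult.commute)
  next
    assume "continuous (at x within S) (c s) \<and> ?T s = 0"
    then show ?thesis using DERIV_mult_zero_within[OF _ dT] by simp
  qed
  have "((\<lambda>t. faa_sum \<alpha> (\<lambda>s. c s t) (\<lambda>\<beta>. a \<beta> t)) has_real_derivative
     (\<Sum>s\<le>?n. (c (Suc s) x * ?e * ?T s + c s x * (real (Suc (\<alpha> i)) * ?T' s - real s * ?e * ?T (s - 1))) / fact s)) (at x within S)"
    unfolding faa_sum_def times_divide_eq_left by (intro DERIV_sum DERIV_cdivide summand) simp
  also have "(\<Sum>s\<le>?n. (c (Suc s) x * ?e * ?T s + c s x * (real (Suc (\<alpha> i)) * ?T' s - real s * ?e * ?T (s - 1))) / fact s)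
    = real (Suc (\<alpha> i)) * (\<Sum>s\<le>?n. c s x / fact s * ?T' s)
      + (\<Sum>s\<le>?n. c (Suc s) x * ?e * ?T s / fact s - c s x * (real s * ?e * ?T (s - 1)) / fact s)"
    unfolding sum_distrib_left sum.distrib[symmetric]
    by (intro sum.cong refl) (simp add: field_simps)
  also have "(\<Sum>s\<le>k. c (Suc s) x * ?e * ?T s / fact s - c s x * (real s * ?e * ?T (s - 1)) / fact s)
      = c (Suc k) x * ?e * ?T k / fact k" for k
    by (rule sum_fact_telescope)
  finally have D: "((\<lambda>t. faa_sum \<alpha> (\<lambda>s. c s t) (\<lambda>\<beta>. a \<beta> t)) has_real_derivative
     real (Suc (\<alpha> i)) * (\<Sum>s\<le>?n. c s x / fact s * ?T' s) + c (Suc ?n) x * ?e * ?T ?n / fact ?n) (at x within S)" .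
  \<comment> \<open>There are no tuples with more parts than the order, so this function is
    constantly 0. Comparing with the formula for its derivative shows that the term left over by the
    telescoping is the summand of index \<open>Suc ?n\<close> for the raised multi-index.\<close>
  have "((\<lambda>t. tuple_sum (Suc ?n) \<alpha> (\<lambda>\<beta>. a \<beta> t)) has_real_derivative 0) (at x within S)"
    by (simp add: tuple_sum_eq_0)
  with dT have "real (Suc (\<alpha> i)) * ?T' (Suc ?n) - real (Suc ?n) * ?e * ?T (Suc ?n - 1) = 0"
    using nontriv by (rule has_field_derivative_unique)
  then have "?e * ?T ?n = real (Suc (\<alpha> i)) * ?T' (Suc ?n) / real (Suc ?n)"
    by (simp add: field_simps del: of_nat_Suc)
  then have "c (Suc ?n) x * (?e * ?T ?n) / fact ?n = real (Suc (\<alpha> i)) * (c (Suc ?n) x / fact (Suc ?n) * ?T' (Suc ?n))"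
    by (simp only:) (simp add: mult_ac del: of_nat_Suc fun_upd_apply)
  with D show ?thesis
    unfolding faa_sum_def mi_order_upd by (simp add: distrib_left mult.assoc)
qed

section \<open>The chain rule almost everywhere\<close>

lemma harmonic_points_has_derivative_cong:
  assumes "\<And>t. t \<in> harmonic_points \<Longrightarrow> F t = G t"
  shows "(F has_real_derivative d) (at 0 within harmonic_points) \<longleftrightarrow> (G has_real_derivative d) (at 0 within harmonic_points)"
  using assms unfolding harmonic_points_derivative_iff by (simp add: harmonic_points_def)

lemma harmonic_points_nontrivial: "at 0 within harmonic_points \<noteq> bot"
proof
  assume "at 0 within harmonic_points = bot"
  then have "((\<lambda>x. x) has_real_derivative 0) (at 0 within harmonic_points)"
    by (simp add: has_field_derivative_iff)
  moreover have "((\<lambda>x. x) has_real_derivative 1) (at 0 within harmonic_points)" by simp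
  ultimately show False using has_real_derivative_harmonic_points_unique by fastforce
qed

lemma AE_harmonic_points:
  fixes b :: "'a::euclidean_space"
  assumes "AE x in lebesgue. P x"
  shows "AE x in lebesgue. \<forall>t\<in>harmonic_points. P (x + t *\<^sub>R b)"
proof -
  have "AE x in lborel. P x" using assms by (simp add: AE_completion_iff)
  then have "AE x in lborel. \<forall>t\<in>harmonic_points. P (x + t *\<^sub>R b)"
  proof (subst AE_ball_countable)
    show "countable harmonic_points" by (simp add: harmonic_points_def)
  qed (intro ballI AE_lborel_translate)
  then show ?thesis by (rule AE_completion)
qed

lemma represents_mderiv_has_derivative:
  assumes "represents u (mderiv \<beta> T)" "represents h (mderiv (mi_suc \<beta> i) T)"
  shows "AE x in lebesgue. ((\<lambda>t. u (x + t *\<^sub>R axis i 1)) has_real_derivative h x) (at 0 within harmonic_points)"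
proof -
  obtain u' h' where *: "loc_int u'" "AE x in lebesgue. u x = u' x" "mderiv \<beta> T = dist_of u'"
      "loc_int h'" "AE x in lebesgue. h x = h' x" "mderiv (mi_suc \<beta> i) T = dist_of h'"
    using assms unfolding represents_iff by blast
  have "weak_deriv (axis i 1) u' h'" by (rule weak_deriv_mderiv[OF *(1,4,3,6)])
  from AE_completion[OF weak_deriv_has_derivative_harmonic[OF this axis_in_Basis]] *(5) AE_harmonic_points[OF *(2), where b="axis i 1"]
  show ?thesis
  proof eventually_elim
    case (elim x)
    then have "((\<lambda>t. u (x + t *\<^sub>R axis i 1)) has_real_derivative h' x) (at 0 within harmonic_points)"
      by (subst harmonic_points_has_derivative_cong[of _ "\<lambda>t. u' (x + t *\<^sub>R axis i 1)"]) blast+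
    then show ?case using elim(2) by simp
  qed
qed

lemma represents_mderiv_zero_on_null_preimage:
  assumes "represents u (mderiv \<beta> T)" "represents h (mderiv (mi_suc \<beta> i) T)" "N \<in> null_sets lborel"
  shows "AE x in lebesgue. u x \<in> N \<longrightarrow> h x = 0"
proof -
  obtain u' h' where *: "loc_int u'" "AE x in lebesgue. u x = u' x" "mderiv \<beta> T = dist_of u'"
      "loc_int h'" "AE x in lebesgue. h x = h' x" "mderiv (mi_suc \<beta> i) T = dist_of h'"
    using assms unfolding represents_iff by blast
  have "weak_deriv (axis i 1) u' h'" by (rule weak_deriv_mderiv[OF *(1,4,3,6)])
  from AE_completion[OF weak_deriv_zero_on_null_preimage[OF this axis_in_Basis assms(3)]] *(5,2)
  show ?thesis by eventually_elim simp
qed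

section \<open>From weak to classical derivatives on the line\<close>

lemma AE_obtain_in_open:
  fixes U :: "'a::euclidean_space set"
  assumes "AE x in lborel. P x" "open U" "U \<noteq> {}"
  obtains x where "x \<in> U" "P x"
proof (rule ccontr)
  assume "\<not> thesis"
  with that have "\<not> P x" if "x \<in> U" for x using \<open>x \<in> U\<close> by blast
  then have "AE x in lebesgue. x \<notin> U"
    by (intro AE_completion) (use assms(1) in \<open>auto elim!: eventually_mono\<close>)
  then have "negligible U"
    using \<open>open U\<close> by (simp add: negligible_iff_null_sets AE_iff_null_sets)
  then show False using open_not_negligible assms(2,3) by blast
qed

lemma continuous_eq_if_AE_eq:
  fixes f g :: "real \<Rightarrow> real"
  assumes "open S" "continuous_on S f" "continuous_on S g" "AE x in lborel. x \<in> S \<longrightarrow> f x = g x" "x \<in> S"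
  shows "f x = g x"
proof (rule ccontr)
  assume "f x \<noteq> g x"
  define U where "U = S \<inter> (\<lambda>x. f x - g x) -` (- {0})"
  have "open U" unfolding U_def
    by (rule continuous_open_preimage[OF continuous_on_diff[OF assms(2,3)] assms(1)]) auto
  moreover have "x \<in> U" using \<open>f x \<noteq> g x\<close> assms(5) by (simp add: U_def)
  ultimately obtain y where "y \<in> U" "y \<in> S \<longrightarrow> f y = g y"
    using AE_obtain_in_open[OF assms(4), of U] by blast
  then show False by (simp add: U_def)
qed

lemma continuous_loc_int:
  fixes v :: "'a::euclidean_space \<Rightarrow> real"
  assumes "continuous_on UNIV v"
  shows "loc_int v"
  unfolding loc_int_def
proof (intro conjI allI impI)
  show "v \<in> borel_measurable borel" using assms by (rule borel_measurable_continuous_onI)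
  fix K :: "'a set" assume "compact K"
  from borel_integrable_compact[OF this continuous_on_subset[OF assms subset_UNIV]]
  show "integrable lborel (\<lambda>x. indicator K x * v x)"
    by (rule Bochner_Integration.integrable_cong[THEN iffD1, rotated -1]) (auto simp: indicator_def)
qed

lemma ray_primitive_continuous:
  fixes w :: "real \<Rightarrow> real"
  assumes "loc_int w"
  shows "continuous_on {0..} (\<lambda>t. integral {0..t} w)"
  unfolding continuous_on_eq_continuous_within
proof
  fix t :: real assume t: "t \<in> {0..}"
  obtain n :: nat where n: "t < real n" using reals_Archimedean2 by blast
  have "continuous_on {0..real n} (\<lambda>t. integral {0..t} w)"
    by (intro indefinite_integral_continuous_1 loc_int_real_integrable_on assms)
  then have "continuous (at t within {0..real n}) (\<lambda>t. integral {0..t} w)"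
    using t n by (auto simp: continuous_on_eq_continuous_within)
  moreover have "at t within {0..real n} = at t within {0..}"
    by (rule at_within_nhd[of t "{..<real n}"]) (use n in auto)
  ultimately show "continuous (at t within {0..}) (\<lambda>t. integral {0..t} w)" by simp
qed

text \<open>Continuity upgrades the identity on a ray from almost every to every positive
  \<open>t\<close>, so \<open>v\<close> is a genuine primitive to the right of the starting point.
  The starting point has to be generic, so it is picked left of \<open>- real n\<close>, and
  \<open>n\<close> exhausts the line.\<close>

lemma continuous_weak_deriv_differentiable:
  fixes v :: "real \<Rightarrow> real"
  assumes v: "continuous_on UNIV v" and wd: "weak_deriv 1 v u"
  shows "AE y in lborel. (v has_real_derivative u y) (at y)"
proof -
  have u: "loc_int u" using wd by (auto simp: weak_deriv_def)
  have "AE y in lborel. \<forall>n::nat. - real n < y \<longrightarrow> (v has_real_derivative u y) (at y)"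
    unfolding AE_all_countable
  proof
    fix n :: nat
    obtain z where "z \<in> {..<- real n}" "AE t in lborel. t \<ge> 0 \<longrightarrow> v (z + t *\<^sub>R 1) = v z + integral {0..t} (\<lambda>s. u (z + s *\<^sub>R 1))"
      using AE_obtain_in_open[OF weak_deriv_on_rays[OF wd], of "{..<- real n}"] by auto
    then have z: "z < - real n" "AE t in lborel. t \<ge> 0 \<longrightarrow> v (z + t) = v z + integral {0..t} (\<lambda>s. u (z + s))"
      by simp_all
    have w: "loc_int (\<lambda>s. u (z + s))" using loc_int_translate[OF u, of z] by (simp add: add.commute)
    have eq: "v (z + t) = v z + integral {0..t} (\<lambda>s. u (z + s))" if "t > 0" for t
    proof (rule continuous_eq_if_AE_eq[where S="{0<..}" and f="\<lambda>t. v (z + t)"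
          and g="\<lambda>t. v z + integral {0..t} (\<lambda>s. u (z + s))"])
      show "continuous_on {0<..} (\<lambda>t. v (z + t))"
        by (rule continuous_on_compose2[OF v]) (auto intro!: continuous_intros)
      show "continuous_on {0<..} (\<lambda>t. v z + integral {0..t} (\<lambda>s. u (z + s)))"
        by (intro continuous_intros continuous_on_subset[OF ray_primitive_continuous[OF w]]) auto
      show "AE t in lborel. t \<in> {0<..} \<longrightarrow> v (z + t) = v z + integral {0..t} (\<lambda>s. u (z + s))"
        using z(2) by (auto elim!: eventually_mono)
    qed (use that in auto)
    from AE_lborel_translate[OF loc_int_primitive_differentiable[OF w, of 0], of "- z"]
    show "AE y in lborel. - real n < y \<longrightarrow> (v has_real_derivative u y) (at y)"
    proof eventually_elim
      case (elim y)
      show ?case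
      proof
        assume y: "- real n < y"
        let ?I = "\<lambda>t. v z + integral {0..t} (\<lambda>s. u (z + s))"
        have "(?I has_real_derivative u y) (at (y - z))"
          using elim y z(1) by (auto intro!: derivative_eq_intros)
        then have "((\<lambda>t. ?I (t - z)) has_real_derivative u y) (at y)"
          using DERIV_shift[of ?I "u y" y "- z"] by simp
        then show "(v has_real_derivative u y) (at y)"
        proof (rule has_field_derivative_transform_within_open)
          show "open {z<..}" "y \<in> {z<..}" using y z by auto
          show "?I (t - z) = v t" if "t \<in> {z<..}" for t using eq[of "t - z"] that by simp
        qed
      qed
    qed
  qed
  then show ?thesis
  proof eventually_elim
    case (elim y)
    obtain n :: nat where "- y < real n" using reals_Archimedean2 by blast
    then show ?case using elim by (metis minus_less_iff)
  qed
qed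

lemma derivative_reps_top_differentiable:
  assumes "derivative_reps m f F"
  shows "AE y in lborel. (F (m - 1) has_real_derivative F m y) (at y)"
proof -
  have cont: "continuous_on UNIV (F (m - 1))" and rep: "represents (F m) (dist_deriv [1] (dist_of (F (m - 1))))"
    using assms by (auto simp: derivative_reps_def)
  have v: "loc_int (F (m - 1))" by (rule continuous_loc_int[OF cont])
  obtain u where u: "loc_int u" "AE y in lebesgue. F m y = u y" "dist_deriv [1] (dist_of (F (m - 1))) = dist_of u"
    using rep unfolding represents_iff by blast
  have "weak_deriv 1 (F (m - 1)) u"
    unfolding weak_deriv_def
  proof (intro conjI ballI v u)
    fix \<phi> :: "real \<Rightarrow> real" assume \<phi>: "\<phi> \<in> test_functions"
    have d: "directional_deriv 1 \<phi> \<in> test_functions" by (rule test_functions_directional_deriv[OF \<phi>]) simp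
    have "- (\<integral>x. u x * \<phi> x \<partial>lborel) = - dist_deriv [1] (dist_of (F (m - 1))) \<phi>"
      unfolding u(3) dist_of_apply[OF u(1) \<phi>] ..
    also have "\<dots> = (\<integral>x. F (m - 1) x * directional_deriv 1 \<phi> x \<partial>lborel)"
      using \<phi> by (simp add: dist_deriv_def iter_deriv_Cons dist_of_apply[OF v d] del: One_nat_def)
    finally show "(\<integral>x. F (m - 1) x * directional_deriv 1 \<phi> x \<partial>lborel) = - (\<integral>x. u x * \<phi> x \<partial>lborel)" by simp
  qed
  from continuous_weak_deriv_differentiable[OF cont this]
  have "AE y in lborel. (F (m - 1) has_real_derivative u y) (at y)" .
  moreover have "AE y in lborel. F m y = u y" using u(2) by (simp add: AE_completion_iff)
  ultimately show ?thesis by eventually_elim simp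
qed

section \<open>The induction on the order\<close>

lemma mderiv_0: "T \<in> extensional test_functions \<Longrightarrow> mderiv (\<lambda>_. 0) T = T"
proof (rule distribution_eqI)
  fix \<phi> :: "real^'a \<Rightarrow> real" assume "\<phi> \<in> test_functions"
  moreover have "mi_list (\<lambda>_::'a. 0) = []" using length_mi_list[of "\<lambda>_::'a. 0"] by (simp add: mi_order_def)
  ultimately show "mderiv (\<lambda>_. 0) T \<phi> = T \<phi>" by (simp add: mderiv_def dist_deriv_def)
qed simp_all

lemma mi_fact_suc: "mi_fact (mi_suc \<beta> i) = real (Suc (\<beta> i)) * mi_fact \<beta>"
proof -
  have "mi_fact (mi_suc \<beta> i) = fact (Suc (\<beta> i)) * (\<Prod>j\<in>UNIV - {i}. fact (\<beta> j))"
    unfolding mi_fact_def by (subst prod.remove[of _ i]) (auto intro!: prod.cong)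
  moreover have "mi_fact \<beta> = fact (\<beta> i) * (\<Prod>j\<in>UNIV - {i}. fact (\<beta> j))"
    unfolding mi_fact_def by (rule prod.remove) auto
  ultimately show ?thesis by simp
qed

lemma mi_order_Suc_obtain:
  assumes "mi_order \<beta> = Suc k"
  obtains \<gamma> i where "\<beta> = mi_suc \<gamma> i" "mi_order \<gamma> = k"
proof -
  have "\<beta> \<noteq> (\<lambda>_. 0)" using assms mi_order_pos_iff[of \<beta>] by simp
  then obtain i where i: "\<beta> i \<noteq> 0" by auto
  then have eq: "\<beta> = mi_suc (\<beta>(i := \<beta> i - 1)) i" by auto
  moreover have "mi_order (\<beta>(i := \<beta> i - 1)) = k"
    using mi_order_upd[of "\<beta>(i := \<beta> i - 1)" i] eq assms by simp
  ultimately show thesis by (rule that)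
qed

text \<open>Assumption \<open>lower\<close> supplies the derivative one order below, for which the
  formula holds at \<open>x\<close> and at all harmonic points around it. Both sides of that
  identity are then differentiated along these points: the left side gives \<open>k x\<close>, the
  right side gives the formula for the raised index.\<close>

lemma chain_rule_AE:
  fixes G :: "(real^'n::finite) distribution"
  assumes m: "2 \<le> m" and F: "derivative_reps m f F" and g: "represents g G" and D: "partial_reps \<alpha> G D"
    and \<alpha>: "mi_order \<alpha> \<le> m" and fg: "locally_integrable (f \<circ> g)"
    and lower: "\<And>\<beta>. \<beta> \<le> \<alpha> \<Longrightarrow> \<exists>k. represents k (mderiv \<beta> (dist_of (f \<circ> g)))"
    and "\<beta> \<le> \<alpha>" and "represents k (mderiv \<beta> (dist_of (f \<circ> g)))"
  shows "AE x in lebesgue. k x = mi_fact \<beta> * faa_sum \<beta> (\<lambda>s. F s (g x)) (\<lambda>\<gamma>. D \<gamma> x / mi_fact \<gamma>)"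
  using assms(8,9)
proof (induction "mi_order \<beta>" arbitrary: \<beta> k)
  case 0
  then have \<beta>: "\<beta> = (\<lambda>_. 0)" using mi_order_pos_iff[of \<beta>] by auto
  have "represents (f \<circ> g) (mderiv \<beta> (dist_of (f \<circ> g)))"
    using fg unfolding \<beta> by (simp add: mderiv_0 represents_def)
  from represents_unique[OF 0(3) this] show ?case
  proof eventually_elim
    case (elim x)
    have "F 0 = f" using F by (simp add: derivative_reps_def)
    with elim show ?case by (simp add: \<beta> faa_sum_def mi_order_def mi_fact_def tuple_sum_0)
  qed
next
  case (Suc n)
  obtain \<gamma> i where \<beta>: "\<beta> = mi_suc \<gamma> i" and n: "mi_order \<gamma> = n"
    using mi_order_Suc_obtain Suc.hyps(2) by metis
  let ?b = "axis i (1::real) :: real^'n"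
  have \<gamma>\<beta>: "\<gamma> \<le> \<beta>" unfolding \<beta> by (auto simp: le_fun_def)
  then have \<gamma>: "\<gamma> \<le> \<alpha>" using Suc.prems(1) by (rule order_trans)
  have "mi_order \<beta> \<le> mi_order \<alpha>" using mi_order_diff[OF Suc.prems(1)] by linarith
  then have nm: "n < m" using Suc.hyps(2) \<alpha> by linarith
  obtain k' where k': "represents k' (mderiv \<gamma> (dist_of (f \<circ> g)))" using lower[OF \<gamma>] by blast
  have 1: "AE x in lebesgue. \<forall>t\<in>harmonic_points. k' (x + t *\<^sub>R ?b)
      = mi_fact \<gamma> * faa_sum \<gamma> (\<lambda>s. F s (g (x + t *\<^sub>R ?b))) (\<lambda>\<delta>. D \<delta> (x + t *\<^sub>R ?b) / mi_fact \<delta>)"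
    using Suc.hyps(1)[OF n[symmetric] \<gamma> k'] by (rule AE_harmonic_points)
  have 2: "AE x in lebesgue. ((\<lambda>t. k' (x + t *\<^sub>R ?b)) has_real_derivative k x) (at 0 within harmonic_points)"
    using represents_mderiv_has_derivative[OF k'] Suc.prems(2) unfolding \<beta> by blast
  have Drep: "represents (D \<delta>) (mderiv \<delta> G)" if "\<delta> \<le> \<alpha>" for \<delta> using D that by (simp add: partial_reps_def)
  have suc_le: "mi_suc \<delta> i \<le> \<alpha>" if "\<delta> \<le> \<gamma>" for \<delta>
  proof -
    have "mi_suc \<delta> i \<le> \<beta>" using that unfolding \<beta> by (auto simp: le_fun_def)
    then show ?thesis using Suc.prems(1) by (rule order_trans)
  qed
  have 3: "AE x in lebesgue. \<forall>\<delta>\<in>mi_parts \<gamma>. ((\<lambda>t. D \<delta> (x + t *\<^sub>R ?b)) has_real_derivative D (mi_suc \<delta> i) x) (at 0 within harmonic_points)"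
  proof (rule AE_finite_allI[OF finite_mi_parts])
    fix \<delta> assume "\<delta> \<in> mi_parts \<gamma>"
    then have "\<delta> \<le> \<gamma>" by (simp add: mi_parts_def)
    then show "AE x in lebesgue. ((\<lambda>t. D \<delta> (x + t *\<^sub>R ?b)) has_real_derivative D (mi_suc \<delta> i) x) (at 0 within harmonic_points)"
      by (intro represents_mderiv_has_derivative[OF Drep[OF order_trans[OF _ \<gamma>]] Drep[OF suc_le]])
  qed
  have "G \<in> extensional test_functions" using g by (auto simp: represents_def)
  then have g0: "represents g (mderiv (\<lambda>_. 0) G)" using g by (simp add: mderiv_0)
  have "represents (D (mi_unit i)) (mderiv (mi_unit i) G)"
    by (intro Drep suc_le) (auto simp: le_fun_def)
  from represents_mderiv_has_derivative[OF g0 this]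
  have 4: "AE x in lebesgue. ((\<lambda>t. g (x + t *\<^sub>R ?b)) has_real_derivative D (mi_unit i) x) (at 0 within harmonic_points)" .
  \<comment> \<open>Off this null set \<open>F m\<close> is the classical derivative of
    \<open>F (m - 1)\<close>; on it the values of \<open>F m\<close> are arbitrary.\<close>
  obtain N where N: "N \<in> null_sets lborel" "{y. \<not> (F (m - 1) has_real_derivative F m y) (at y)} \<subseteq> N"
    using derivative_reps_top_differentiable[OF F] by (auto simp: eventually_ae_filter)
  have 5: "AE x in lebesgue. \<forall>j\<in>{j. mi_unit j \<le> \<alpha>}. g x \<in> N \<longrightarrow> D (mi_unit j) x = 0"
    by (rule AE_finite_allI) (auto intro!: represents_mderiv_zero_on_null_preimage[OF g0 Drep N(1)] simp del: fun_upd_apply)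
  from 1 2 3 4 5 show ?case
  proof eventually_elim
    case (elim x)
    let ?a = "\<lambda>\<delta> t. D \<delta> (x + t *\<^sub>R ?b) / mi_fact \<delta>"
    let ?c = "\<lambda>s t. F s (g (x + t *\<^sub>R ?b))"
    have unit_fact: "mi_fact (mi_unit j) = 1" for j :: 'n
      using mi_fact_suc[of "\<lambda>_. 0" j] by (simp add: mi_fact_def)
    have cont_g: "continuous (at 0 within harmonic_points) (\<lambda>t. g (x + t *\<^sub>R ?b))"
      using elim(4) by (rule DERIV_continuous)
    have "((\<lambda>t. faa_sum \<gamma> (\<lambda>s. ?c s t) (\<lambda>\<delta>. ?a \<delta> t)) has_real_derivative
      real (Suc (\<gamma> i)) * faa_sum (mi_suc \<gamma> i) (\<lambda>s. ?c s 0) (\<lambda>\<delta>. ?a \<delta> 0)) (at 0 within harmonic_points)"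
    proof (rule faa_sum_has_derivative[OF _ _ harmonic_points_nontrivial])
      fix \<delta> assume "\<delta> \<in> mi_parts \<gamma>"
      then have "(?a \<delta> has_real_derivative D (mi_suc \<delta> i) x / mi_fact \<delta>) (at 0 within harmonic_points)"
        using elim(3) by (intro DERIV_cdivide) auto
      also have "D (mi_suc \<delta> i) x / mi_fact \<delta> = real (Suc (\<delta> i)) * ?a (mi_suc \<delta> i) 0"
        by (simp add: mi_fact_suc del: fun_upd_apply of_nat_Suc)
      finally show "(?a \<delta> has_real_derivative real (Suc (\<delta> i)) * ?a (mi_suc \<delta> i) 0) (at 0 within harmonic_points)" .
    next
      fix s assume s: "s \<le> mi_order \<gamma>"
      have chain: "(?c s has_real_derivative ?c (Suc s) 0 * ?a (mi_unit i) 0) (at 0 within harmonic_points)"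
        if "(F s has_real_derivative F (Suc s) (g x)) (at (g x))"
        using DERIV_chain'[OF elim(4), of "F s" "F (Suc s) (g x)"] that by (simp add: unit_fact del: fun_upd_apply)
      show "(?c s has_real_derivative ?c (Suc s) 0 * ?a (mi_unit i) 0) (at 0 within harmonic_points) \<or>
        continuous (at 0 within harmonic_points) (?c s) \<and> tuple_sum s \<gamma> (\<lambda>\<delta>. ?a \<delta> 0) = 0"
      proof (cases "s < m - 1 \<or> g x \<notin> N")
        case True
        have "(F s has_real_derivative F (Suc s) (g x)) (at (g x))"
        proof (cases "s < m - 1")
          case True
          then show ?thesis using F by (simp add: derivative_reps_def)
        next
          case False
          then have "s = m - 1" "Suc s = m" using s n nm m by auto
          then show ?thesis using True False N(2) by auto
        qed
        then show ?thesis using chain by blast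
      next
        case False
        \<comment> \<open>Here \<open>s = m - 1\<close> is the full order of
          \<open>\<gamma>\<close>, so the cofactor is built from products of \<open>s\<close> first
          derivatives, all zero at \<open>x\<close>; \<open>s > 0\<close> comes from
          \<open>2 \<le> m\<close>. The arbitrary value \<open>F m (g x)\<close> thereby gets the
          coefficient zero.\<close>
        then have sm: "s = m - 1" "s = mi_order \<gamma>" "s > 0" and gN: "g x \<in> N" using s n nm m by auto
        have "isCont (F s) (g x)" using F sm(1) by (simp add: derivative_reps_def continuous_on_eq_continuous_at)
        then have "continuous (at 0 within harmonic_points) (?c s)"
          using continuous_within_compose3[OF _ cont_g, of "F s"] by simp
        moreover have "tuple_sum s \<gamma> (\<lambda>\<delta>. ?a \<delta> 0) = 0"
        proof (rule tuple_sum_top_eq_0[OF sm(2)[symmetric] sm(3)])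
          fix \<delta> assume \<delta>: "\<delta> \<le> \<gamma>" "mi_order \<delta> = 1"
          obtain \<epsilon> j where "\<delta> = mi_suc \<epsilon> j" "mi_order \<epsilon> = 0"
            using mi_order_Suc_obtain[of \<delta> 0] \<delta>(2) by auto
          then have "\<delta> = mi_unit j" using mi_order_pos_iff[of \<epsilon>] by simp
          moreover have "\<delta> \<le> \<alpha>" using \<delta>(1) \<gamma> by (rule order_trans)
          ultimately show "?a \<delta> 0 = 0" using elim(5) gN by simp
        qed
        ultimately show ?thesis by blast
      qed
    qed
    then have "((\<lambda>t. mi_fact \<gamma> * faa_sum \<gamma> (\<lambda>s. ?c s t) (\<lambda>\<delta>. ?a \<delta> t)) has_real_derivative
      mi_fact \<gamma> * (real (Suc (\<gamma> i)) * faa_sum (mi_suc \<gamma> i) (\<lambda>s. ?c s 0) (\<lambda>\<delta>. ?a \<delta> 0))) (at 0 within harmonic_points)"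
      by (rule DERIV_cmult)
    then have "((\<lambda>t. k' (x + t *\<^sub>R ?b)) has_real_derivative
      mi_fact \<gamma> * (real (Suc (\<gamma> i)) * faa_sum (mi_suc \<gamma> i) (\<lambda>s. ?c s 0) (\<lambda>\<delta>. ?a \<delta> 0))) (at 0 within harmonic_points)"
      using elim(1) by (subst harmonic_points_has_derivative_cong) auto
    from has_real_derivative_harmonic_points_unique[OF elim(2) this]
    show ?case unfolding \<beta> mi_fact_suc by (simp add: mult.assoc mult.left_commute del: fun_upd_apply)
  qed
qed

section \<open>Regularity of the outer function\<close>

lemma plateau_exists:
  fixes R :: real
  obtains \<eta> :: "'a::euclidean_space \<Rightarrow> real" where "\<eta> \<in> test_functions" "\<And>x. norm x \<le> R \<Longrightarrow> \<eta> x = 1"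
proof -
  obtain \<rho> :: "'a \<Rightarrow> real" where \<rho>: "\<rho> \<in> test_functions" "(\<integral>y. \<rho> y \<partial>lborel) = 1" by (rule unit_mollifier_exists)
  obtain K where K: "compact K" "\<And>x. x \<notin> K \<Longrightarrow> \<rho> x = 0"
    by (rule test_functions_obtain_support[OF \<rho>(1)]) blast
  obtain C where C: "\<And>x. x \<in> K \<Longrightarrow> norm x \<le> C"
    using compact_imp_bounded[OF K(1)] by (auto simp: bounded_iff)
  \<comment> \<open>The ball is enlarged by the radius \<open>C\<close> of the mollifier, so that
    for norm x \<le> R the whole mass of \<open>\<rho>\<close> around \<open>x\<close> is
    counted.\<close>
  let ?w = "indicator (cball 0 (R + C)) :: 'a \<Rightarrow> real"
  have "displacement lborel ?w (\<lambda>y. y) (R + C)"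
  proof (intro displacement.intro displacement_axioms.intro lborel.sigma_finite_measure_axioms)
    show "integrable lborel ?w"
      by (rule integrable_bounded_compact_support[of _ "cball 0 (R + C)" 1]) (auto intro!: borel_measurable_indicator)
  qed (auto simp: indicator_def split: if_splits)
  then interpret displacement lborel ?w "\<lambda>y. - y" "R + C" by (rule displacement.uminus_displacement)
  show thesis
  proof (rule that)
    show "superpose lborel ?w (\<lambda>y. - y) \<rho> \<in> test_functions" by (rule superpose_test[OF \<rho>(1)])
    fix x :: 'a assume x: "norm x \<le> R"
    have "?w y * \<rho> (x - y) = \<rho> (x - y)" for y
    proof (cases "norm y \<le> R + C")
      case False
      have "norm y \<le> norm x + norm (x - y)" by (metis norm_triangle_sub norm_minus_commute add.commute)
      then have "\<not> norm (x - y) \<le> C" using x False by linarith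
      then have "x - y \<notin> K" using C by blast
      then show ?thesis using K(2) by simp
    qed simp
    then have "superpose lborel ?w (\<lambda>y. - y) \<rho> x = (\<integral>y. \<rho> (x - y) \<partial>lborel)"
      unfolding superpose_def diff_conv_add_uminus[symmetric] by (simp only:)
    also have "\<dots> = 1" using lborel_reflect[OF test_functions_borel[OF \<rho>(1)], of x] \<rho>(2) by simp
    finally show "superpose lborel ?w (\<lambda>y. - y) \<rho> x = 1" .
  qed
qed

lemma integral_shift_loc_int:
  fixes u :: "real \<Rightarrow> real"
  assumes u: "loc_int u"
  shows "integral {c..d} (\<lambda>s. u (s - \<tau>)) = integral {c - \<tau>..d - \<tau>} u"
proof -
  have [measurable]: "u \<in> borel_measurable borel" by (rule loc_int_borel[OF u])
  have u': "loc_int (\<lambda>s. u (s - \<tau>))" using loc_int_translate[OF u, of "- \<tau>"] by simp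
  have "integral {c..d} (\<lambda>s. u (s - \<tau>)) = (\<integral>s. indicator {c..d} s * u (s - \<tau>) \<partial>lborel)"
    by (rule loc_int_real_integrable_on(2)[OF u', symmetric])
  also have "\<dots> = (\<integral>s. indicator {c..d} (s + \<tau>) * u (s + \<tau> - \<tau>) \<partial>lborel)"
    by (rule lborel_translate(2)[symmetric]) measurable
  also have "\<dots> = (\<integral>s. indicator {c - \<tau>..d - \<tau>} s * u s \<partial>lborel)"
    by (intro Bochner_Integration.integral_cong) (auto simp: indicator_def)
  also have "\<dots> = integral {c - \<tau>..d - \<tau>} u" by (rule loc_int_real_integrable_on(2)[OF u])
  finally show ?thesis .
qed

lemma integral_AE_cong_ray:
  fixes u v :: "real \<Rightarrow> real"
  assumes "AE s in lborel. s \<ge> 0 \<longrightarrow> u s = v s"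
  shows "integral {0..t} u = integral {0..t} v"
proof -
  obtain N where N: "N \<in> null_sets lborel" "{s. \<not> (s \<ge> 0 \<longrightarrow> u s = v s)} \<subseteq> N"
    using assms by (auto simp: eventually_ae_filter)
  have "negligible N" using N(1) by (simp add: negligible_iff_null_sets null_sets_completionI)
  then show ?thesis by (rule integral_spike) (use N(2) in auto)
qed

text \<open>The hypothesis is tested on \<open>x \<mapsto> \<theta> (x\<^sub>i)\<close>, cut off far away; \<open>f \<circ> \<theta>\<close> is then read off on a generic line.\<close>

lemma composition_profile:
  fixes \<theta> :: "real \<Rightarrow> real"
  assumes cp: "composition_preserves f (adams_frazier m p :: (real^'n::finite) distribution set)"
    and m: "1 \<le> m" and p: "1 \<le> p" and \<theta>: "smooth \<theta>" and r: "r > 0"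
  obtains P :: "nat \<Rightarrow> real \<Rightarrow> real" and u a c where "loc_int u" "a < - r"
    "\<And>j s. j < m - 1 \<Longrightarrow> s \<in> {-r<..<r} \<Longrightarrow> (P j has_real_derivative P (Suc j) s) (at s)"
    "\<And>j. j < m \<Longrightarrow> continuous_on {-r<..<r} (P j)"
    "AE s in lborel. s \<in> {-r<..<r} \<longrightarrow> f (\<theta> s) = P 0 s"
    "\<And>s. s \<in> {-r<..<r} \<Longrightarrow> P (m - 1) s = c + integral {a..s} u"
proof -
  fix i :: 'n
  define b :: "real^'n" where "b = axis i 1"
  have b: "b \<in> Basis" unfolding b_def by (rule axis_in_Basis)
  have bb: "b \<bullet> b = 1" "norm b = 1" using b by (auto simp: inner_Basis)
  \<comment> \<open>A starting point within distance 1 of \<open>- r0 *\<^sub>R b\<close> has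
    coordinate below \<open>- r\<close>, and parameters up to \<open>2 * r0\<close> carry it past
    \<open>r\<close>. On that stretch the norm is at most \<open>r0 + 1\<close>, where the cutoff
    equals 1.\<close>
  define r0 where "r0 = r + 1"
  obtain \<eta> :: "real^'n \<Rightarrow> real" where \<eta>: "\<eta> \<in> test_functions" "\<And>x. norm x \<le> r0 + 1 \<Longrightarrow> \<eta> x = 1"
    by (rule plateau_exists[where R="r0 + 1"]) blast
  define g where "g = (\<lambda>x. \<theta> (x \<bullet> b) * \<eta> x)"
  have "smooth (\<lambda>x. \<theta> (x \<bullet> b))" using smooth_affine[OF \<theta>, of 1 b 0] by simp
  then have gt: "g \<in> test_functions" unfolding g_def by (rule test_functions_mult[OF _ \<eta>(1)])
  have "dist_of g \<in> adams_frazier m p" by (rule test_functions_adams_frazier[OF gt]) (use m p in auto)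
  moreover have "represents g (dist_of g)"
    unfolding represents_iff using test_functions_loc_int[OF gt] by auto
  ultimately obtain H where H: "H \<in> adams_frazier m p" "represents (f \<circ> g) H"
    using cp unfolding composition_preserves_def by blast
  define \<beta> :: "nat \<Rightarrow> 'n multi_index" where "\<beta> = (\<lambda>j. (\<lambda>_. 0)(i := j))"
  have \<beta>0: "\<beta> 0 = (\<lambda>_. 0)" and \<beta>Suc: "\<beta> (Suc j) = mi_suc (\<beta> j) i" for j by (auto simp: \<beta>_def)
  have \<beta>ord: "mi_order (\<beta> j) = j" for j
  proof (induction j)
    case 0
    then show ?case by (simp add: \<beta>0 mi_order_def)
  qed (simp only: \<beta>Suc mi_order_upd)
  have "\<forall>j. \<exists>h. j \<le> m \<longrightarrow> loc_int h \<and> mderiv (\<beta> j) H = dist_of h"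
    using adams_frazier_mderiv_loc_int[OF H(1) p H(2)] by (simp add: \<beta>ord)
  then obtain h where h: "\<And>j. j \<le> m \<Longrightarrow> loc_int (h j)" "\<And>j. j \<le> m \<Longrightarrow> mderiv (\<beta> j) H = dist_of (h j)"
    by metis
  have Hext: "H \<in> extensional test_functions" using H(2) by (auto simp: represents_def)
  have "represents (h 0) H"
    using h[of 0] Hext unfolding represents_iff by (auto simp: \<beta>0 mderiv_0)
  from represents_unique[OF H(2) this] have fgh: "AE x in lborel. f (g x) = h 0 x"
    by (simp add: AE_completion_iff)
  have wd: "weak_deriv b (h j) (h (Suc j))" if "j < m" for j
    unfolding b_def using that h[of j] h[of "Suc j"]
    by (intro weak_deriv_mderiv[of _ _ "\<beta> j" H]) (auto simp: \<beta>Suc[symmetric] simp del: fun_upd_apply)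
  have "AE z in lborel. \<forall>j\<in>{..<m}. AE t in lborel. t \<ge> 0 \<longrightarrow> h j (z + t *\<^sub>R b) = h j z + integral {0..t} (\<lambda>s. h (Suc j) (z + s *\<^sub>R b))"
    by (rule AE_finite_allI) (auto intro: weak_deriv_on_rays[OF wd b])
  moreover have "AE z in lborel. \<forall>j\<in>{..m}. loc_int (\<lambda>s. h j (z + s *\<^sub>R b))"
    by (rule AE_finite_allI) (auto intro: loc_int_on_lines h)
  moreover have "AE z in lborel. AE t in lborel. f (g (z + t *\<^sub>R b)) = h 0 (z + t *\<^sub>R b)"
    by (rule AE_on_lines[OF fgh])
  ultimately have "AE z in lborel. (\<forall>j\<in>{..<m}. AE t in lborel. t \<ge> 0 \<longrightarrow> h j (z + t *\<^sub>R b) = h j z + integral {0..t} (\<lambda>s. h (Suc j) (z + s *\<^sub>R b)))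
      \<and> (\<forall>j\<in>{..m}. loc_int (\<lambda>s. h j (z + s *\<^sub>R b))) \<and> (AE t in lborel. f (g (z + t *\<^sub>R b)) = h 0 (z + t *\<^sub>R b))"
    by eventually_elim blast
  then obtain z where z: "z \<in> ball (- r0 *\<^sub>R b) 1"
      "\<And>j. j < m \<Longrightarrow> AE t in lborel. t \<ge> 0 \<longrightarrow> h j (z + t *\<^sub>R b) = h j z + integral {0..t} (\<lambda>s. h (Suc j) (z + s *\<^sub>R b))"
      "\<And>j. j \<le> m \<Longrightarrow> loc_int (\<lambda>s. h j (z + s *\<^sub>R b))"
      "AE t in lborel. f (g (z + t *\<^sub>R b)) = h 0 (z + t *\<^sub>R b)"
    by (rule AE_obtain_in_open[of _ "ball (- r0 *\<^sub>R b) 1"]) auto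
  define \<tau> where "\<tau> = z \<bullet> b"
  have z1: "norm (z + r0 *\<^sub>R b) < 1" using z(1) by (simp add: dist_norm norm_minus_commute add.commute)
  have "\<bar>(z + r0 *\<^sub>R b) \<bullet> b\<bar> \<le> norm (z + r0 *\<^sub>R b)" by (rule Basis_le_norm[OF b])
  then have \<tau>: "- r0 - 1 < \<tau>" "\<tau> < - r" using z1 by (auto simp: \<tau>_def inner_add_left bb r0_def)
  have gz: "g (z + t *\<^sub>R b) = \<theta> (\<tau> + t)" if "t \<in> {0..2 * r0}" for t
  proof -
    have "z + t *\<^sub>R b = (z + r0 *\<^sub>R b) + (t - r0) *\<^sub>R b" by (simp add: algebra_simps)
    then have "norm (z + t *\<^sub>R b) \<le> norm (z + r0 *\<^sub>R b) + norm ((t - r0) *\<^sub>R b)" by (metis norm_triangle_ineq)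
    also have "\<dots> \<le> r0 + 1" using z1 that bb by auto
    finally have "\<eta> (z + t *\<^sub>R b) = 1" by (rule \<eta>(2))
    then show ?thesis by (simp add: g_def \<tau>_def inner_add_left bb)
  qed
  \<comment> \<open>The continuous representatives along the chosen line. As the integrand agrees
    almost everywhere with the next one, which is continuous for \<open>j < m - 1\<close>, each of
    these is classically differentiable.\<close>
  define \<Phi> where "\<Phi> = (\<lambda>j t. h j z + integral {0..t} (\<lambda>s. h (Suc j) (z + s *\<^sub>R b)))"
  have \<Phi>cont: "continuous_on {0..} (\<Phi> j)" if "j < m" for j
    unfolding \<Phi>_def using that by (intro continuous_intros ray_primitive_continuous z(3)) auto
  have \<Phi>deriv: "(\<Phi> j has_real_derivative \<Phi> (Suc j) t) (at t)" if j: "j < m - 1" and t: "t > 0" for j t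
  proof -
    have ae: "AE s in lborel. s \<ge> 0 \<longrightarrow> h (Suc j) (z + s *\<^sub>R b) = \<Phi> (Suc j) s"
      unfolding \<Phi>_def using z(2)[of "Suc j"] j by simp
    have eq: "\<Phi> j = (\<lambda>t. h j z + integral {0..t} (\<Phi> (Suc j)))"
    proof
      fix t
      have "\<Phi> j t = h j z + integral {0..t} (\<lambda>s. h (Suc j) (z + s *\<^sub>R b))" by (simp add: \<Phi>_def)
      also have "\<dots> = h j z + integral {0..t} (\<Phi> (Suc j))" by (simp only: integral_AE_cong_ray[OF ae])
      finally show "\<Phi> j t = h j z + integral {0..t} (\<Phi> (Suc j))" .
    qed
    have "continuous_on {0..t+1} (\<Phi> (Suc j))"
      by (rule continuous_on_subset[OF \<Phi>cont]) (use j in auto)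
    then have "((\<lambda>t. integral {0..t} (\<Phi> (Suc j))) has_real_derivative \<Phi> (Suc j) t) (at t within {0..t+1})"
      by (rule integral_has_real_derivative) (use t in auto)
    then have "((\<lambda>t. integral {0..t} (\<Phi> (Suc j))) has_real_derivative \<Phi> (Suc j) t) (at t)"
      using t by (simp add: at_within_Icc_at)
    then show ?thesis unfolding eq by (auto intro!: derivative_eq_intros)
  qed
  show thesis
  proof (rule that[of "\<lambda>s. h m (z + (s - \<tau>) *\<^sub>R b)" \<tau> "\<lambda>j s. \<Phi> j (s - \<tau>)" "h (m - 1) z"])
    show "loc_int (\<lambda>s. h m (z + (s - \<tau>) *\<^sub>R b))"
      using loc_int_translate[OF z(3)[of m], of "- \<tau>"] by simp
    show "\<tau> < - r" by (rule \<tau>)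
    show "((\<lambda>s. \<Phi> j (s - \<tau>)) has_real_derivative \<Phi> (Suc j) (s - \<tau>)) (at s)"
      if "j < m - 1" "s \<in> {-r<..<r}" for j s
      using \<Phi>deriv[OF that(1), of "s - \<tau>"] that(2) \<tau> DERIV_shift[of "\<Phi> j" "\<Phi> (Suc j) (s - \<tau>)" s "- \<tau>"] by simp
    show "continuous_on {-r<..<r} (\<lambda>s. \<Phi> j (s - \<tau>))" if "j < m" for j
      by (rule continuous_on_compose2[OF \<Phi>cont[OF that]]) (use \<tau> in \<open>auto intro!: continuous_intros\<close>)
    show "AE s in lborel. s \<in> {-r<..<r} \<longrightarrow> f (\<theta> s) = \<Phi> 0 (s - \<tau>)"
    proof -
      have "AE t in lborel. t \<in> {0..2 * r0} \<longrightarrow> f (\<theta> (\<tau> + t)) = \<Phi> 0 t"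
        using z(4) z(2)[of 0] m by (auto elim!: eventually_elim2 simp: gz \<Phi>_def)
      from AE_lborel_translate[OF this, of "- \<tau>"] show ?thesis
        by (rule eventually_mono) (use \<tau> in \<open>auto simp: r0_def\<close>)
    qed
    show "\<Phi> (m - 1) (s - \<tau>) = h (m - 1) z + integral {\<tau>..s} (\<lambda>s. h m (z + (s - \<tau>) *\<^sub>R b))" for s
      using integral_shift_loc_int[OF z(3)[of m], of \<tau> s \<tau>] m by (simp add: \<Phi>_def)
  qed
qed

text \<open>Take an inner function that equals \<open>t\<close> on the negative half line and
  increases strictly on the positive one. The continuous version \<open>Q\<close> of the composite
  is \<open>f t\<close> on the left and agrees with \<open>P\<close> of the inner function on the
  right; its continuity at 0 gives \<open>f t = Q 0 = P t\<close>.\<close>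

lemma composition_profile_everywhere:
  assumes cp: "composition_preserves f (adams_frazier m p :: (real^'n::finite) distribution set)"
    and m: "1 \<le> m" and p: "1 \<le> p" and r: "r > 0"
    and P: "continuous_on {-r<..<r} P" "AE s in lborel. s \<in> {-r<..<r} \<longrightarrow> f s = P s"
    and t: "t \<in> {-r<..<r}"
  shows "f t = P t"
proof -
  define \<theta> where "\<theta> = (\<lambda>s. t + flat_mono 0 s)"
  have sm: "smooth \<theta>" unfolding \<theta>_def by (intro smooth_add smooth_const smooth_flat_mono)
  obtain Q where Q: "continuous_on {-1<..<1} Q" "AE s in lborel. s \<in> {-1<..<1} \<longrightarrow> f (\<theta> s) = Q s"
  proof (rule composition_profile[OF cp m p sm, of 1])
    show "(0::real) < 1" by simp
    fix Q :: "nat \<Rightarrow> real \<Rightarrow> real"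
    assume "\<And>j. j < m \<Longrightarrow> continuous_on {-1<..<1} (Q j)" "AE s in lborel. s \<in> {-1<..<1} \<longrightarrow> f (\<theta> s) = Q 0 s"
    then show thesis using that[of "Q 0"] m by simp
  qed
  have Q0: "isCont Q 0" using Q(1) by (simp add: continuous_on_eq_continuous_at)
  have left: "Q s = f t" if "s \<in> {-1<..<0}" for s
  proof (rule continuous_eq_if_AE_eq[where S="{-1<..<0}" and f=Q and g="\<lambda>_. f t", OF _ _ _ _ that])
    show "AE x in lborel. x \<in> {-1<..<0} \<longrightarrow> Q x = f t"
      using Q(2) by (rule eventually_mono) (auto simp: \<theta>_def flat_mono_def)
  qed (auto intro: continuous_on_subset[OF Q(1)])
  have "(Q \<longlongrightarrow> f t) (at_left 0)"
    by (rule tendsto_eventually) (auto simp: eventually_at left intro!: exI[of _ 1])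
  moreover have "(Q \<longlongrightarrow> Q 0) (at_left 0)" using Q0 by (simp add: isCont_def filterlim_at_split)
  ultimately have 1: "Q 0 = f t" using tendsto_unique trivial_limit_at_left_real by blast
  have \<theta>0: "\<theta> 0 = t" by (simp add: \<theta>_def flat_mono_def)
  have \<theta>cont: "continuous_on UNIV \<theta>" by (rule smooth_continuous_on[OF sm])
  have "open (\<theta> -` {-r<..<r})" by (rule open_vimage[OF _ \<theta>cont]) simp
  moreover have "0 \<in> \<theta> -` {-r<..<r}" using t \<theta>0 by simp
  ultimately obtain e where e: "e > 0" "ball 0 e \<subseteq> \<theta> -` {-r<..<r}" using open_contains_ball by blast
  define \<delta> where "\<delta> = min e 1"
  have \<delta>: "\<delta> > 0" "\<delta> \<le> 1" "\<And>s. s \<in> {0<..<\<delta>} \<Longrightarrow> \<theta> s \<in> {-r<..<r}"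
    using e by (auto simp: \<delta>_def dist_real_def subset_iff)
  obtain N where N: "N \<in> null_sets lborel" "{s. \<not> (s \<in> {-r<..<r} \<longrightarrow> f s = P s)} \<subseteq> N"
    using P(2) by (auto simp: eventually_ae_filter)
  \<comment> \<open>The inner function has nonzero derivative for s > 0, so it pulls the null set on
    which \<open>f\<close> and \<open>P\<close> may differ back to a null set.\<close>
  have "negligible {s. s > 0 \<and> \<theta> s \<in> N}"
  proof (rule negligible_critical_preimage[where G=\<theta> and N=N])
    show "negligible N" using N(1) by (simp add: negligible_iff_null_sets null_sets_completionI)
    fix s assume s: "s \<in> {s. s > 0 \<and> \<theta> s \<in> N}"
    have "(\<theta> has_real_derivative 0 + (- real 0 * flat_mono (Suc 0) s + flat_mono (0+2) s)) (at s)"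
      unfolding \<theta>_def by (intro DERIV_add DERIV_const flat_mono_deriv)
    moreover have "0 + (- real 0 * flat_mono (Suc 0) s + flat_mono (0+2) s) \<noteq> 0" using s by (simp add: flat_mono_def)
    ultimately show "\<theta> s \<in> N \<and> (\<exists>d. d \<noteq> 0 \<and> (\<theta> has_real_derivative d) (at s))" using s by blast
  qed
  then have "AE s in lebesgue. s \<notin> {s. s > 0 \<and> \<theta> s \<in> N}"
    unfolding negligible_iff_null_sets by (rule AE_not_in)
  then have null: "AE s in lborel. s \<notin> {s. s > 0 \<and> \<theta> s \<in> N}" by (simp add: AE_completion_iff)
  have right: "Q s = P (\<theta> s)" if "s \<in> {0<..<\<delta>}" for s
  proof (rule continuous_eq_if_AE_eq[where S="{0<..<\<delta>}" and f=Q and g="\<lambda>s. P (\<theta> s)", OF _ _ _ _ that])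
    show "continuous_on {0<..<\<delta>} Q" by (rule continuous_on_subset[OF Q(1)]) (use \<delta> in auto)
    show "continuous_on {0<..<\<delta>} (\<lambda>s. P (\<theta> s))"
      by (rule continuous_on_compose2[OF P(1) continuous_on_subset[OF \<theta>cont]]) (use \<delta>(3) in auto)
    show "AE x in lborel. x \<in> {0<..<\<delta>} \<longrightarrow> Q x = P (\<theta> x)"
      using Q(2) null
    proof eventually_elim
      case (elim s)
      show ?case
      proof
        assume s: "s \<in> {0<..<\<delta>}"
        then have "\<theta> s \<notin> N" using elim(2) by auto
        then have "f (\<theta> s) = P (\<theta> s)" using N(2) \<delta>(3)[OF s] by blast
        then show "Q s = P (\<theta> s)" using elim(1) s \<delta> by auto
      qed
    qed
  qed simp
  have "isCont P (\<theta> 0)" using P(1) t by (simp add: \<theta>0 continuous_on_eq_continuous_at)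
  moreover have "isCont \<theta> 0" using smooth_isCont[OF sm] .
  ultimately have "isCont (\<lambda>s. P (\<theta> s)) 0" by (rule isCont_o2[rotated])
  then have "((\<lambda>s. P (\<theta> s)) \<longlongrightarrow> P t) (at_right 0)" by (simp add: isCont_def filterlim_at_split \<theta>0)
  moreover have "\<forall>\<^sub>F s in at_right 0. P (\<theta> s) = Q s"
    unfolding eventually_at using \<delta>(1) right by (intro exI[of _ \<delta>]) (auto simp: dist_real_def)
  ultimately have "(Q \<longlongrightarrow> P t) (at_right 0)" by (rule Lim_transform_eventually)
  moreover have "(Q \<longlongrightarrow> Q 0) (at_right 0)" using Q0 by (simp add: isCont_def filterlim_at_split)
  ultimately have "Q 0 = P t" using tendsto_unique trivial_limit_at_right_real by blast
  with 1 show ?thesis by simp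
qed

section \<open>Existence of the derivatives of the outer function\<close>

lemma loc_int_indicator:
  assumes u: "loc_int u" and S [measurable]: "S \<in> sets borel"
  shows "loc_int (\<lambda>x. indicator S x * u x)"
  unfolding loc_int_def
proof (intro conjI allI impI)
  note [measurable] = loc_int_borel[OF u]
  show "(\<lambda>x. indicator S x * u x) \<in> borel_measurable borel" by measurable
  fix K :: "'a set" assume K: "compact K"
  then have [measurable]: "K \<in> sets borel" by (simp add: borel_compact)
  show "integrable lborel (\<lambda>x. indicator K x * (indicator S x * u x))"
    by (rule Bochner_Integration.integrable_bound[OF loc_int_integrable[OF u K]])
      (auto simp: indicator_def)
qed

text \<open>As \<open>u\<close> is only locally integrable, the primitive is written as an average
  of a cut-off of \<open>u\<close> along a segment. Transposition turns the derivative of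
  \<open>\<phi>\<close> into the difference \<open>\<phi> (x + L) - \<phi> x\<close>.\<close>

lemma primitive_integration_by_parts:
  fixes u :: "real \<Rightarrow> real"
  assumes u: "loc_int u" and \<phi>: "\<phi> \<in> test_functions" and a: "a < - r"
    and supp: "\<And>x. x \<notin> {-r<..<r} \<Longrightarrow> \<phi> x = 0" "\<And>x. x \<notin> {-r<..<r} \<Longrightarrow> directional_deriv 1 \<phi> x = 0"
    and v: "\<And>x. x \<in> {-r<..<r} \<Longrightarrow> v x = c + integral {a..x} u"
  shows "(\<integral>x. v x * directional_deriv 1 \<phi> x \<partial>lborel) = - (\<integral>x. u x * \<phi> x \<partial>lborel)"
proof (cases "r > 0")
  case False
  then have "\<phi> x = 0" "directional_deriv 1 \<phi> x = 0" for x using supp[of x] by auto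
  then show ?thesis by simp
next
  case True
  \<comment> \<open>This length carries every point of \<open>{a..r}\<close> to the right of the
    support, so the term at \<open>x + L\<close> vanishes; it also lets the segment from any
    \<open>z\<close> in the interval reach back to \<open>a\<close>.\<close>
  define L where "L = r - a"
  have L: "L \<ge> 0" using a True by (simp add: L_def)
  define w where "w = (\<lambda>x. indicator {a..r} x * u x)"
  have w: "loc_int w" unfolding w_def by (rule loc_int_indicator[OF u]) simp
  have [measurable]: "w \<in> borel_measurable borel" by (rule loc_int_borel[OF w])
  have d: "directional_deriv 1 \<phi> \<in> test_functions" by (rule test_functions_directional_deriv[OF \<phi>]) simp
  interpret D: displacement lborel "ray_weight L" "\<lambda>s. s *\<^sub>R (1::real)" "max \<bar>0\<bar> \<bar>L\<bar> * norm (1::real)"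
    by (rule ray_displacement)
  interpret D': displacement lborel "ray_weight L" "\<lambda>s. - (s *\<^sub>R (1::real))" "max \<bar>0\<bar> \<bar>L\<bar> * norm (1::real)"
    by (rule D.uminus_displacement)
  let ?V = "superpose lborel (ray_weight L) (\<lambda>s. - (s *\<^sub>R 1)) w"
  have V: "?V z = integral {a..z} u" if z: "z \<in> {-r<..<r}" for z
  proof -
    have "?V z = (\<integral>s. ray_weight L (z - (z - s)) * w (z - s) \<partial>lborel)" by (simp add: superpose_def)
    also have "\<dots> = (\<integral>y. ray_weight L (z - y) * w y \<partial>lborel)"
      by (rule lborel_reflect[of "\<lambda>y. ray_weight L (z - y) * w y" z]) measurable
    also have "\<dots> = (\<integral>y. indicator {a..z} y * u y \<partial>lborel)"
      by (intro Bochner_Integration.integral_cong) (use z a in \<open>auto simp: ray_weight_def indicator_def w_def L_def\<close>)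
    also have "\<dots> = integral {a..z} u" by (rule loc_int_real_integrable_on(2)[OF u])
    finally show ?thesis .
  qed
  have dneg: "directional_deriv (- 1) \<phi> = (\<lambda>x. - directional_deriv 1 \<phi> x)"
    using directional_deriv_scaleR[OF smooth_differentiable[OF test_functionsD(1)[OF \<phi>]], of "-1" 1] by (simp add: fun_eq_iff)
  have S: "superpose lborel (ray_weight L) (\<lambda>s. - (- (s *\<^sub>R 1))) (directional_deriv 1 \<phi>) x = \<phi> (x + L) - \<phi> x" for x
    using superpose_ray_directional_deriv[OF \<phi> L, where b="-1" and x=x] unfolding dneg
    by (simp add: superpose_def)
  have "(\<integral>x. v x * directional_deriv 1 \<phi> x \<partial>lborel) = (\<integral>x. c * directional_deriv 1 \<phi> x + ?V x * directional_deriv 1 \<phi> x \<partial>lborel)"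
  proof (rule Bochner_Integration.integral_cong[OF refl])
    fix x show "v x * directional_deriv 1 \<phi> x = c * directional_deriv 1 \<phi> x + ?V x * directional_deriv 1 \<phi> x"
      using supp(2)[of x] v[of x] V[of x] by (cases "x \<in> {-r<..<r}") (auto simp: distrib_right)
  qed
  also have "\<dots> = c * (\<integral>x. directional_deriv 1 \<phi> x \<partial>lborel) + (\<integral>x. ?V x * directional_deriv 1 \<phi> x \<partial>lborel)"
    by (subst Bochner_Integration.integral_add[OF integrable_mult_right[OF test_functions_integrable[OF d]]
          loc_int_integrable_test[OF D'.loc_int_superpose(1)[OF w] d]]) simp
  also have "(\<integral>x. directional_deriv 1 \<phi> x \<partial>lborel) = 0"
    by (rule test_functions_integral_deriv_zero[OF \<phi>]) simp
  also have "(\<integral>x. ?V x * directional_deriv 1 \<phi> x \<partial>lborel) = (\<integral>x. w x * (\<phi> (x + L) - \<phi> x) \<partial>lborel)"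
    using D'.integral_superpose[OF w d] by (simp only: S)
  also have "\<dots> = (\<integral>x. - (u x * \<phi> x) \<partial>lborel)"
  proof (rule Bochner_Integration.integral_cong[OF refl])
    fix x show "w x * (\<phi> (x + L) - \<phi> x) = - (u x * \<phi> x)"
      using supp(1)[of x] supp(1)[of "x + L"] a by (auto simp: w_def indicator_def L_def)
  qed
  finally show ?thesis by simp
qed

text \<open>With the identity as inner function, \<open>f\<close> coincides on each interval with a
  profile having \<open>m - 1\<close> continuous derivatives, the last of them a primitive of a
  locally integrable function. The profiles depend on the interval, whereas iterated derivatives of
  \<open>f\<close> are global, so everything is stated for the latter.\<close>

lemma derivative_reps_exists:
  assumes cp: "composition_preserves f (adams_frazier m p :: (real^'n::finite) distribution set)"
    and m: "2 \<le> m" and p: "1 \<le> p"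
  shows "\<exists>F. derivative_reps m f F"
proof -
  \<comment> \<open>\<open>deriv\<close> is total, so \<open>F m\<close> has some value even where
    \<open>F (m - 1)\<close> is not differentiable. These points form a null set, which does not
    change the class.\<close>
  define F where "F = (\<lambda>s. (deriv ^^ s) f)"
  have FSuc: "F (Suc j) = deriv (F j)" for j by (simp add: F_def)
  have m1: "1 \<le> m" using m by simp
  have id: "smooth (\<lambda>x::real. x)"
    by (rule smooth_real_primitive[where k'="\<lambda>_. 1"]) (auto intro: smooth_const)
  have profile: "\<exists>P u a c. loc_int u \<and> a < - r \<and> (\<forall>j<m. \<forall>s\<in>{-r<..<r}. F j s = P j s) \<and>
      (\<forall>j<m - 1. \<forall>s\<in>{-r<..<r}. (P j has_real_derivative P (Suc j) s) (at s)) \<and>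
      continuous_on {-r<..<r} (P (m - 1)) \<and> (\<forall>s\<in>{-r<..<r}. P (m - 1) s = c + integral {a..s} u)" if r: "r > 0" for r
  proof (rule composition_profile[OF cp m1 p id r])
    fix P :: "nat \<Rightarrow> real \<Rightarrow> real" and u a c
    assume P: "loc_int u" "a < - r"
      "\<And>j s. j < m - 1 \<Longrightarrow> s \<in> {-r<..<r} \<Longrightarrow> (P j has_real_derivative P (Suc j) s) (at s)"
      "\<And>j. j < m \<Longrightarrow> continuous_on {-r<..<r} (P j)"
      "AE s in lborel. s \<in> {-r<..<r} \<longrightarrow> f s = P 0 s"
      "\<And>s. s \<in> {-r<..<r} \<Longrightarrow> P (m - 1) s = c + integral {a..s} u"
    have F: "\<forall>s\<in>{-r<..<r}. F j s = P j s" if "j < m" for j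
      using that
    proof (induction j)
      case 0
      then show ?case
        using composition_profile_everywhere[OF cp m1 p r P(4)[OF 0] P(5)] by (simp add: F_def)
    next
      case (Suc j)
      show ?case
      proof
        fix s assume s: "s \<in> {-r<..<r}"
        have "(P j has_real_derivative P (Suc j) s) (at s)" using P(3) Suc.prems s by simp
        then have "(F j has_real_derivative P (Suc j) s) (at s)"
          by (rule has_field_derivative_transform_within_open[of _ _ _ "{-r<..<r}"]) (use Suc s in auto)
        then show "F (Suc j) s = P (Suc j) s" unfolding FSuc by (rule DERIV_imp_deriv)
      qed
    qed
    show ?thesis
      by (intro exI[of _ P] exI[of _ u] exI[of _ a] exI[of _ c]) (use P F m in auto)
  qed
  have Fderiv: "(F j has_real_derivative F (Suc j) t) (at t)" if j: "j < m - 1" for j t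
  proof -
    define r where "r = \<bar>t\<bar> + 1"
    have r: "r > 0" "t \<in> {-r<..<r}" by (auto simp: r_def)
    obtain P where P: "\<forall>j<m. \<forall>s\<in>{-r<..<r}. F j s = P j s"
      "\<forall>j<m - 1. \<forall>s\<in>{-r<..<r}. (P j has_real_derivative P (Suc j) s) (at s)" using profile[OF r(1)] by blast
    have "(P j has_real_derivative P (Suc j) t) (at t)" using P(2) j r by blast
    then have "(F j has_real_derivative P (Suc j) t) (at t)"
      by (rule has_field_derivative_transform_within_open[of _ _ _ "{-r<..<r}"]) (use P(1) j r in auto)
    then show ?thesis using P(1) j r by simp
  qed
  have Fcont: "continuous_on UNIV (F (m - 1))"
  proof (rule continuous_at_imp_continuous_on, rule ballI)
    fix t :: real
    define r where "r = \<bar>t\<bar> + 1"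
    have r: "r > 0" "t \<in> {-r<..<r}" by (auto simp: r_def)
    obtain P where P: "\<forall>j<m. \<forall>s\<in>{-r<..<r}. F j s = P j s" "continuous_on {-r<..<r} (P (m - 1))"
      using profile[OF r(1)] by blast
    have "continuous_on {-r<..<r} (F (m - 1))"
      by (rule continuous_on_cong[THEN iffD1, OF refl _ P(2)]) (use P(1) m in auto)
    then show "isCont (F (m - 1)) t" using r(2) by (simp add: continuous_on_eq_continuous_at)
  qed
  let ?v = "F (m - 1)" and ?w = "F m"
  have top: "\<exists>u a c. loc_int u \<and> a < - r \<and> (\<forall>s\<in>{-r<..<r}. ?v s = c + integral {a..s} u) \<and>
      (AE s in lebesgue. s \<in> {-r<..<r} \<longrightarrow> ?w s = u s)" if r: "r > 0" for r
  proof -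
    obtain P u a c where P: "loc_int u" "a < - r" "\<forall>j<m. \<forall>s\<in>{-r<..<r}. F j s = P j s"
      "\<forall>s\<in>{-r<..<r}. P (m - 1) s = c + integral {a..s} u" using profile[OF r] by blast
    then have v: "\<forall>s\<in>{-r<..<r}. ?v s = c + integral {a..s} u" using m by simp
    have "AE s in lebesgue. s \<in> {-r<..<r} \<longrightarrow> ?w s = u s"
    proof (rule AE_completion)
      show "AE s in lborel. s \<in> {-r<..<r} \<longrightarrow> ?w s = u s"
        using loc_int_primitive_differentiable[OF P(1), of a]
      proof eventually_elim
        case (elim s)
        show ?case
        proof
          assume s: "s \<in> {-r<..<r}"
          have "((\<lambda>s. c + integral {a..s} u) has_real_derivative u s) (at s)"
            using elim s P(2) by (auto intro!: derivative_eq_intros)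
          then have "(?v has_real_derivative u s) (at s)"
            by (rule has_field_derivative_transform_within_open[of _ _ _ "{-r<..<r}"]) (use v s in auto)
          then have "deriv ?v s = u s" by (rule DERIV_imp_deriv)
          then show "?w s = u s" using FSuc[of "m - 1"] m by simp
        qed
      qed
    qed
    then show ?thesis using P v by blast
  qed
  have "locally_integrable ?w"
    unfolding locally_integrable_def set_integrable_def
  proof (intro allI impI)
    fix K :: "real set" assume K: "compact K"
    obtain B where B: "B > 0" "\<And>x. x \<in> K \<Longrightarrow> norm x \<le> B" using compact_imp_bounded[OF K] by (auto simp: bounded_pos)
    define r where "r = B + 1"
    have r: "r > 0" "K \<subseteq> {-r<..<r}" using B by (force simp: r_def)+
    obtain u where u: "loc_int u" "AE s in lebesgue. s \<in> {-r<..<r} \<longrightarrow> ?w s = u s" using top[OF r(1)] by blast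
    have "locally_integrable u" by (rule locally_integrableI[OF u(1)]) simp
    then have i: "integrable lebesgue (\<lambda>x. indicator K x *\<^sub>R u x)"
      using K by (simp add: locally_integrable_def set_integrable_def)
    have ae: "AE x in lebesgue. indicator K x *\<^sub>R u x = indicator K x *\<^sub>R ?w x"
      using u(2) by eventually_elim (use r(2) in \<open>auto simp: indicator_def\<close>)
    show "integrable lebesgue (\<lambda>x. indicator K x *\<^sub>R ?w x)"
      using integrable_cong_AE_imp[OF i borel_measurable_lebesgue_cong_AE[OF borel_measurable_integrable[OF i] ae] ae] .
  qed
  then obtain w' where w': "loc_int w'" "AE x in lebesgue. ?w x = w' x" by (rule locally_integrable_borel_version)
  have v: "loc_int ?v" by (rule continuous_loc_int[OF Fcont])
  have "dist_deriv [1] (dist_of ?v) = dist_of w'"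
  proof (rule distribution_eqI)
    fix \<phi> :: "real \<Rightarrow> real" assume \<phi>: "\<phi> \<in> test_functions"
    have d: "directional_deriv 1 \<phi> \<in> test_functions" by (rule test_functions_directional_deriv[OF \<phi>]) simp
    obtain B where B: "B > 0" "\<And>x. x \<in> closure {x. \<phi> x \<noteq> 0} \<Longrightarrow> norm x \<le> B"
      using compact_imp_bounded[OF test_functionsD(2)[OF \<phi>]] by (auto simp: bounded_pos)
    define r where "r = B + 1"
    have r: "r > 0" using B by (simp add: r_def)
    have out: "x \<notin> closure {x. \<phi> x \<noteq> 0}" if "x \<notin> {-r<..<r}" for x
      using B(2)[of x] that by (auto simp: r_def)
    obtain u a c where u: "loc_int u" "a < - r" "\<forall>s\<in>{-r<..<r}. ?v s = c + integral {a..s} u"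
      "AE s in lebesgue. s \<in> {-r<..<r} \<longrightarrow> ?w s = u s" using top[OF r] by blast
    have \<phi>0: "\<phi> x = 0" if "x \<notin> {-r<..<r}" for x by (rule test_functionsD(3)[OF \<phi> out[OF that]])
    have "(\<integral>x. ?v x * directional_deriv 1 \<phi> x \<partial>lborel) = - (\<integral>x. u x * \<phi> x \<partial>lborel)"
    proof (rule primitive_integration_by_parts[OF u(1) \<phi> u(2)])
      show "directional_deriv 1 \<phi> x = 0" if "x \<notin> {-r<..<r}" for x
        by (rule directional_deriv_outside_support[OF out[OF that]])
    qed (use \<phi>0 u(3) in auto)
    \<comment> \<open>\<open>u\<close> belongs to one interval and \<open>w'\<close> to the whole
      line; they agree almost everywhere on the interval that contains the support of
      \<open>\<phi>\<close>.\<close>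
    also have "(\<integral>x. u x * \<phi> x \<partial>lborel) = (\<integral>x. w' x * \<phi> x \<partial>lborel)"
    proof (rule Bochner_Integration.integral_cong_AE)
      have "AE x in lebesgue. u x * \<phi> x = w' x * \<phi> x"
        using u(4) w'(2) by eventually_elim (use \<phi>0 in fastforce)
      then show "AE x in lborel. u x * \<phi> x = w' x * \<phi> x" by (simp add: AE_completion_iff)
    qed (use loc_int_borel[OF u(1)] loc_int_borel[OF w'(1)] test_functions_borel[OF \<phi>] in auto)
    finally show "dist_deriv [1] (dist_of ?v) \<phi> = dist_of w' \<phi>"
      using \<phi> by (simp add: dist_deriv_def iter_deriv_Cons dist_of_apply[OF v d] dist_of_apply[OF w'(1) \<phi>] del: One_nat_def)
  qed simp_all
  then have "represents ?w (dist_deriv [1] (dist_of ?v))" unfolding represents_iff using w' by auto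
  then have "derivative_reps m f F"
    unfolding derivative_reps_def using Fderiv Fcont by (auto simp: F_def)
  then show ?thesis by blast
qed

theorem theorem3:
  fixes m :: nat and p :: real and f :: "real \<Rightarrow> real" and \<alpha> :: "'n::finite multi_index"
  assumes "2 \<le> m" and "1 \<le> p"
    and "composition_preserves f (adams_frazier m p :: (real^'n) distribution set)"
    and "0 < mi_order \<alpha>" and "mi_order \<alpha> \<le> m"
  shows "(\<exists>F. derivative_reps m f F) \<and>
    (\<forall>G \<in> (adams_frazier m p :: (real^'n) distribution set). \<forall>g. represents g G \<longrightarrow>
      (\<exists>D. partial_reps \<alpha> G D) \<and>
      (\<forall>F D. derivative_reps m f F \<and> partial_reps \<alpha> G D \<longrightarrow>
        represents (faa_di_bruno \<alpha> F g D) (mderiv \<alpha> (dist_of (f \<circ> g))) \<and>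
        (\<forall>h. represents h (mderiv \<alpha> (dist_of (f \<circ> g))) \<longrightarrow>
          (AE x in lebesgue. h x = faa_di_bruno \<alpha> F g D x))))"
proof (intro conjI ballI allI impI)
  show "\<exists>F. derivative_reps m f F" by (rule derivative_reps_exists[OF assms(3,1,2)])
next
  fix G :: "(real^'n) distribution" and g assume G: "G \<in> adams_frazier m p" "represents g G"
  have below: "mi_order \<beta> \<le> m" if "\<beta> \<le> \<alpha>" for \<beta>
    using mi_order_diff[OF that] assms(5) by linarith
  have reps: "\<exists>h. represents h (mderiv \<beta> T)"
    if T: "T \<in> adams_frazier m p" "represents v T" and "\<beta> \<le> \<alpha>" for \<beta> v and T :: "(real^'n) distribution"
    using adams_frazier_mderiv_loc_int[OF T(1) assms(2) T(2) below[OF that(3)]]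
    unfolding represents_iff by auto
  have "\<forall>\<beta>. \<exists>h. \<beta> \<le> \<alpha> \<longrightarrow> represents h (mderiv \<beta> G)" using reps[OF G] by blast
  then show "\<exists>D. partial_reps \<alpha> G D" unfolding partial_reps_def by (rule choice)
  fix F D assume FD: "derivative_reps m f F \<and> partial_reps \<alpha> G D"
  obtain H where H: "H \<in> (adams_frazier m p :: (real^'n) distribution set)" "represents (f \<circ> g) H"
    using assms(3) G unfolding composition_preserves_def by blast
  then have fg: "locally_integrable (f \<circ> g)" "H = dist_of (f \<circ> g)" by (auto simp: represents_def)
  have formula: "AE x in lebesgue. h x = faa_di_bruno \<alpha> F g D x"
    if "represents h (mderiv \<alpha> (dist_of (f \<circ> g)))" for h
    unfolding faa_di_bruno_eq_faa_sum[OF assms(4)]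
    using FD reps[OF H] that unfolding fg(2)
    by (intro chain_rule_AE[OF assms(1) _ G(2) _ assms(5) fg(1)]) auto
  then show "AE x in lebesgue. h x = faa_di_bruno \<alpha> F g D x"
    if "represents h (mderiv \<alpha> (dist_of (f \<circ> g)))" for h using that .
  obtain h where h: "represents h (mderiv \<alpha> (dist_of (f \<circ> g)))"
    using reps[OF H order_refl] unfolding fg(2) by blast
  \<comment> \<open>Some representative of the derivative of \<open>f \<circ> g\<close> is already
    available. Almost everywhere equality with it makes the right-hand side a representative too,
    including its local integrability.\<close>
  have "AE x in lebesgue. faa_di_bruno \<alpha> F g D x = h x" using formula[OF h] by eventually_elim simp
  then show "represents (faa_di_bruno \<alpha> F g D) (mderiv \<alpha> (dist_of (f \<circ> g)))" by (rule represents_cong_AE[OF h])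
qed

end
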